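(* Let $c\in H^1(\mathbb R_{\ge0})$ satisfy $c_{\min}\le c(\omega)\le c_{\max}$ for all $\omega\ge0$ (constants $c_{\min},c_{\max}>0$) and $c'\in L^2(\mathbb R_{\ge0})\cap L^\infty(\mathbb R_{\ge0})$. Let $\Omega_o=\bigcup_{j\in\mathbb N}[a_j,b_j]$ with $(a_j)$ unbounded and $0=a_1<b_1\le a_2<b_2\le\cdots$ satisfy either (a) there exist $K>k>0$ with $k(a_n-b_m)-\sum_{j=m+1}^{n-1}K(b_j-a_j)\le1$ for all $n\ge m$ in $\mathbb N$, or (b) there exist $c_0,c_1>0$ with $|\Omega_o\cap I|\ge c_1|I|-c_0$ for all intervals $I\subset\mathbb R_{\ge0}$ and $|\Omega_o\cap[0,L]|>0$ for all $L>0$. Then for every $\gamma>0$ the controlled continuity equation $$\partial_tx(\omega,t)=-\partial_\omega\big(c_L(\omega)x(\omega,t)\big)+\chi_{\Omega^o_L}(\omega)u(\omega,t),\quad c(0)x(0,t)=c(L)x(L,t),\quad x(\cdot,0)=x^0\in L^2(\Omega_L)$$ can be domain-uniformly stabilized with respect to $\mathcal O_\gamma=\{[0,L]:L\ge\gamma\}$ by a state feedback $u=-(k_Bx)|_{\Omega_L^o}$ with $k_B\in L^\infty(\mathbb R_{>0})$; i.e. there are such $k_B$ and $M,\kappa>0$ such that the closed-loop semigroups on $L^2(\Omega_L)$ satisfy $\|\mathcal T(t)\|\le Me^{-\kappa t}$ for all $L\ge\gamma$, $t\ge0$.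
   Context: $\Omega_L=[0,L]$, $c_L=c|_{[0,L]}$, $\Omega^o_L=\Omega_o\cap[0,L]$; $|\cdot|$ is Lebesgue measure. The closed-loop continuity equation is a bounded perturbation of the generator $x\mapsto-(c_Lx)'$ with domain $\{x\in H^1(\Omega_L):c(0)x(0)=c(L)x(L)\}$ on $L^2(\Omega_L)$.
   Formalization: The hypothesis c ∈ H¹(ℝ≥0) contradicts c ≥ c_min > 0 (c cannot be in L² of the half-line); it is read as: c is locally absolutely continuous (H¹ on every [0,L]) with weak derivative c' ∈ L²(ℝ≥0) ∩ L^∞(ℝ≥0). *)

theory Defs
  imports "HOL-Analysis.Analysis"
begin

text \<open>Functions on \<open>\<Omega>_L = [0,L]\<close> are represented by \<open>real \<Rightarrow> real\<close>;
  only their values on \<open>[0,L]\<close> (up to a.e. equality) matter.\<close>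

definition L2_on :: "real \<Rightarrow> (real \<Rightarrow> real) \<Rightarrow> bool" where
  "L2_on L f \<longleftrightarrow> set_borel_measurable lborel {0..L} f
      \<and> set_integrable lborel {0..L} (\<lambda>s. (f s)\<^sup>2)"

definition L2norm :: "real \<Rightarrow> (real \<Rightarrow> real) \<Rightarrow> real" where
  "L2norm L f = sqrt (LINT s:{0..L}|lborel. (f s)\<^sup>2)"

definition ae_eq_on :: "real \<Rightarrow> (real \<Rightarrow> real) \<Rightarrow> (real \<Rightarrow> real) \<Rightarrow> bool" where
  "ae_eq_on L f g \<longleftrightarrow> (AE s in lborel. s \<in> {0..L} \<longrightarrow> f s = g s)"

definition H1_rep :: "real \<Rightarrow> (real \<Rightarrow> real) \<Rightarrow> (real \<Rightarrow> real) \<Rightarrow> bool" where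
  "H1_rep L y g \<longleftrightarrow> L2_on L g \<and>
      (\<forall>s\<in>{0..L}. y s = y 0 + (LINT \<tau>:{0..s}|lborel. g \<tau>))"

text \<open>The observation/control region \<open>\<Omega>_o = \<Union>_j [a_j,b_j]\<close> (indices start at 0).\<close>
definition Omega_o :: "(nat \<Rightarrow> real) \<Rightarrow> (nat \<Rightarrow> real) \<Rightarrow> real set" where
  "Omega_o a b = (\<Union>j. {a j..b j})"

definition CL_dom :: "(real \<Rightarrow> real) \<Rightarrow> real \<Rightarrow> (real \<Rightarrow> real) \<Rightarrow> bool" where
  "CL_dom c L x \<longleftrightarrow> L2_on L x \<and>
     (\<exists>y g. H1_rep L y g \<and> ae_eq_on L x y \<and> c 0 * y 0 = c L * y L)"

text \<open>Graph of the closed-loop generator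
  \<open>x \<mapsto> -(c_L x)' - \<chi>_{\<Omega>^o_L} k_B x\<close> (feedback \<open>u = -(k_B x)|_{\<Omega>^o_L}\<close>);
  \<open>dc\<close> is the weak derivative of \<open>c\<close>, so \<open>(c y)' = dc\<cdot>y + c\<cdot>y'\<close>.\<close>
definition CL_op :: "(real \<Rightarrow> real) \<Rightarrow> (real \<Rightarrow> real) \<Rightarrow> (real \<Rightarrow> real) \<Rightarrow> real set
    \<Rightarrow> real \<Rightarrow> (real \<Rightarrow> real) \<Rightarrow> (real \<Rightarrow> real) \<Rightarrow> bool" where
  "CL_op c dc kB Om L x z \<longleftrightarrow>
     (\<exists>y g. H1_rep L y g \<and> ae_eq_on L x y \<and> c 0 * y 0 = c L * y L \<and>
        ae_eq_on L z (\<lambda>s. - (dc s * y s + c s * g s)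
                          - indicator (Om \<inter> {0..L}) s * kB s * y s))"

definition C0_semigroup_gen :: "real \<Rightarrow> (real \<Rightarrow> (real \<Rightarrow> real) \<Rightarrow> (real \<Rightarrow> real))
    \<Rightarrow> ((real \<Rightarrow> real) \<Rightarrow> bool) \<Rightarrow> ((real \<Rightarrow> real) \<Rightarrow> (real \<Rightarrow> real) \<Rightarrow> bool) \<Rightarrow> bool" where
  "C0_semigroup_gen L T D A \<longleftrightarrow>
     (\<forall>t\<ge>0. \<forall>x. L2_on L x \<longrightarrow> L2_on L (T t x)) \<and>
     (\<forall>t\<ge>0. \<forall>x y. L2_on L x \<longrightarrow> L2_on L y \<longrightarrow> ae_eq_on L x y \<longrightarrow> ae_eq_on L (T t x) (T t y)) \<and>
     (\<forall>t\<ge>0. \<forall>a b x y. L2_on L x \<longrightarrow> L2_on L y \<longrightarrow>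
         ae_eq_on L (T t (\<lambda>s. a * x s + b * y s)) (\<lambda>s. a * T t x s + b * T t y s)) \<and>
     (\<forall>t\<ge>0. \<exists>C. \<forall>x. L2_on L x \<longrightarrow> L2norm L (T t x) \<le> C * L2norm L x) \<and>
     (\<forall>x. L2_on L x \<longrightarrow> ae_eq_on L (T 0 x) x) \<and>
     (\<forall>t\<ge>0. \<forall>s\<ge>0. \<forall>x. L2_on L x \<longrightarrow> ae_eq_on L (T (t + s) x) (T t (T s x))) \<and>
     (\<forall>x. L2_on L x \<longrightarrow> ((\<lambda>t. L2norm L (\<lambda>s. T t x s - x s)) \<longlongrightarrow> 0) (at_right 0)) \<and>
     (\<forall>x. D x \<longleftrightarrow> L2_on L x \<and> (\<exists>z. L2_on L z \<and>
         ((\<lambda>h. L2norm L (\<lambda>s. (T h x s - x s) / h - z s)) \<longlongrightarrow> 0) (at_right 0))) \<and>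
     (\<forall>x z. D x \<longrightarrow> L2_on L z \<longrightarrow> (A x z \<longleftrightarrow>
         ((\<lambda>h. L2norm L (\<lambda>s. (T h x s - x s) / h - z s)) \<longlongrightarrow> 0) (at_right 0)))"

end

(*
  The constant feedback k_B = 1 works.  With phi(w) the integral of 1/c over [0,w], S = phi(L), Q(w) the integral
  of chi/c over [0,w] (chi the indicator of Omega_o) and p = c e^Q, the function v = p x, read in the coordinate
  s = phi(w), solves v_t = - v_s with v(s + S) = e^(Q(L)) v(s).  So the semigroup is translation of the
  quasi-periodic extension of v.  Its generator is identified directly: (v(s-h) - v(s))/h converges in L^2 iff v is
  a primitive, because the averages of v over [s-h,s] converge to v and differ from a constant by a convergent
  integral.
  Undoing the weight, the flux c x is transported along the circle of length S and damped by e^(-D), where D is the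
  increase of Q (counted with laps) along the characteristic.  On part of a lap D is at least a multiple of the
  length travelled minus a constant; on a full lap no constant is lost: for large L the linear term dominates, and
  for L in [gamma, 2 c0/c1] the first interval [a_1,b_1] contributes a fixed amount.  Hence D >= kappa t - C with
  kappa and C independent of L.  Condition (a) implies the coverage inequality of (b).
*)

theory Submission
  imports Defs
begin

section \<open>Continuity of translation in mean\<close>

text \<open>Two comparisons between x and the translated function are kept apart. Through the weight
  p the comparison constant contains e^Q and depends on L; this is harmless for measurability,
  strong continuity and the generator, where L is fixed and only convergence counts. The decay
  estimate must not see this constant. There e^Q is first combined with its own translate into
  e^(-D), and only the periodic factor c x is compared with x: since d\<omega> = c ds, its squared
  norm in s is the integral of c x^2, which costs just cmax / cmin. The other obstacle is
  regularity. c' exists only almost everywhere, so the product and chain rules for c, p and 1 / p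
  are proved for indefinite integrals. The coordinate change itself stays C^1, because its
  derivative 1 / c is continuous. Domain and graph of the generator are recovered in both directions
  from L2 limits of difference quotients, which is where continuity of translation in mean
  enters.\<close>

lemma integral_shift:
  fixes F :: "real \<Rightarrow> real"
  shows "(LINT s|lborel. F (s - h)) = (LINT s|lborel. F s)"
  using lborel_integral_real_affine[of 1 F "-h"] by simp

lemma integrable_shift:
  fixes F :: "real \<Rightarrow> real"
  shows "integrable lborel F \<Longrightarrow> integrable lborel (\<lambda>s. F (s - h))"
  using lborel_integrable_real_affine[of F 1 "-h"] by simp

text \<open>The error of G against F is translation invariant, so it enters twice with the same
  size, and quarters of e leave room for the middle term. Isolated because it closes two steps of
  the density argument: from open to Borel sets, and from approximants to limits.\<close>

lemma L1_translation_approx: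
  fixes F :: "real \<Rightarrow> real"
  assumes F: "integrable lborel F"
    and ap: "\<And>e. e > 0 \<Longrightarrow> \<exists>G. integrable lborel G \<and>
       ((\<lambda>h. LINT s|lborel. \<bar>G (s - h) - G s\<bar>) \<longlongrightarrow> 0) (at 0) \<and> (LINT s|lborel. \<bar>F s - G s\<bar>) < e"
  shows "((\<lambda>h. LINT s|lborel. \<bar>F (s - h) - F s\<bar>) \<longlongrightarrow> 0) (at 0)"
proof (rule tendstoI)
  fix e :: real assume "e > 0"
  then obtain G where G: "integrable lborel G"
    and lim: "((\<lambda>h. LINT s|lborel. \<bar>G (s - h) - G s\<bar>) \<longlongrightarrow> 0) (at 0)"
    and d: "(LINT s|lborel. \<bar>F s - G s\<bar>) < e/4" using ap[of "e/4"] by auto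
  have "\<forall>\<^sub>F h in at 0. dist (LINT s|lborel. \<bar>G (s - h) - G s\<bar>) 0 < e/4"
    using tendstoD[OF lim, of "e/4"] \<open>e > 0\<close> by simp
  then show "\<forall>\<^sub>F h in at 0. dist (LINT s|lborel. \<bar>F (s - h) - F s\<bar>) 0 < e"
  proof eventually_elim
    case (elim h)
    have FG: "integrable lborel (\<lambda>s. \<bar>F s - G s\<bar>)" using F G by auto
    have FGh: "integrable lborel (\<lambda>s. \<bar>F (s-h) - G (s-h)\<bar>)" using integrable_shift[OF FG] .
    have Gh: "integrable lborel (\<lambda>s. \<bar>G (s - h) - G s\<bar>)" using G integrable_shift[OF G] by auto
    have "(LINT s|lborel. \<bar>F (s - h) - F s\<bar>)
        \<le> (LINT s|lborel. \<bar>F (s-h) - G (s-h)\<bar> + \<bar>G (s - h) - G s\<bar> + \<bar>F s - G s\<bar>)"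
      using F integrable_shift[OF F, of h] FG FGh Gh by (intro integral_mono) auto
    also have "\<dots> = (LINT s|lborel. \<bar>F s - G s\<bar>) + (LINT s|lborel. \<bar>G (s - h) - G s\<bar>) + (LINT s|lborel. \<bar>F s - G s\<bar>)"
      using FG FGh Gh integral_shift[of "\<lambda>s. \<bar>F s - G s\<bar>" h] by simp
    also have "\<dots> < e" using d elim \<open>e > 0\<close> by simp
    finally show ?case by (simp)
  qed
qed

text \<open>Translation invariance kills the integral of the signed difference, so the absolute
  difference integrates to twice its positive part \<open>?p\<close>. That part is dominated by the
  indicator of \<open>U\<close> for every h, unlike the absolute difference, whose support moves; at
  each point of \<open>U\<close> it vanishes for small h because \<open>U\<close> is open.\<close>

lemma L1_translation_indicator_open:
  fixes U :: "real set"
  assumes U: "open U" "emeasure lborel U < \<infinity>"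
  shows "((\<lambda>h. LINT s|lborel. \<bar>indicator U (s - h) - indicator U s :: real\<bar>) \<longlongrightarrow> 0) (at 0)"
proof -
  have [measurable]: "U \<in> sets borel" using U by simp
  have int: "integrable lborel (indicator U :: real \<Rightarrow> real)" using U by simp
  have inth: "integrable lborel (\<lambda>s. indicator U (s - h) :: real)" for h
    using integrable_shift[OF int] .
  let ?p = "\<lambda>h s. max 0 (indicator U s - indicator U (s - h)) :: real"
  have intp: "integrable lborel (?p h)" for h using int inth[of h] by auto
  have eq: "(LINT s|lborel. \<bar>indicator U (s - h) - indicator U s :: real\<bar>) = 2 * (LINT s|lborel. ?p h s)" for h
  proof -
    have "(LINT s|lborel. \<bar>indicator U (s - h) - indicator U s :: real\<bar>)
        = (LINT s|lborel. 2 * ?p h s - (indicator U s - indicator U (s - h)))"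
      by (rule Bochner_Integration.integral_cong) (auto simp: indicator_def)
    also have "\<dots> = 2 * (LINT s|lborel. ?p h s) - ((LINT s|lborel. indicator U s) - (LINT s|lborel. indicator U (s - h)))"
      using intp[of h] int inth[of h] by simp
    finally show ?thesis using integral_shift[of "indicator U" h] by simp
  qed
  have "((\<lambda>h. LINT s|lborel. ?p h s) \<longlongrightarrow> 0) (at 0)"
    unfolding tendsto_at_iff_sequentially
  proof (intro allI impI)
    fix X :: "nat \<Rightarrow> real" assume X: "\<forall>i. X i \<in> UNIV - {0}" "X \<longlonglongrightarrow> 0"
    have "(\<lambda>i. LINT s|lborel. ?p (X i) s) \<longlonglongrightarrow> (LINT s|(lborel::real measure). (0::real))"
    proof (rule integral_dominated_convergence[where w="indicator U"])
      show "AE s in lborel. (\<lambda>i. ?p (X i) s) \<longlonglongrightarrow> 0"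
      proof (rule AE_I2)
        fix s
        show "(\<lambda>i. ?p (X i) s) \<longlonglongrightarrow> 0"
        proof (cases "s \<in> U")
          case True
          have "(\<lambda>i. s - X i) \<longlonglongrightarrow> s" using tendsto_diff[OF tendsto_const X(2), of s] by simp
          then have "\<forall>\<^sub>F i in sequentially. s - X i \<in> U" using U True by (auto dest: topological_tendstoD)
          then have "\<forall>\<^sub>F i in sequentially. ?p (X i) s = 0" by eventually_elim (auto simp: True)
          then show ?thesis by (rule tendsto_eventually)
        qed (auto simp: indicator_def)
      qed
    qed (use int in \<open>auto simp: indicator_def\<close>)
    then show "((\<lambda>h. LINT s|lborel. ?p h s) \<circ> X) \<longlonglongrightarrow> 0" by (simp add: comp_def)
  qed
  then have "((\<lambda>h. 2 * (LINT s|lborel. ?p h s)) \<longlongrightarrow> 2 * 0) (at 0)" by (intro tendsto_intros)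
  then show ?thesis unfolding eq by simp
qed

lemma tendsto_L1_translation:
  fixes F :: "real \<Rightarrow> real"
  assumes "integrable lborel F"
  shows "((\<lambda>h. LINT s|lborel. \<bar>F (s - h) - F s\<bar>) \<longlongrightarrow> 0) (at 0)"
  using assms
proof (induction rule: integrable_induct)
  case (base A c)
  have A: "A \<in> sets borel" using base by simp
  have intA: "integrable lborel (indicator A :: real \<Rightarrow> real)" using base by simp
  have "((\<lambda>h. LINT s|lborel. \<bar>indicator A (s - h) - indicator A s :: real\<bar>) \<longlongrightarrow> 0) (at 0)"
  proof (rule L1_translation_approx[OF intA])
    fix e :: real assume "e > 0"
    have "A \<in> sets lebesgue" using A by simp
    \<comment> \<open>Outer regularity replaces the Borel set by an open one at the cost of e in
      measure; the open set keeps finite measure, as the open case requires.\<close>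
    from sets_lebesgue_outer_open[OF this \<open>e > 0\<close>] obtain U where
      U: "open U" "A \<subseteq> U" "U - A \<in> lmeasurable" "emeasure lebesgue (U - A) < ennreal e" by auto
    have [measurable]: "U \<in> sets borel" "A \<in> sets borel" using U A by auto
    have e1: "emeasure lborel (U - A) < ennreal e" using U(4) by (simp add: emeasure_completion)
    have Ue: "emeasure lborel U < \<infinity>"
    proof -
      have "emeasure lborel U \<le> emeasure lborel (A \<union> (U - A))" using U(2) by (intro emeasure_mono) auto
      also have "\<dots> \<le> emeasure lborel A + emeasure lborel (U - A)" by (intro emeasure_subadditive) auto
      also have "\<dots> < \<infinity>" using base e1 by (auto simp: less_top[symmetric] dest: order.strict_trans)
      finally show ?thesis .
    qed
    have "(LINT s|lborel. \<bar>indicator A s - indicator U s :: real\<bar>) = (LINT s|lborel. indicator (U - A) s)"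
      using U(2) by (intro Bochner_Integration.integral_cong) (auto simp: indicator_def)
    also have "\<dots> = measure lborel (U - A)" by simp
    also have "\<dots> < e" using e1 \<open>e > 0\<close>
      by (simp add: measure_def enn2real_less_iff order.strict_trans[OF _ ennreal_less_top])
    finally show "\<exists>G. integrable lborel G \<and>
       ((\<lambda>h. LINT s|lborel. \<bar>G (s - h) - G s\<bar>) \<longlongrightarrow> 0) (at 0) \<and> (LINT s|lborel. \<bar>indicator A s - G s\<bar>) < e"
      using L1_translation_indicator_open[OF U(1) Ue] Ue U(1)
      by (intro exI[of _ "indicator U"]) auto
  qed
  then have "((\<lambda>h. (LINT s|lborel. \<bar>indicator A (s - h) - indicator A s :: real\<bar>) * \<bar>c\<bar>) \<longlongrightarrow> 0 * \<bar>c\<bar>) (at 0)"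
    by (intro tendsto_intros)
  then show ?case by (simp add: left_diff_distrib[symmetric] abs_mult)
next
  case (add f g)
  have *: "((\<lambda>h. (LINT s|lborel. \<bar>f (s - h) - f s\<bar>) + (LINT s|lborel. \<bar>g (s - h) - g s\<bar>)) \<longlongrightarrow> 0 + 0) (at 0)"
    using add by (intro tendsto_intros)
  show ?case
  proof (rule tendsto_sandwich[OF _ _ tendsto_const *[simplified]])
    show "\<forall>\<^sub>F h in at 0. (LINT s|lborel. \<bar>(f (s - h) + g (s - h)) - (f s + g s)\<bar>)
       \<le> (LINT s|lborel. \<bar>f (s - h) - f s\<bar>) + (LINT s|lborel. \<bar>g (s - h) - g s\<bar>)"
    proof (rule always_eventually, rule)
      fix h
      have i: "integrable lborel (\<lambda>s. \<bar>f (s - h) - f s\<bar>)" "integrable lborel (\<lambda>s. \<bar>g (s - h) - g s\<bar>)"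
        using add integrable_shift[of f h] integrable_shift[of g h] by auto
      show "(LINT s|lborel. \<bar>(f (s - h) + g (s - h)) - (f s + g s)\<bar>)
       \<le> (LINT s|lborel. \<bar>f (s - h) - f s\<bar>) + (LINT s|lborel. \<bar>g (s - h) - g s\<bar>)"
        unfolding Bochner_Integration.integral_add[OF i, symmetric]
        using i add integrable_shift[of f h] integrable_shift[of g h] by (intro integral_mono) auto
    qed
  qed auto
next
  case (lim f s)
  show ?case
  proof (rule L1_translation_approx[OF lim(4)])
    fix e :: real assume "e > 0"
    have [measurable]: "f \<in> borel_measurable borel" "\<And>i. s i \<in> borel_measurable borel"
      using lim(1,4) borel_measurable_integrable by force+
    have "(\<lambda>i. LINT x|lborel. \<bar>f x - s i x\<bar>) \<longlonglongrightarrow> (LINT x|(lborel::real measure). (0::real))"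
    \<comment> \<open>The factor 3: the approximants supplied by the induction satisfy |s i x| <= 2
      |f x|.\<close>
    proof (rule integral_dominated_convergence[where w="\<lambda>x. 3 * \<bar>f x\<bar>"])
      show "AE x in lborel. (\<lambda>i. \<bar>f x - s i x\<bar>) \<longlonglongrightarrow> 0"
      proof (rule AE_I2)
        fix x
        have "(\<lambda>i. s i x) \<longlonglongrightarrow> f x" using lim(2) by simp
        then have "(\<lambda>i. \<bar>f x - s i x\<bar>) \<longlonglongrightarrow> \<bar>f x - f x\<bar>" by (intro tendsto_intros)
        then show "(\<lambda>i. \<bar>f x - s i x\<bar>) \<longlonglongrightarrow> 0" by simp
      qed
      show "AE x in lborel. norm \<bar>f x - s i x\<bar> \<le> 3 * \<bar>f x\<bar>" for i
      proof (rule AE_I2)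
        fix x show "norm \<bar>f x - s i x\<bar> \<le> 3 * \<bar>f x\<bar>" using lim(3)[of x i] by auto
      qed
    qed (use lim in auto)
    then have "\<forall>\<^sub>F i in sequentially. (LINT x|lborel. \<bar>f x - s i x\<bar>) < e"
      using \<open>e > 0\<close> by (auto dest: order_tendstoD)
    then obtain i where "(LINT x|lborel. \<bar>f x - s i x\<bar>) < e" by (auto simp: eventually_sequentially)
    then show "\<exists>G. integrable lborel G \<and>
       ((\<lambda>h. LINT s|lborel. \<bar>G (s - h) - G s\<bar>) \<longlongrightarrow> 0) (at 0) \<and> (LINT s|lborel. \<bar>f s - G s\<bar>) < e"
      using lim by blast
  qed
qed

text \<open>The map a -> a |a| turns an L2 function into an L1 function, and this bound leads back
  from L1 distance to squared L2 distance. For a >= b >= 0 use (a - b)^2 <= (a - b)(a + b); for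
  opposite signs (a - b)^2 <= 2 (a^2 + b^2). The remaining cases are symmetries.\<close>

lemma square_diff_le_signed_square_diff:
  fixes a b :: real
  shows "(a - b)\<^sup>2 \<le> 2 * \<bar>a * \<bar>a\<bar> - b * \<bar>b\<bar>\<bar>"
proof -
  have same_sign: "(a - b)\<^sup>2 \<le> 2 * \<bar>a * \<bar>a\<bar> - b * \<bar>b\<bar>\<bar>" if "0 \<le> b" "b \<le> a" for a b :: real
  proof -
    have "(a - b) * (a - b) \<le> (a - b) * (a + b)" using that by (intro mult_left_mono) auto
    moreover have "0 \<le> (a - b) * (a + b)" using that by simp
    ultimately show ?thesis using that by (simp add: power2_eq_square algebra_simps)
  qed
  have opposite_sign: "(a - b)\<^sup>2 \<le> 2 * \<bar>a * \<bar>a\<bar> - b * \<bar>b\<bar>\<bar>" if "b \<le> 0" "0 \<le> a" for a b :: real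
    using that sum_squares_ge_zero[of "a+b" 0] by (simp add: power2_eq_square algebra_simps abs_if mult_nonneg_nonpos)
  consider "0 \<le> b" "b \<le> a" | "0 \<le> a" "a \<le> b" | "b \<le> 0" "0 \<le> a" | "a \<le> 0" "0 \<le> b"
    | "a \<le> 0" "b \<le> 0" "a \<le> b" | "a \<le> 0" "b \<le> 0" "b \<le> a" by linarith
  then show ?thesis
    using same_sign[of b a] same_sign[of a b] same_sign[of "-b" "-a"] same_sign[of "-a" "-b"]
      opposite_sign[of b a] opposite_sign[of a b]
    by cases (simp_all add: power2_commute abs_minus_commute)
qed

lemma tendsto_L2_translation:
  fixes v :: "real \<Rightarrow> real"
  assumes S: "S > 0" and v[measurable]: "v \<in> borel_measurable borel"
    and int: "set_integrable lborel {-S..S} (\<lambda>s. (v s)\<^sup>2)"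
  shows "((\<lambda>h. LINT s:{0..S}|lborel. (v (s - h) - v s)\<^sup>2) \<longlongrightarrow> 0) (at_right 0)"
proof -
  \<comment> \<open>The signed square of v, truncated to an interval containing both s and s - h for
    s in [0,S] and 0 < h < S.\<close>
  define F where "F = (\<lambda>s. indicator {-S..S} s * (v s * \<bar>v s\<bar>))"
  have F: "integrable lborel F"
  proof (rule Bochner_Integration.integrable_bound[OF int[unfolded set_integrable_def]])
    show "F \<in> borel_measurable lborel" unfolding F_def by measurable
    show "AE x in lborel. norm (F x) \<le> norm (indicator {-S..S} x *\<^sub>R (v x)\<^sup>2)"
      by (auto simp: F_def indicator_def power2_eq_square abs_mult)
  qed
  have lim: "((\<lambda>h. 2 * (LINT s|lborel. \<bar>F (s - h) - F s\<bar>)) \<longlongrightarrow> 2 * 0) (at_right 0)"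
    by (intro tendsto_intros tendsto_within_subset[OF tendsto_L1_translation[OF F]]) auto
  show ?thesis
  proof (rule tendsto_sandwich[OF _ _ tendsto_const lim[simplified]])
    show "\<forall>\<^sub>F h in at_right 0. 0 \<le> (LINT s:{0..S}|lborel. (v (s - h) - v s)\<^sup>2)"
      unfolding set_lebesgue_integral_def by (intro always_eventually allI integral_nonneg_AE) auto
    have "\<forall>\<^sub>F h in at_right 0. 0 < h \<and> h < S"
      using S by (auto simp: eventually_at_right_field intro: exI[of _ S])
    then show "\<forall>\<^sub>F h in at_right 0. (LINT s:{0..S}|lborel. (v (s - h) - v s)\<^sup>2) \<le> 2 * (LINT s|lborel. \<bar>F (s - h) - F s\<bar>)"
    proof eventually_elim
      case (elim h)
      have iF: "integrable lborel (\<lambda>s. 2 * \<bar>F (s - h) - F s\<bar>)" using F integrable_shift[OF F, of h] by auto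
      have le: "indicator {0..S} s *\<^sub>R (v (s - h) - v s)\<^sup>2 \<le> 2 * \<bar>F (s - h) - F s\<bar>" for s
        using square_diff_le_signed_square_diff[of "v (s-h)" "v s"] elim
        by (auto simp: F_def indicator_def)
      have "integrable lborel (\<lambda>s. indicator {0..S} s *\<^sub>R (v (s - h) - v s)\<^sup>2)"
        by (rule Bochner_Integration.integrable_bound[OF iF])
           (use le in \<open>auto intro!: AE_I2 simp: F_def[symmetric]\<close>)
      then have "(LINT s:{0..S}|lborel. (v (s - h) - v s)\<^sup>2) \<le> (LINT s|lborel. 2 * \<bar>F (s - h) - F s\<bar>)"
        unfolding set_lebesgue_integral_def using iF le by (intro integral_mono) auto
      then show ?case by simp
    qed
  qed
qed

section \<open>Averages over short intervals\<close>

lemma set_integral_split_Icc: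
  fixes f :: "real \<Rightarrow> real"
  assumes "a \<le> b" "b \<le> c" and f: "set_integrable lborel {a..c} f"
  shows "(LINT s:{a..c}|lborel. f s) = (LINT s:{a..b}|lborel. f s) + (LINT s:{b..c}|lborel. f s)"
proof -
  have "{a..c} = {a..b} \<union> {b..c}" using assms by auto
  moreover have "(LINT s:{a..b} \<union> {b..c}|lborel. f s) = (LINT s:{a..b}|lborel. f s) + (LINT s:{b..c}|lborel. f s)"
  proof (rule set_integral_Un_AE)
    show "AE x in lborel. \<not> (x \<in> {a..b} \<and> x \<in> {b..c})"
      using AE_lborel_singleton[of b] by eventually_elim auto
  qed (use assms in \<open>auto intro: set_integrable_subset[OF f]\<close>)
  ultimately show ?thesis by simp
qed

lemma set_integral_shift_Icc:
  fixes f :: "real \<Rightarrow> real"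
  shows "(LINT s:{a..b}|lborel. f (s - h)) = (LINT s:{a - h..b - h}|lborel. f s)"
proof -
  have "(LINT s:{a - h..b - h}|lborel. f s) = (LINT s|lborel. indicator {a - h..b - h} (s - h) *\<^sub>R f (s - h))"
    unfolding set_lebesgue_integral_def using integral_shift[of "\<lambda>s. indicator {a - h..b - h} s *\<^sub>R f s" h] by simp
  also have "\<dots> = (LINT s:{a..b}|lborel. f (s - h))"
    unfolding set_lebesgue_integral_def by (intro Bochner_Integration.integral_cong) (auto simp: indicator_def)
  finally show ?thesis ..
qed

lemma set_integrable_shift_Icc:
  fixes f :: "real \<Rightarrow> real"
  assumes "set_integrable lborel {a - h..b - h} f"
  shows "set_integrable lborel {a..b} (\<lambda>s. f (s - h))"
proof -
  have "integrable lborel (\<lambda>s. indicator {a - h..b - h} (s - h) *\<^sub>R f (s - h))"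
    using integrable_shift[OF assms[unfolded set_integrable_def]] .
  also have "(\<lambda>s. indicator {a - h..b - h} (s - h) *\<^sub>R f (s - h)) = (\<lambda>s. indicator {a..b} s *\<^sub>R f (s - h))"
    by (auto simp: indicator_def fun_eq_iff)
  finally show ?thesis by (simp add: set_integrable_def)
qed

lemma set_integral_reflect_Icc:
  fixes f :: "real \<Rightarrow> real"
  shows "(LINT s:{0..h}|lborel. f (x - s)) = (LINT s:{x - h..x}|lborel. f s)"
proof -
  have "(LINT s:{x - h..x}|lborel. f s) = (LINT s|lborel. indicator {x - h..x} (x - s) *\<^sub>R f (x - s))"
    unfolding set_lebesgue_integral_def
    using lborel_integral_real_affine[of "-1" "\<lambda>s. indicator {x - h..x} s *\<^sub>R f s" x] by simp
  also have "\<dots> = (LINT s:{0..h}|lborel. f (x - s))"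
    unfolding set_lebesgue_integral_def by (intro Bochner_Integration.integral_cong) (auto simp: indicator_def)
  finally show ?thesis ..
qed

lemma sq_add_le: "(a + b)\<^sup>2 \<le> 2 * a\<^sup>2 + 2 * (b::real)\<^sup>2"
  using zero_le_power2[of "a - b"] by (simp add: power2_diff power2_sum)

lemma set_integrable_sq_add:
  fixes f g :: "'a \<Rightarrow> real"
  assumes [measurable]: "f \<in> borel_measurable M" "g \<in> borel_measurable M" "A \<in> sets M"
    and f: "set_integrable M A (\<lambda>s. (f s)\<^sup>2)" and g: "set_integrable M A (\<lambda>s. (g s)\<^sup>2)"
  shows "set_integrable M A (\<lambda>s. (f s + g s)\<^sup>2)"
proof (rule set_integrable_bound)
  show "set_integrable M A (\<lambda>s. 2 * (f s)\<^sup>2 + 2 * (g s)\<^sup>2)" using f g by auto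
  show "set_borel_measurable M A (\<lambda>s. (f s + g s)\<^sup>2)" unfolding set_borel_measurable_def by measurable
  show "AE x in M. x \<in> A \<longrightarrow> norm ((f x + g x)\<^sup>2) \<le> norm (2 * (f x)\<^sup>2 + 2 * (g x)\<^sup>2)"
    using sq_add_le[of "f _" "g _"] by (intro AE_I2) auto
qed

lemma set_integrable_sq_diff:
  fixes f g :: "'a \<Rightarrow> real"
  assumes "f \<in> borel_measurable M" "g \<in> borel_measurable M" "A \<in> sets M"
    and "set_integrable M A (\<lambda>s. (f s)\<^sup>2)" and "set_integrable M A (\<lambda>s. (g s)\<^sup>2)"
  shows "set_integrable M A (\<lambda>s. (f s - g s)\<^sup>2)"
  using set_integrable_sq_add[of f M "\<lambda>s. - g s" A] assms by simp

lemma set_integral_sq_add_le: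
  fixes f g :: "'a \<Rightarrow> real"
  assumes "f \<in> borel_measurable M" "g \<in> borel_measurable M" "A \<in> sets M"
    and "set_integrable M A (\<lambda>s. (f s)\<^sup>2)" and "set_integrable M A (\<lambda>s. (g s)\<^sup>2)"
  shows "(LINT s:A|M. (f s + g s)\<^sup>2) \<le> 2 * (LINT s:A|M. (f s)\<^sup>2) + 2 * (LINT s:A|M. (g s)\<^sup>2)"
proof -
  have "(LINT s:A|M. (f s + g s)\<^sup>2) \<le> (LINT s:A|M. 2 * (f s)\<^sup>2 + 2 * (g s)\<^sup>2)"
    using assms set_integrable_sq_add[OF assms] sq_add_le
    by (intro set_integral_mono) auto
  then show ?thesis using assms by simp
qed

lemma set_integral_nonneg_all:
  fixes f :: "'a \<Rightarrow> real"
  shows "(\<And>x. x \<in> A \<Longrightarrow> 0 \<le> f x) \<Longrightarrow> 0 \<le> (LINT s:A|M. f s)"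
  unfolding set_lebesgue_integral_def by (intro integral_nonneg_AE AE_I2) (auto simp: indicator_def)

lemma set_integral_const_Icc:
  fixes c :: real shows "a \<le> b \<Longrightarrow> (LINT s:{a..b}|lborel. c) = (b - a) * c"
  by (simp add: set_lebesgue_integral_def)

lemma set_integrable_const_Icc: "set_integrable lborel {a..b::real} (\<lambda>_. c::real)"
  by (rule borel_integrable_atLeastAtMost'[OF continuous_on_const])

lemma set_integrable_if_sq_Icc:
  fixes f :: "real \<Rightarrow> real"
  assumes m: "set_borel_measurable lborel {a..b} f" and f: "set_integrable lborel {a..b} (\<lambda>s. (f s)\<^sup>2)"
  shows "set_integrable lborel {a..b} f"
proof (rule set_integrable_bound[OF _ m])
  show "set_integrable lborel {a..b} (\<lambda>s. 1 + (f s)\<^sup>2)"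
    by (intro set_integral_add(1) set_integrable_const_Icc f)
  show "AE x in lborel. x \<in> {a..b} \<longrightarrow> norm (f x) \<le> norm (1 + (f x)\<^sup>2)"
  proof (intro AE_I2 impI)
    fix x
    have "0 \<le> (\<bar>f x\<bar> - 1)\<^sup>2" by simp
    then show "norm (f x) \<le> norm (1 + (f x)\<^sup>2)" by (simp add: power2_diff)
  qed
qed

lemma set_integral_sq_dist_const:
  fixes f :: "real \<Rightarrow> real"
  assumes "a \<le> b" and f: "set_integrable lborel {a..b} f" and f2: "set_integrable lborel {a..b} (\<lambda>s. (f s)\<^sup>2)"
  shows "set_integrable lborel {a..b} (\<lambda>s. (f s - k)\<^sup>2)"
    and "(LINT s:{a..b}|lborel. (f s - k)\<^sup>2)
      = (LINT s:{a..b}|lborel. (f s)\<^sup>2) - 2 * k * (LINT s:{a..b}|lborel. f s) + (b - a) * k\<^sup>2"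
proof -
  have eq: "(\<lambda>s. (f s - k)\<^sup>2) = (\<lambda>s. (f s)\<^sup>2 - (2 * k) * f s + k\<^sup>2)"
    by (auto simp: power2_diff fun_eq_iff)
  show "set_integrable lborel {a..b} (\<lambda>s. (f s - k)\<^sup>2)"
    unfolding eq by (intro set_integral_add(1) set_integral_diff(1) set_integrable_mult_right f f2 set_integrable_const_Icc)
  have "(LINT s:{a..b}|lborel. (f s - k)\<^sup>2)
      = (LINT s:{a..b}|lborel. (f s)\<^sup>2 - (2 * k) * f s) + (LINT s:{a..b}|lborel. k\<^sup>2)"
    unfolding eq by (intro set_integral_add(2) set_integral_diff(1) set_integrable_mult_right f f2 set_integrable_const_Icc)
  also have "(LINT s:{a..b}|lborel. (f s)\<^sup>2 - (2 * k) * f s)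
      = (LINT s:{a..b}|lborel. (f s)\<^sup>2) - (LINT s:{a..b}|lborel. (2 * k) * f s)"
    by (intro set_integral_diff(2) set_integrable_mult_right f f2)
  finally show "(LINT s:{a..b}|lborel. (f s - k)\<^sup>2)
      = (LINT s:{a..b}|lborel. (f s)\<^sup>2) - 2 * k * (LINT s:{a..b}|lborel. f s) + (b - a) * k\<^sup>2"
    using assms(1) by (simp add: set_integral_const_Icc)
qed

text \<open>Nonnegativity of the variance: expand the integral of (f - k)^2 with k the mean of
  f.\<close>

lemma set_integral_Cauchy_Schwarz_Icc:
  fixes f :: "real \<Rightarrow> real"
  assumes "a < b" and f: "set_integrable lborel {a..b} f" and f2: "set_integrable lborel {a..b} (\<lambda>s. (f s)\<^sup>2)"
  shows "(LINT s:{a..b}|lborel. f s)\<^sup>2 \<le> (b - a) * (LINT s:{a..b}|lborel. (f s)\<^sup>2)"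
proof -
  define J where "J = (LINT s:{a..b}|lborel. f s)"
  define k where "k = J / (b - a)"
  have "0 \<le> (LINT s:{a..b}|lborel. (f s - k)\<^sup>2)" by (intro set_integral_nonneg_all) auto
  also have "\<dots> = (LINT s:{a..b}|lborel. (f s)\<^sup>2) - 2 * k * J + (b - a) * k\<^sup>2"
    using set_integral_sq_dist_const(2)[OF _ f f2, of k] assms by (simp add: J_def)
  also have "\<dots> = (LINT s:{a..b}|lborel. (f s)\<^sup>2) - J\<^sup>2 / (b - a)"
  proof -
    have "(b - a) * k = J" using assms(1) by (simp add: k_def)
    then have "(b - a) * k\<^sup>2 = k * J" by (simp add: power2_eq_square mult.assoc[symmetric])
    moreover have "k * J = J\<^sup>2 / (b - a)" by (simp add: k_def power2_eq_square)
    ultimately show ?thesis by simp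
  qed
  finally show ?thesis using assms(1) by (simp add: J_def field_simps)
qed

lemma set_integrable_sq_translate_diff:
  fixes v :: "real \<Rightarrow> real"
  assumes [measurable]: "v \<in> borel_measurable borel"
    and int: "set_integrable lborel {-S..S} (\<lambda>s. (v s)\<^sup>2)" and h: "0 \<le> h" "h \<le> S"
  shows "set_integrable lborel {0..S} (\<lambda>s. (v (s - h) - v s)\<^sup>2)"
proof (rule set_integrable_sq_diff)
  have "set_integrable lborel {0 - h..S - h} (\<lambda>s. (v s)\<^sup>2)"
    by (rule set_integrable_subset[OF int]) (use h in auto)
  then show "set_integrable lborel {0..S} (\<lambda>s. (v (s - h))\<^sup>2)"
    by (rule set_integrable_shift_Icc)
  show "set_integrable lborel {0..S} (\<lambda>s. (v s)\<^sup>2)"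
    by (rule set_integrable_subset[OF int]) (use h in auto)
qed auto

text \<open>Reflection fixes the moving window at [0,h] and puts s into a jointly measurable
  integrand, where measurability of parameter integrals applies.\<close>

lemma borel_measurable_window_integral:
  fixes v :: "real \<Rightarrow> real"
  assumes [measurable]: "v \<in> borel_measurable borel"
  shows "(\<lambda>s. LINT \<tau>:{s - h..s}|lborel. v \<tau>) \<in> borel_measurable borel"
proof -
  have "(\<lambda>s. LINT \<tau>|lborel. indicator {0..h} \<tau> *\<^sub>R v (s - \<tau>)) \<in> borel_measurable borel"
    by measurable
  also have "(\<lambda>s. LINT \<tau>|lborel. indicator {0..h} \<tau> *\<^sub>R v (s - \<tau>)) = (\<lambda>s. LINT \<tau>:{s - h..s}|lborel. v \<tau>)"
    using set_integral_reflect_Icc[where f=v and h=h] by (auto simp: fun_eq_iff set_lebesgue_integral_def)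
  finally show ?thesis .
qed

text \<open>The average minus v s is the mean over \<tau> in [0,h] of v (s - \<tau>) - v s.
  Cauchy-Schwarz moves the square inside the mean, and exchanging the order of integration leaves a
  mean over \<tau> of quantities bounded by e.\<close>

lemma L2_average_le:
  fixes v :: "real \<Rightarrow> real"
  assumes [measurable]: "v \<in> borel_measurable borel"
    and int: "set_integrable lborel {-S..S} (\<lambda>s. (v s)\<^sup>2)" and h: "0 < h" "h \<le> S"
    and e: "e \<ge> 0" "\<And>\<tau>. 0 < \<tau> \<Longrightarrow> \<tau> \<le> h \<Longrightarrow> (LINT s:{0..S}|lborel. (v (s - \<tau>) - v s)\<^sup>2) \<le> e"
  shows "set_integrable lborel {0..S} (\<lambda>s. ((LINT \<tau>:{s - h..s}|lborel. v \<tau>) / h - v s)\<^sup>2)"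
    and "(LINT s:{0..S}|lborel. ((LINT \<tau>:{s - h..s}|lborel. v \<tau>) / h - v s)\<^sup>2) \<le> e"
proof -
  define w where "w = (\<lambda>s. (LINT \<tau>:{s - h..s}|lborel. v \<tau>) / h - v s)"
  have [measurable]: "w \<in> borel_measurable borel"
    unfolding w_def using borel_measurable_window_integral by measurable
  have v1: "set_integrable lborel {-S..S} v"
    by (rule set_integrable_if_sq_Icc[OF _ int]) (simp add: set_borel_measurable_def)
  have bound: "(w s)\<^sup>2 \<le> (LINT \<tau>:{0..h}|lborel. (v (s - \<tau>) - v s)\<^sup>2) / h"
    and sqint: "set_integrable lborel {0..h} (\<lambda>\<tau>. (v (s - \<tau>) - v s)\<^sup>2)" if s: "s \<in> {0..S}" for s
  proof -
    have refl: "set_integrable lborel {0..h} (\<lambda>\<tau>. g (s - \<tau>))" if g: "set_integrable lborel {-S..S} g" for g :: "real \<Rightarrow> real"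
    proof -
      have "integrable lborel (\<lambda>\<tau>. indicator {-S..S} (s + (-1) * \<tau>) *\<^sub>R g (s + (-1) * \<tau>))"
        using g unfolding set_integrable_def by (rule lborel_integrable_real_affine) simp
      then have "set_integrable lborel {s - S..s + S} (\<lambda>\<tau>. g (s - \<tau>))"
        unfolding set_integrable_def
        by (rule Bochner_Integration.integrable_cong[THEN iffD1, rotated -1]) (auto simp: indicator_def)
      then show ?thesis by (rule set_integrable_subset) (use s h in auto)
    qed
    have i1: "set_integrable lborel {0..h} (\<lambda>\<tau>. v (s - \<tau>))" by (rule refl[OF v1])
    have i2: "set_integrable lborel {0..h} (\<lambda>\<tau>. (v (s - \<tau>))\<^sup>2)" by (rule refl[OF int])
    show sqint: "set_integrable lborel {0..h} (\<lambda>\<tau>. (v (s - \<tau>) - v s)\<^sup>2)"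
      by (intro set_integral_sq_dist_const i1 i2) (use h in auto)
    have i3: "set_integrable lborel {0..h} (\<lambda>\<tau>. v (s - \<tau>) - v s)"
      by (intro set_integral_diff i1 set_integrable_const_Icc)
    have "(LINT \<tau>:{0..h}|lborel. v (s - \<tau>) - v s) = (LINT \<tau>:{0..h}|lborel. v (s - \<tau>)) - h * v s"
      using set_integral_diff(2)[OF i1 set_integrable_const_Icc, of "v s"] h by (simp add: set_integral_const_Icc)
    then have "w s = (LINT \<tau>:{0..h}|lborel. v (s - \<tau>) - v s) / h"
      unfolding w_def using set_integral_reflect_Icc[where f=v and h=h and x=s] h by (simp add: diff_divide_distrib)
    then have "(w s)\<^sup>2 = (LINT \<tau>:{0..h}|lborel. v (s - \<tau>) - v s)\<^sup>2 / h\<^sup>2" by (simp add: power_divide)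
    also have "\<dots> \<le> (h - 0) * (LINT \<tau>:{0..h}|lborel. (v (s - \<tau>) - v s)\<^sup>2) / h\<^sup>2"
      by (intro divide_right_mono set_integral_Cauchy_Schwarz_Icc i3 sqint) (use h in auto)
    also have "\<dots> = (LINT \<tau>:{0..h}|lborel. (v (s - \<tau>) - v s)\<^sup>2) / h" using h by (simp add: power2_eq_square)
    finally show "(w s)\<^sup>2 \<le> (LINT \<tau>:{0..h}|lborel. (v (s - \<tau>) - v s)\<^sup>2) / h" .
  qed
  \<comment> \<open>Nonnegative integrals, because integrability in s is itself part of the claim;
    the finite bound supplies it.\<close>
  have "(\<integral>\<^sup>+ s. ennreal (indicator {0..S} s * (w s)\<^sup>2) \<partial>lborel)
      \<le> (\<integral>\<^sup>+ s. (\<integral>\<^sup>+ \<tau>. ennreal (indicator {0..S} s * (indicator {0..h} \<tau> * (v (s - \<tau>) - v s)\<^sup>2 / h)) \<partial>lborel) \<partial>lborel)"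
  proof (rule nn_integral_mono)
    fix s
    show "ennreal (indicator {0..S} s * (w s)\<^sup>2)
      \<le> (\<integral>\<^sup>+ \<tau>. ennreal (indicator {0..S} s * (indicator {0..h} \<tau> * (v (s - \<tau>) - v s)\<^sup>2 / h)) \<partial>lborel)"
    proof (cases "s \<in> {0..S}")
      case True
      have "(\<integral>\<^sup>+ \<tau>. ennreal (indicator {0..h} \<tau> * (v (s - \<tau>) - v s)\<^sup>2 / h) \<partial>lborel)
        = ennreal (LINT \<tau>|lborel. indicator {0..h} \<tau> * (v (s - \<tau>) - v s)\<^sup>2 / h)"
        using sqint[OF True] h by (intro nn_integral_eq_integral) (auto simp: set_integrable_def)
      also have "\<dots> = ennreal ((LINT \<tau>:{0..h}|lborel. (v (s - \<tau>) - v s)\<^sup>2) / h)"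
        by (simp add: set_lebesgue_integral_def)
      finally show ?thesis using True bound[OF True] by (simp add: ennreal_leI)
    qed simp
  qed
  also have "\<dots> = (\<integral>\<^sup>+ \<tau>. (\<integral>\<^sup>+ s. ennreal (indicator {0..S} s * (indicator {0..h} \<tau> * (v (s - \<tau>) - v s)\<^sup>2 / h)) \<partial>lborel) \<partial>lborel)"
    by (rule lborel_pair.Fubini') measurable
  also have "\<dots> \<le> (\<integral>\<^sup>+ \<tau>. ennreal (e / h) * indicator {0..h} \<tau> \<partial>lborel)"
  \<comment> \<open>The hypothesis covers only \<tau> > 0, as it will come from a limit from the
    right; the point 0 is a null set.\<close>
  proof (rule nn_integral_mono_AE, rule AE_mp[OF AE_lborel_singleton[of 0]], intro AE_I2 impI)
    fix \<tau> :: real assume "\<tau> \<noteq> 0"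
    show "(\<integral>\<^sup>+ s. ennreal (indicator {0..S} s * (indicator {0..h} \<tau> * (v (s - \<tau>) - v s)\<^sup>2 / h)) \<partial>lborel)
       \<le> ennreal (e / h) * indicator {0..h} \<tau>"
    proof (cases "\<tau> \<in> {0..h}")
      case True
      have "set_integrable lborel {0..S} (\<lambda>s. (v (s - \<tau>) - v s)\<^sup>2)"
        by (rule set_integrable_sq_translate_diff[OF assms(1) int]) (use True h in auto)
      then have "(\<integral>\<^sup>+ s. ennreal (indicator {0..S} s * ((v (s - \<tau>) - v s)\<^sup>2 / h)) \<partial>lborel)
         = ennreal (LINT s|lborel. indicator {0..S} s * ((v (s - \<tau>) - v s)\<^sup>2 / h))"
        using h by (intro nn_integral_eq_integral) (auto simp: set_integrable_def)
      also have "\<dots> = ennreal ((LINT s:{0..S}|lborel. (v (s - \<tau>) - v s)\<^sup>2) / h)"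
        by (simp add: set_lebesgue_integral_def)
      also have "\<dots> \<le> ennreal (e / h)"
        by (intro ennreal_leI divide_right_mono e(2)) (use True h \<open>\<tau> \<noteq> 0\<close> in auto)
      finally show ?thesis using True by simp
    qed simp
  qed
  also have "\<dots> = ennreal (e / h) * ennreal h" using h by (simp add: nn_integral_cmult_indicator)
  also have "\<dots> = ennreal e" using h e by (simp add: ennreal_mult[symmetric])
  finally have fin: "(\<integral>\<^sup>+ s. ennreal (indicator {0..S} s * (w s)\<^sup>2) \<partial>lborel) \<le> ennreal e" .
  have wi: "integrable lborel (\<lambda>s. indicator {0..S} s * (w s)\<^sup>2)"
    using fin by (intro integrableI_nonneg) (auto simp: less_top[symmetric] top_unique)
  then show "set_integrable lborel {0..S} (\<lambda>s. ((LINT \<tau>:{s - h..s}|lborel. v \<tau>) / h - v s)\<^sup>2)"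
    by (simp add: set_integrable_def w_def)
  have "ennreal (LINT s|lborel. indicator {0..S} s * (w s)\<^sup>2) \<le> ennreal e"
    using fin by (subst nn_integral_eq_integral[OF wi, symmetric]) auto
  then show "(LINT s:{0..S}|lborel. ((LINT \<tau>:{s - h..s}|lborel. v \<tau>) / h - v s)\<^sup>2) \<le> e"
    using e by (simp add: set_lebesgue_integral_def w_def)
qed

lemma L2_average_integrable:
  fixes v :: "real \<Rightarrow> real"
  assumes v: "v \<in> borel_measurable borel"
    and int: "set_integrable lborel {-S..S} (\<lambda>s. (v s)\<^sup>2)" and h: "0 < h" "h \<le> S"
  shows "set_integrable lborel {0..S} (\<lambda>s. ((LINT \<tau>:{s - h..s}|lborel. v \<tau>) / h - v s)\<^sup>2)"
proof (rule L2_average_le(1)[OF v int h])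
  have sub: "set_integrable lborel {a..b} (\<lambda>s. (v s)\<^sup>2)" if "-S \<le> a" "b \<le> S" for a b
    by (rule set_integrable_subset[OF int]) (use that in auto)
  let ?J = "\<lambda>a b. LINT s:{a..b}|lborel. (v s)\<^sup>2"
  \<comment> \<open>A crude bound is enough, since only integrability is wanted: 4 = 2 + 2 from (a +
    b)^2 <= 2 a^2 + 2 b^2, with both translates staying inside [-S,S].\<close>
  show "0 \<le> 4 * ?J (-S) S" by (simp add: set_integral_nonneg_all)
  fix \<tau> assume t: "0 < \<tau>" "\<tau> \<le> h"
  have mono: "?J a b \<le> ?J (-S) S" if "-S \<le> a" "a \<le> b" "b \<le> S" for a b
    using set_integral_split_Icc[of "-S" a S "\<lambda>s. (v s)\<^sup>2"] set_integral_split_Icc[of a b S "\<lambda>s. (v s)\<^sup>2"] sub that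
      set_integral_nonneg_all[of "{-S..a}" "\<lambda>s. (v s)\<^sup>2"] set_integral_nonneg_all[of "{b..S}" "\<lambda>s. (v s)\<^sup>2"]
    by simp
  have "(LINT s:{0..S}|lborel. (v (s - \<tau>) + (- v s))\<^sup>2)
     \<le> 2 * (LINT s:{0..S}|lborel. (v (s - \<tau>))\<^sup>2) + 2 * (LINT s:{0..S}|lborel. (- v s)\<^sup>2)"
    using v t h sub by (intro set_integral_sq_add_le set_integrable_shift_Icc[of _ \<tau> _ "\<lambda>s. (v s)\<^sup>2"]) auto
  also have "(LINT s:{0..S}|lborel. (v (s - \<tau>))\<^sup>2) = ?J (0 - \<tau>) (S - \<tau>)"
    by (rule set_integral_shift_Icc)
  finally show "(LINT s:{0..S}|lborel. (v (s - \<tau>) - v s)\<^sup>2) \<le> 4 * ?J (-S) S"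
    using mono[of "0 - \<tau>" "S - \<tau>"] mono[of 0 S] t h by simp
qed

lemma tendsto_L2_average:
  fixes v :: "real \<Rightarrow> real"
  assumes S: "S > 0" and v: "v \<in> borel_measurable borel"
    and int: "set_integrable lborel {-S..S} (\<lambda>s. (v s)\<^sup>2)"
  shows "((\<lambda>h. LINT s:{0..S}|lborel. ((LINT \<tau>:{s - h..s}|lborel. v \<tau>) / h - v s)\<^sup>2) \<longlongrightarrow> 0) (at_right 0)"
proof (rule tendstoI)
  fix e :: real assume "e > 0"
  then have "\<forall>\<^sub>F h in at_right 0. dist (LINT s:{0..S}|lborel. (v (s - h) - v s)\<^sup>2) 0 < e / 2"
    using tendstoD[OF tendsto_L2_translation[OF S v int], of "e/2"] by simp
  then obtain b where b: "b > 0" "\<And>h. 0 < h \<Longrightarrow> h < b \<Longrightarrow> (LINT s:{0..S}|lborel. (v (s - h) - v s)\<^sup>2) \<le> e / 2"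
    by (force simp: eventually_at_right_field)
  have "\<forall>\<^sub>F h in at_right 0. 0 < h \<and> h < min b S"
    using S b by (auto simp: eventually_at_right_field intro!: exI[of _ "min b S"])
  then show "\<forall>\<^sub>F h in at_right 0. dist (LINT s:{0..S}|lborel. ((LINT \<tau>:{s - h..s}|lborel. v \<tau>) / h - v s)\<^sup>2) 0 < e"
  proof eventually_elim
    case (elim h)
    have "(LINT s:{0..S}|lborel. ((LINT \<tau>:{s - h..s}|lborel. v \<tau>) / h - v s)\<^sup>2) \<le> e / 2"
      by (rule L2_average_le(2)[OF v int]) (use elim b \<open>e > 0\<close> in auto)
    moreover have "0 \<le> (LINT s:{0..S}|lborel. ((LINT \<tau>:{s - h..s}|lborel. v \<tau>) / h - v s)\<^sup>2)"
      by (intro set_integral_nonneg_all) auto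
    ultimately show ?case using \<open>e > 0\<close> by simp
  qed
qed

section \<open>The generator of translation on quasi-periodic functions\<close>

lemma AE_lborel_shift:
  fixes P :: "real \<Rightarrow> bool"
  assumes "AE s in lborel. P s"
  shows "AE s in lborel. P (t + s)"
proof -
  from assms obtain N where N: "N \<in> null_sets lborel" "{s. \<not> P s} \<subseteq> N"
    by (auto simp: eventually_ae_filter)
  have [measurable]: "N \<in> sets borel" using N(1) by auto
  have "AE s in lborel. s \<notin> N" using N(1) by (rule AE_not_in)
  then have "AE s in lborel. t + 1 * s \<notin> N" by (intro AE_borel_affine[where P="\<lambda>s. s \<notin> N"]) auto
  then show ?thesis by eventually_elim (use N(2) in auto)
qed

lemma set_integral_quasi_periodic:
  fixes f :: "real \<Rightarrow> real"
  assumes "\<And>s. f (s + S) = m * f s"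
  shows "(LINT s:{a + S..b + S}|lborel. f s) = m * (LINT s:{a..b}|lborel. f s)"
  using set_integral_shift_Icc[of a b f "-S"] assms by simp

lemma borel_measurable_indefinite_integral:
  fixes f :: "real \<Rightarrow> real"
  assumes [measurable]: "f \<in> borel_measurable borel"
  shows "(\<lambda>s. LINT t:{0..s}|lborel. f t) \<in> borel_measurable borel"
proof -
  have "(\<lambda>s. LINT t|lborel. (if 0 \<le> t \<and> t \<le> s then f t else 0)) \<in> borel_measurable borel"
    by measurable
  also have "(\<lambda>s. LINT t|lborel. (if 0 \<le> t \<and> t \<le> s then f t else 0)) = (\<lambda>s. LINT t:{0..s}|lborel. f t)"
    by (auto simp: fun_eq_iff set_lebesgue_integral_def intro!: Bochner_Integration.integral_cong)
  finally show ?thesis .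
qed

lemma AE_zero_if_set_integral_sq_zero:
  fixes f :: "'a \<Rightarrow> real"
  assumes A: "A \<in> sets M" and f: "set_integrable M A (\<lambda>s. (f s)\<^sup>2)" and z: "(LINT s:A|M. (f s)\<^sup>2) = 0"
  shows "AE s in M. s \<in> A \<longrightarrow> f s = 0"
proof -
  have "AE s in M. indicator A s *\<^sub>R (f s)\<^sup>2 = 0"
    using f z by (subst integral_nonneg_eq_0_iff_AE[symmetric])
      (auto simp: set_integrable_def set_lebesgue_integral_def)
  then show ?thesis by eventually_elim (auto simp: indicator_def)
qed

text \<open>\<open>v\<close> is the state in characteristic coordinates and \<open>\<zeta>\<close>
  the candidate for its image under the generator. The multiplier m will be exp \<theta>, the same
  for both, since translation commutes with the shift by S. Integrability is asked on [-S,S] because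
  s - h leaves [0,S] on the left.\<close>

locale quasi_periodic_pair =
  fixes v \<zeta> :: "real \<Rightarrow> real" and S m :: real
  assumes S: "S > 0" and m: "m > 0"
    and v_meas[measurable]: "v \<in> borel_measurable borel"
    and z_meas[measurable]: "\<zeta> \<in> borel_measurable borel"
    and v_sq: "set_integrable lborel {-S..S} (\<lambda>s. (v s)\<^sup>2)"
    and z_sq: "set_integrable lborel {-S..S} (\<lambda>s. (\<zeta> s)\<^sup>2)"
    and v_per: "\<And>s. v (s + S) = m * v s"
    and z_per: "\<And>s. \<zeta> (s + S) = m * \<zeta> s"
begin

lemma v_int: "-S \<le> a \<Longrightarrow> b \<le> S \<Longrightarrow> set_integrable lborel {a..b} v"
  by (rule set_integrable_subset[OF set_integrable_if_sq_Icc[OF _ v_sq]]) (auto simp: set_borel_measurable_def)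

lemma z_int: "-S \<le> a \<Longrightarrow> b \<le> S \<Longrightarrow> set_integrable lborel {a..b} \<zeta>"
  by (rule set_integrable_subset[OF set_integrable_if_sq_Icc[OF _ z_sq]]) (auto simp: set_borel_measurable_def)

text \<open>The quotient is exactly an average of \<zeta> over [s - h, s], so convergence of short
  averages applies. Near the left end the translate leaves [0,S]; there \<open>YS\<close> matches
  the quasi-periodicity of \<zeta>, and the primitive continues across 0.\<close>

lemma translation_generator_limit:
  fixes Y :: "real \<Rightarrow> real"
  assumes Y: "\<And>s. s \<in> {0..S} \<Longrightarrow> Y s = Y 0 - (LINT t:{0..s}|lborel. \<zeta> t)"
    and YS: "Y S = m * Y 0"
    and vY: "AE s in lborel. s \<in> {0..S} \<longrightarrow> v s = Y s"
  shows "((\<lambda>h. LINT s:{0..S}|lborel. ((v (s - h) - v s) / h - \<zeta> s)\<^sup>2) \<longlongrightarrow> 0) (at_right 0)"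
proof -
  have Ydiff: "Y s - Y t = (LINT t:{s..t}|lborel. \<zeta> t)" if "0 \<le> s" "s \<le> t" "t \<le> S" for s t
    using Y[of s] Y[of t] set_integral_split_Icc[of 0 s t \<zeta>] z_int[of 0 t] that S by simp
  have diff: "AE s in lborel. s \<in> {0..S} \<longrightarrow> v (s - h) - v s = (LINT t:{s - h..s}|lborel. \<zeta> t)"
    if h: "0 < h" "h < S" for h
    \<comment> \<open>Three copies of \<open>vY\<close>: at s, at s - h, and at s - h + S for the
      points where s - h is negative.\<close>
    using vY AE_lborel_shift[OF vY, of "-h"] AE_lborel_shift[OF vY, of "S - h"]
  proof eventually_elim
    case (elim s)
    show ?case
    proof
      assume s: "s \<in> {0..S}"
      show "v (s - h) - v s = (LINT t:{s - h..s}|lborel. \<zeta> t)"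
      proof (cases "h \<le> s")
        case True
        then show ?thesis using elim s h Ydiff[of "s-h" s] by (simp add: algebra_simps)
      next
        case False
        have "m * v (s - h) = v (s - h + S)" by (simp add: v_per)
        also have "\<dots> = Y (s - h + S)" using elim(3) s h False by (simp add: algebra_simps)
        also have "\<dots> = Y S + (LINT t:{(s - h) + S..0 + S}|lborel. \<zeta> t)"
          using Ydiff[of "s - h + S" S] s h False by simp
        also have "\<dots> = m * (Y 0 + (LINT t:{s - h..0}|lborel. \<zeta> t))"
          unfolding set_integral_quasi_periodic[where f=\<zeta> and S=S and m=m, OF z_per] YS by (simp add: algebra_simps)
        finally have "v (s - h) = Y 0 + (LINT t:{s - h..0}|lborel. \<zeta> t)" using m by simp
        moreover have "v s = Y 0 - (LINT t:{0..s}|lborel. \<zeta> t)" using elim(1) s Y[of s] by simp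
        moreover have "(LINT t:{s - h..s}|lborel. \<zeta> t) = (LINT t:{s - h..0}|lborel. \<zeta> t) + (LINT t:{0..s}|lborel. \<zeta> t)"
          using s h False by (intro set_integral_split_Icc z_int) auto
        ultimately show ?thesis by simp
      qed
    qed
  qed
  have "\<forall>\<^sub>F h in at_right 0. 0 < h \<and> h < S"
    using S by (auto simp: eventually_at_right_field intro!: exI[of _ S])
  then have "\<forall>\<^sub>F h in at_right 0. (LINT s:{0..S}|lborel. ((LINT \<tau>:{s - h..s}|lborel. \<zeta> \<tau>) / h - \<zeta> s)\<^sup>2)
     = (LINT s:{0..S}|lborel. ((v (s - h) - v s) / h - \<zeta> s)\<^sup>2)"
  proof eventually_elim
    case (elim h)
    have [measurable]: "(\<lambda>s. LINT \<tau>:{s - h..s}|lborel. \<zeta> \<tau>) \<in> borel_measurable borel"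
      by (rule borel_measurable_window_integral) simp
    show ?case
    proof (rule set_lebesgue_integral_cong_AE)
      show "AE s\<in>{0..S} in lborel. ((LINT \<tau>:{s - h..s}|lborel. \<zeta> \<tau>) / h - \<zeta> s)\<^sup>2 = ((v (s - h) - v s) / h - \<zeta> s)\<^sup>2"
        using diff[of h] elim by auto
    qed measurable
  qed
  then show ?thesis
    by (rule Lim_transform_eventually[OF tendsto_L2_average[OF S z_meas z_sq]])
qed

text \<open>Integrating the difference quotient over [0,s] telescopes: only the window averages at 0
  and at s remain, so V h 0 - V h s - Z s is the integral of the error D h, small uniformly in s by
  Cauchy-Schwarz. Thus r = v + Z is L2-close to the constants V h 0, hence constant itself. The same
  identity at s = S, where quasi-periodicity gives V h S = m V h 0, yields the boundary
  condition.\<close>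

lemma translation_generator_primitive:
  assumes lim: "((\<lambda>h. LINT s:{0..S}|lborel. ((v (s - h) - v s) / h - \<zeta> s)\<^sup>2) \<longlongrightarrow> 0) (at_right 0)"
  obtains C where "AE s in lborel. s \<in> {0..S} \<longrightarrow> v s = C - (LINT t:{0..s}|lborel. \<zeta> t)"
    and "C - (LINT t:{0..S}|lborel. \<zeta> t) = m * C"
proof -
  define Z where "Z = (\<lambda>s. LINT t:{0..s}|lborel. \<zeta> t)"
  define D where "D = (\<lambda>h s. (v (s - h) - v s) / h - \<zeta> s)"
  define E where "E = (\<lambda>h. LINT s:{0..S}|lborel. (D h s)\<^sup>2)"
  define V where "V = (\<lambda>h s. (LINT \<tau>:{s - h..s}|lborel. v \<tau>) / h)"
  define A where "A = (\<lambda>h. LINT s:{0..S}|lborel. (V h s - v s)\<^sup>2)"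
  define r where "r = (\<lambda>s. v s + Z s)"
  have E0: "(E \<longlongrightarrow> 0) (at_right 0)" using lim by (simp add: E_def D_def)
  have A0: "(A \<longlongrightarrow> 0) (at_right 0)" using tendsto_L2_average[OF S v_meas v_sq] by (simp add: A_def V_def)
  have [measurable]: "Z \<in> borel_measurable borel" unfolding Z_def by (rule borel_measurable_indefinite_integral) simp
  have [measurable]: "r \<in> borel_measurable borel" unfolding r_def by measurable
  have [measurable]: "D h \<in> borel_measurable borel" for h unfolding D_def by measurable
  have v_sq': "set_integrable lborel {0..S} (\<lambda>s. (v s)\<^sup>2)"
    by (rule set_integrable_subset[OF v_sq]) (use S in auto)
  have Zbound: "\<bar>Z s\<bar> \<le> (LINT t:{0..S}|lborel. \<bar>\<zeta> t\<bar>)" if "s \<in> {0..S}" for s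
  proof -
    have za: "set_integrable lborel {a..b} (\<lambda>t. \<bar>\<zeta> t\<bar>)" if "-S \<le> a" "b \<le> S" for a b
      using z_int[OF that] by (rule set_integrable_abs)
    have "\<bar>Z s\<bar> \<le> (LINT t:{0..s}|lborel. \<bar>\<zeta> t\<bar>)"
      unfolding Z_def set_lebesgue_integral_def by (rule order_trans[OF integral_abs_bound]) (simp add: abs_mult)
    also have "\<dots> \<le> (LINT t:{0..S}|lborel. \<bar>\<zeta> t\<bar>)"
      using set_integral_split_Icc[of 0 s S "\<lambda>t. \<bar>\<zeta> t\<bar>"] za[of 0 S] that S
        set_integral_nonneg_all[of "{s..S}" "\<lambda>t. \<bar>\<zeta> t\<bar>"] by simp
    finally show ?thesis .
  qed
  have Zsq: "set_integrable lborel {0..S} (\<lambda>s. (Z s)\<^sup>2)"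
  proof (rule set_integrable_bound[OF set_integrable_const_Icc[of 0 S "(LINT t:{0..S}|lborel. \<bar>\<zeta> t\<bar>)\<^sup>2"]])
    show "AE s in lborel. s \<in> {0..S} \<longrightarrow> norm ((Z s)\<^sup>2) \<le> norm ((LINT t:{0..S}|lborel. \<bar>\<zeta> t\<bar>)\<^sup>2)"
    proof (intro AE_I2 impI)
      fix s assume "s \<in> {0..S}"
      from power_mono[OF Zbound[OF this], of 2] show "norm ((Z s)\<^sup>2) \<le> norm ((LINT t:{0..S}|lborel. \<bar>\<zeta> t\<bar>)\<^sup>2)" by simp
    qed
  qed (simp add: set_borel_measurable_def)
  have rsq: "set_integrable lborel {0..S} (\<lambda>s. (r s)\<^sup>2)"
    unfolding r_def using v_sq' Zsq by (intro set_integrable_sq_add) auto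
  have rint: "set_integrable lborel {0..S} r"
    by (rule set_integrable_if_sq_Icc[OF _ rsq]) (simp add: set_borel_measurable_def)
  \<comment> \<open>The mean of r. By \<open>dist_k\<close> it is the nearest constant in L2, so one
    inequality for the constant V h 0 controls both the distance of r from C and that of V h 0 from
    C.\<close>
  define C where "C = (LINT s:{0..S}|lborel. r s) / S"
  have JC: "(LINT s:{0..S}|lborel. r s) = S * C" using S by (simp add: C_def)
  have dist_k: "(LINT s:{0..S}|lborel. (r s - k)\<^sup>2) = (LINT s:{0..S}|lborel. (r s - C)\<^sup>2) + S * (k - C)\<^sup>2" for k
    using set_integral_sq_dist_const(2)[OF _ rint rsq, of k] set_integral_sq_dist_const(2)[OF _ rint rsq, of C] S
    by (simp add: JC power2_eq_square algebra_simps)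
  have key: "\<bar>V h 0 - (V h s + Z s)\<bar>\<^sup>2 \<le> S * E h" "set_integrable lborel {0..S} (\<lambda>s. (D h s)\<^sup>2)"
    if h: "0 < h" "h < S" and s: "s \<in> {0..S}" for h s
  proof -
    have "set_integrable lborel {0..S} (\<lambda>s. ((v (s - h) - v s) / h)\<^sup>2)"
      using set_integrable_sq_translate_diff[OF v_meas v_sq, of h] h by (simp add: power_divide)
    moreover have "set_integrable lborel {0..S} (\<lambda>s. (\<zeta> s)\<^sup>2)"
      by (rule set_integrable_subset[OF z_sq]) (use S in auto)
    ultimately show Dsq: "set_integrable lborel {0..S} (\<lambda>s. (D h s)\<^sup>2)"
      unfolding D_def by (intro set_integrable_sq_diff) auto
    have Dsq': "set_integrable lborel {0..s} (\<lambda>s. (D h s)\<^sup>2)"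
      by (rule set_integrable_subset[OF Dsq]) (use s in auto)
    have Dint: "set_integrable lborel {0..s} (D h)"
      by (rule set_integrable_if_sq_Icc[OF _ Dsq']) (simp add: set_borel_measurable_def)
    have vh: "set_integrable lborel {0..s} (\<lambda>t. v (t - h))"
      by (rule set_integrable_shift_Icc, rule v_int) (use s h in auto)
    have vs: "set_integrable lborel {0..s} v" by (rule v_int) (use s h in auto)
    have zs: "set_integrable lborel {0..s} \<zeta>" by (rule z_int) (use s h in auto)
    \<comment> \<open>The interval [-h,s] is split in two ways; comparing the splittings is the
      telescoping.\<close>
    have "(LINT t:{- h..s}|lborel. v t) = (LINT t:{- h..0}|lborel. v t) + (LINT t:{0..s}|lborel. v t)"
      "(LINT t:{- h..s}|lborel. v t) = (LINT t:{- h..s - h}|lborel. v t) + (LINT t:{s - h..s}|lborel. v t)"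
      using s h by (auto intro!: set_integral_split_Icc v_int)
    moreover have "(LINT t:{- h..s - h}|lborel. v t) = (LINT t:{0..s}|lborel. v (t - h))"
      using set_integral_shift_Icc[of 0 s v h] by simp
    moreover have "(LINT t:{0..s}|lborel. v (t - h)) - (LINT t:{0..s}|lborel. v t) = (LINT t:{0..s}|lborel. v (t - h) - v t)"
      by (rule set_integral_diff(2)[OF vh vs, symmetric])
    moreover have "(LINT t:{0..s}|lborel. v (t - h) - v t) = (LINT t:{0..s}|lborel. h * (D h t + \<zeta> t))"
      using h by (intro set_lebesgue_integral_cong) (auto simp: D_def field_simps)
    moreover have "(LINT t:{0..s}|lborel. h * (D h t + \<zeta> t)) = h * ((LINT t:{0..s}|lborel. D h t) + Z s)"
      unfolding Z_def by (subst set_integral_mult_right) (simp add: set_integral_add(2)[OF Dint zs])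
    ultimately have "(LINT t:{- h..0}|lborel. v t) - (LINT t:{s - h..s}|lborel. v t) = h * ((LINT t:{0..s}|lborel. D h t) + Z s)"
      by linarith
    then have eq: "V h 0 - (V h s + Z s) = (LINT t:{0..s}|lborel. D h t)"
      using h by (simp add: V_def field_simps)
    show "\<bar>V h 0 - (V h s + Z s)\<bar>\<^sup>2 \<le> S * E h"
    proof (cases "s = 0")
      case True
      have "(LINT t:{0..s}|lborel. D h t) = 0" using True by (simp add: set_integral_at_point)
      then show ?thesis unfolding eq using S by (simp add: E_def set_integral_nonneg_all)
    next
      case False
      have "(LINT t:{0..s}|lborel. D h t)\<^sup>2 \<le> (s - 0) * (LINT t:{0..s}|lborel. (D h t)\<^sup>2)"
        using False s by (intro set_integral_Cauchy_Schwarz_Icc Dint Dsq') auto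
      also have "\<dots> \<le> S * E h"
      proof (rule mult_mono)
        show "(LINT t:{0..s}|lborel. (D h t)\<^sup>2) \<le> E h"
          unfolding E_def using set_integral_split_Icc[OF _ _ Dsq, of s] s
            set_integral_nonneg_all[of "{s..S}" "\<lambda>t. (D h t)\<^sup>2"] by simp
      qed (use s S in \<open>auto intro: set_integral_nonneg_all\<close>)
      finally show ?thesis unfolding eq by simp
    qed
  qed
  have near: "\<forall>\<^sub>F h in at_right 0. 0 < h \<and> h < S"
    using S by (auto simp: eventually_at_right_field intro!: exI[of _ S])
  have main: "(LINT s:{0..S}|lborel. (r s - V h 0)\<^sup>2) \<le> 2 * A h + 2 * S * (S * E h)" if h: "0 < h" "h < S" for h
  proof -
    have Aint: "set_integrable lborel {0..S} (\<lambda>s. (V h s - v s)\<^sup>2)"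
      unfolding V_def by (rule L2_average_integrable[OF v_meas v_sq]) (use h in auto)
    have "(LINT s:{0..S}|lborel. (r s - V h 0)\<^sup>2) \<le> (LINT s:{0..S}|lborel. 2 * (V h s - v s)\<^sup>2 + 2 * (S * E h))"
    proof (rule set_integral_mono)
      show "set_integrable lborel {0..S} (\<lambda>s. (r s - V h 0)\<^sup>2)"
        by (rule set_integral_sq_dist_const(1)[OF _ rint rsq]) (use S in simp)
      show "set_integrable lborel {0..S} (\<lambda>s. 2 * (V h s - v s)\<^sup>2 + 2 * (S * E h))"
        using Aint by (intro set_integral_add(1) set_integrable_mult_right set_integrable_const_Icc) auto
      fix s assume s: "s \<in> {0..S}"
      have "(r s - V h 0)\<^sup>2 = ((V h s - v s) + (V h 0 - (V h s + Z s)))\<^sup>2"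
        by (simp add: r_def power2_eq_square algebra_simps)
      also have "\<dots> \<le> 2 * (V h s - v s)\<^sup>2 + 2 * (V h 0 - (V h s + Z s))\<^sup>2" by (rule sq_add_le)
      also have "\<dots> \<le> 2 * (V h s - v s)\<^sup>2 + 2 * (S * E h)" using key(1)[OF h s] by simp
      finally show "(r s - V h 0)\<^sup>2 \<le> 2 * (V h s - v s)\<^sup>2 + 2 * (S * E h)" .
    qed
    also have "\<dots> = (LINT s:{0..S}|lborel. 2 * (V h s - v s)\<^sup>2) + (LINT s:{0..S}|lborel. 2 * (S * E h))"
      using Aint by (intro set_integral_add(2) set_integrable_mult_right set_integrable_const_Icc) auto
    also have "\<dots> = 2 * A h + 2 * S * (S * E h)" using S by (simp add: A_def set_integral_const_Icc)
    finally show ?thesis .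
  qed
  have lim0: "((\<lambda>h. 2 * A h + 2 * S * (S * E h)) \<longlongrightarrow> 0) (at_right 0)"
    by (rule tendsto_eq_intros A0 E0 refl | simp)+
  have rC: "(LINT s:{0..S}|lborel. (r s - C)\<^sup>2) \<le> 0"
  proof (rule tendsto_le[OF _ lim0 tendsto_const])
    show "\<forall>\<^sub>F h in at_right 0. (LINT s:{0..S}|lborel. (r s - C)\<^sup>2) \<le> 2 * A h + 2 * S * (S * E h)"
      using near
    proof eventually_elim
      case (elim h)
      then show ?case using main[of h] dist_k[of "V h 0"] S by (smt (verit) mult_nonneg_nonneg zero_le_power2)
    qed
  qed simp
  have rC0: "(LINT s:{0..S}|lborel. (r s - C)\<^sup>2) = 0"
    using rC set_integral_nonneg_all[of "{0..S}" "\<lambda>s. (r s - C)\<^sup>2" lborel] by simp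
  have ae: "AE s in lborel. s \<in> {0..S} \<longrightarrow> r s - C = 0"
    by (rule AE_zero_if_set_integral_sq_zero[OF _ _ rC0]) (use set_integral_sq_dist_const(1)[OF _ rint rsq] S in auto)
  have VC: "((\<lambda>h. V h 0) \<longlongrightarrow> C) (at_right 0)"
  proof -
    have "((\<lambda>h. (V h 0 - C)\<^sup>2) \<longlongrightarrow> 0) (at_right 0)"
    proof (rule tendsto_sandwich[OF _ _ tendsto_const])
      show "((\<lambda>h. (2 * A h + 2 * S * (S * E h)) / S) \<longlongrightarrow> 0) (at_right 0)"
        using tendsto_divide[OF lim0 tendsto_const, of S] S by simp
      show "\<forall>\<^sub>F h in at_right 0. (V h 0 - C)\<^sup>2 \<le> (2 * A h + 2 * S * (S * E h)) / S"
        using near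
      proof eventually_elim
        case (elim h)
        then show ?case using main[of h] dist_k[of "V h 0"] S rC0 by (simp add: field_simps)
      qed
    qed simp
    then have "((\<lambda>h. sqrt ((V h 0 - C)\<^sup>2)) \<longlongrightarrow> sqrt 0) (at_right 0)" by (intro tendsto_intros)
    then have "((\<lambda>h. V h 0 - C) \<longlongrightarrow> 0) (at_right 0)" by (simp add: tendsto_rabs_zero_iff)
    then show ?thesis by (simp add: Lim_null[symmetric])
  qed
  \<comment> \<open>Two limits of one expression: by V h 0 -> C, and by the telescoped identity at
    S, whose bound S * E h tends to 0.\<close>
  have "((\<lambda>h. (V h 0 - (m * V h 0 + Z S))\<^sup>2) \<longlongrightarrow> (C - (m * C + Z S))\<^sup>2) (at_right 0)"
    by (intro tendsto_intros VC)
  moreover have "((\<lambda>h. (V h 0 - (m * V h 0 + Z S))\<^sup>2) \<longlongrightarrow> 0) (at_right 0)"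
  proof (rule tendsto_sandwich[OF _ _ tendsto_const])
    show "((\<lambda>h. S * E h) \<longlongrightarrow> 0) (at_right 0)" by (rule tendsto_eq_intros E0 refl | simp)+
    show "\<forall>\<^sub>F h in at_right 0. (V h 0 - (m * V h 0 + Z S))\<^sup>2 \<le> S * E h"
      using near
    proof eventually_elim
      case (elim h)
      have "V h S = m * V h 0"
        using set_integral_quasi_periodic[where f=v and S=S and m=m and a="-h" and b=0, OF v_per] by (simp add: V_def)
      then show ?case using key(1)[of h S] elim S by simp
    qed
  qed simp
  ultimately have "(C - (m * C + Z S))\<^sup>2 = 0" by (rule tendsto_unique[rotated]) simp
  then have "C - (LINT t:{0..S}|lborel. \<zeta> t) = m * C" by (simp add: Z_def)
  moreover have "AE s in lborel. s \<in> {0..S} \<longrightarrow> v s = C - (LINT t:{0..s}|lborel. \<zeta> t)"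
    using ae by eventually_elim (auto simp: r_def Z_def)
  ultimately show ?thesis using that by blast
qed

end

section \<open>Calculus of indefinite integrals\<close>

text \<open>Absolute continuity in integral form: F is fixed at every point, while f matters only
  almost everywhere.\<close>

definition primitive_on :: "real \<Rightarrow> (real \<Rightarrow> real) \<Rightarrow> (real \<Rightarrow> real) \<Rightarrow> bool" where
  "primitive_on L F f \<longleftrightarrow> set_integrable lborel {0..L} f \<and>
     (\<forall>s\<in>{0..L}. F s = F 0 + (LINT \<tau>:{0..s}|lborel. f \<tau>))"

lemma primitive_onD:
  assumes "primitive_on L F f" "0 \<le> s" "s \<le> t" "t \<le> L"
  shows "F t - F s = (LINT \<tau>:{s..t}|lborel. f \<tau>)"
    and "set_integrable lborel {s..t} f"
proof -
  have i: "set_integrable lborel {0..L} f" using assms by (simp add: primitive_on_def)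
  show "set_integrable lborel {s..t} f" by (rule set_integrable_subset[OF i]) (use assms in auto)
  have *: "F x = F 0 + (LINT \<tau>:{0..x}|lborel. f \<tau>)" if "x \<in> {0..L}" for x
    using assms(1) that unfolding primitive_on_def by blast
  have "F t = F 0 + (LINT \<tau>:{0..t}|lborel. f \<tau>)" "F s = F 0 + (LINT \<tau>:{0..s}|lborel. f \<tau>)"
    by (rule *; use assms in simp)+
  moreover have "set_integrable lborel {0..t} f" by (rule set_integrable_subset[OF i]) (use assms in auto)
  ultimately show "F t - F s = (LINT \<tau>:{s..t}|lborel. f \<tau>)"
    using set_integral_split_Icc[of 0 s t f] assms by simp
qed

lemma continuous_on_set_integral_Icc:
  fixes f :: "real \<Rightarrow> real"
  assumes "set_integrable lborel {0..L} f"
  shows "continuous_on {0..L} (\<lambda>s. LINT \<tau>:{0..s}|lborel. f \<tau>)"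
proof -
  have "continuous_on {0..L} (\<lambda>s. integral {0..s} f)"
    by (rule indefinite_integral_continuous_1) (rule set_borel_integral_eq_integral(1)[OF assms])
  moreover have "integral {0..s} f = (LINT \<tau>:{0..s}|lborel. f \<tau>)" if "s \<in> {0..L}" for s
  proof -
    have "set_integrable lborel {0..s} f" by (rule set_integrable_subset[OF assms]) (use that in auto)
    then show ?thesis using set_borel_integral_eq_integral(2) by metis
  qed
  ultimately show ?thesis by (metis (no_types, lifting) continuous_on_eq)
qed

lemma primitive_on_continuous:
  assumes "primitive_on L F f"
  shows "continuous_on {0..L} F"
proof -
  have "continuous_on {0..L} (\<lambda>s. F 0 + (LINT \<tau>:{0..s}|lborel. f \<tau>))"
    using assms by (intro continuous_intros continuous_on_set_integral_Icc) (simp add: primitive_on_def)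
  then show ?thesis
    by (rule continuous_on_eq) (use assms[unfolded primitive_on_def] in metis)
qed

lemma set_integral_abs_le:
  fixes f g :: "'a \<Rightarrow> real"
  assumes "set_integrable M A f" "set_integrable M A g" "A \<in> sets M" "AE x in M. x \<in> A \<longrightarrow> \<bar>f x\<bar> \<le> g x"
  shows "\<bar>LINT x:A|M. f x\<bar> \<le> (LINT x:A|M. g x)"
proof -
  have "\<bar>LINT x:A|M. f x\<bar> \<le> (LINT x:A|M. \<bar>f x\<bar>)"
    unfolding set_lebesgue_integral_def by (rule order_trans[OF integral_abs_bound]) (simp add: abs_mult)
  also have "\<dots> \<le> (LINT x:A|M. g x)"
    using assms by (intro set_integral_mono_AE set_integrable_abs) auto
  finally show ?thesis .
qed

lemma set_integrable_mult_continuous: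
  fixes f G :: "real \<Rightarrow> real"
  assumes f: "set_integrable lborel {a..b} f" and G: "continuous_on {a..b} G"
  shows "set_integrable lborel {a..b} (\<lambda>s. f s * G s)"
proof -
  have "compact (G ` {a..b})" using G by (intro compact_continuous_image) auto
  from compact_imp_bounded[OF this] obtain B where "\<forall>x\<in>G ` {a..b}. norm x \<le> B"
    by (auto simp: bounded_iff)
  then have B: "\<bar>G s\<bar> \<le> B" if "s \<in> {a..b}" for s using that by auto
  have [measurable]: "(\<lambda>s. indicator {a..b} s *\<^sub>R f s) \<in> borel_measurable borel"
    using f by (auto simp: set_integrable_def dest: borel_measurable_integrable)
  have [measurable]: "(\<lambda>s. indicator {a..b} s *\<^sub>R G s) \<in> borel_measurable borel"
    using borel_integrable_atLeastAtMost'[OF G] by (auto simp: set_integrable_def dest: borel_measurable_integrable)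
  have "(\<lambda>s. (indicator {a..b} s *\<^sub>R f s) * (indicator {a..b} s *\<^sub>R G s)) \<in> borel_measurable lborel"
    by measurable
  also have "(\<lambda>s. (indicator {a..b} s *\<^sub>R f s) * (indicator {a..b} s *\<^sub>R G s)) = (\<lambda>s. indicator {a..b} s *\<^sub>R (f s * G s))"
    by (auto simp: fun_eq_iff indicator_def)
  finally have m: "set_borel_measurable lborel {a..b} (\<lambda>s. f s * G s)"
    by (simp add: set_borel_measurable_def)
  show ?thesis
  proof (rule set_integrable_bound[OF _ m])
    show "set_integrable lborel {a..b} (\<lambda>s. B * \<bar>f s\<bar>)"
      by (intro set_integrable_mult_right set_integrable_abs f)
    have "norm (f x * G x) \<le> norm (B * \<bar>f x\<bar>)" if "x \<in> {a..b}" for x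
    proof -
      have "\<bar>G x\<bar> * \<bar>f x\<bar> \<le> \<bar>B\<bar> * \<bar>f x\<bar>"
        by (rule mult_right_mono) (use B[OF that] in auto)
      then show ?thesis by (simp add: abs_mult mult.commute)
    qed
    then show "AE x in lborel. x \<in> {a..b} \<longrightarrow> norm (f x * G x) \<le> norm (B * \<bar>f x\<bar>)" by simp
  qed
qed

text \<open>The difference of the two sides of the conclusion has derivative zero everywhere, not just almost
  everywhere, hence is constant.\<close>

lemma primitive_on_if_small_error:
  assumes f: "set_integrable lborel {0..L} f"
    and err: "\<And>e. e > 0 \<Longrightarrow> \<exists>d>0. \<forall>s t. 0 \<le> s \<and> s \<le> t \<and> t \<le> L \<and> t - s < d \<longrightarrow>
      \<bar>F t - F s - (LINT \<tau>:{s..t}|lborel. f \<tau>)\<bar> \<le> e * (t - s)"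
  shows "primitive_on L F f"
proof -
  define D where "D = (\<lambda>s. F s - (LINT \<tau>:{0..s}|lborel. f \<tau>))"
  have Dd: "D t - D s = F t - F s - (LINT \<tau>:{s..t}|lborel. f \<tau>)" if "0 \<le> s" "s \<le> t" "t \<le> L" for s t
  proof -
    have "set_integrable lborel {0..t} f" by (rule set_integrable_subset[OF f]) (use that in auto)
    then show ?thesis using set_integral_split_Icc[of 0 s t f] that by (simp add: D_def)
  qed
  have "(D has_derivative (\<lambda>h. 0)) (at x within {0..L})" if x: "x \<in> {0..L}" for x
    unfolding has_derivative_within_alt
  proof (intro conjI allI impI)
    fix e :: real assume "e > 0"
    from err[OF this] obtain d where d: "d > 0" "\<And>s t. 0 \<le> s \<Longrightarrow> s \<le> t \<Longrightarrow> t \<le> L \<Longrightarrow> t - s < d \<Longrightarrow>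
      \<bar>D t - D s\<bar> \<le> e * (t - s)" using Dd by force
    show "\<exists>d>0. \<forall>y\<in>{0..L}. norm (y - x) < d \<longrightarrow> norm (D y - D x - 0) \<le> e * norm (y - x)"
    proof (intro exI conjI ballI impI)
      fix y assume y: "y \<in> {0..L}" "norm (y - x) < d"
      show "norm (D y - D x - 0) \<le> e * norm (y - x)"
      proof (cases "x \<le> y")
        case True then show ?thesis using d(2)[of x y] x y by simp
      next
        case False then show ?thesis using d(2)[of y x] x y by (simp add: abs_minus_commute)
      qed
    qed (rule d)
  qed simp
  then obtain c where "\<And>x. x \<in> {0..L} \<Longrightarrow> D x = c"
    using has_derivative_zero_constant[of "{0..L}" D] by auto
  moreover have "D 0 = F 0" by (simp add: D_def set_integral_at_point)
  ultimately have "F s = F 0 + (LINT \<tau>:{0..s}|lborel. f \<tau>)" if "s \<in> {0..L}" for s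
  proof -
    have "D s = c" "D 0 = c" using that by (auto intro: \<open>\<And>x. x \<in> {0..L} \<Longrightarrow> D x = c\<close>)
    moreover have "D s = F s - (LINT \<tau>:{0..s}|lborel. f \<tau>)" by (simp add: D_def)
    ultimately show ?thesis using \<open>D 0 = F 0\<close> by linarith
  qed
  then show ?thesis using f unfolding primitive_on_def by blast
qed

text \<open>Write the increment of P G as (P t - P s) G t + (G t - G s) P s and each increment as an
  integral. What differs from the claimed integral is p (G t - G) and g (P s - P), each contributing
  at most B (t - s) times the integral of |g| over [s,t]. The bound on p is what makes this error
  o(t - s).\<close>

lemma primitive_on_mult:
  assumes P: "primitive_on L P p" and G: "primitive_on L G g"
    and B: "AE s in lborel. s \<in> {0..L} \<longrightarrow> \<bar>p s\<bar> \<le> B"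
  shows "primitive_on L (\<lambda>s. P s * G s) (\<lambda>s. p s * G s + g s * P s)"
proof (rule primitive_on_if_small_error)
  have Pc: "continuous_on {0..L} P" and Gc: "continuous_on {0..L} G"
    using P G by (auto intro: primitive_on_continuous)
  have pint: "set_integrable lborel {0..L} p" and gint: "set_integrable lborel {0..L} g"
    using P G by (auto simp: primitive_on_def)
  show "set_integrable lborel {0..L} (\<lambda>s. p s * G s + g s * P s)"
    by (intro set_integral_add(1) set_integrable_mult_continuous pint gint Pc Gc)
  have B': "AE s in lborel. s \<in> {0..L} \<longrightarrow> \<bar>p s\<bar> \<le> \<bar>B\<bar>" using B by eventually_elim auto
  fix e :: real assume "e > 0"
  define e' where "e' = e / (2 * \<bar>B\<bar> + 1)"
  have e': "e' > 0" using \<open>e > 0\<close> by (simp add: e'_def)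
  \<comment> \<open>H bounds the variation of G; its uniform continuity makes the integral of |g|
    small over all short intervals at once.\<close>
  define H where "H = (\<lambda>s. LINT \<tau>:{0..s}|lborel. \<bar>g \<tau>\<bar>)"
  have gabs: "set_integrable lborel {0..L} (\<lambda>\<tau>. \<bar>g \<tau>\<bar>)" using gint by (rule set_integrable_abs)
  have "uniformly_continuous_on {0..L} H"
    unfolding H_def by (intro compact_uniformly_continuous continuous_on_set_integral_Icc gabs) auto
  then obtain d where d: "d > 0" "\<And>s t. s \<in> {0..L} \<Longrightarrow> t \<in> {0..L} \<Longrightarrow> \<bar>t - s\<bar> < d \<Longrightarrow> \<bar>H t - H s\<bar> < e'"
    using e' unfolding uniformly_continuous_on_def dist_real_def by metis
  show "\<exists>d>0. \<forall>s t. 0 \<le> s \<and> s \<le> t \<and> t \<le> L \<and> t - s < d \<longrightarrow>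
      \<bar>P t * G t - P s * G s - (LINT \<tau>:{s..t}|lborel. p \<tau> * G \<tau> + g \<tau> * P \<tau>)\<bar> \<le> e * (t - s)"
  proof (intro exI conjI allI impI, rule d(1), elim conjE)
    fix s t assume st: "0 \<le> s" "s \<le> t" "t \<le> L" "t - s < d"
    have sub: "set_integrable lborel {s'..t'} f" if "set_integrable lborel {0..L} f" "s \<le> s'" "t' \<le> t" for f :: "real \<Rightarrow> real" and s' t'
      by (rule set_integrable_subset[OF that(1)]) (use st that in auto)
    have cs: "continuous_on {s..t} P" "continuous_on {s..t} G"
      using st by (auto intro: continuous_on_subset[OF Pc] continuous_on_subset[OF Gc])
    have i1: "set_integrable lborel {s..t} (\<lambda>\<tau>. p \<tau> * G \<tau>)"
      by (intro set_integrable_mult_continuous sub[OF pint] cs) auto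
    have i2: "set_integrable lborel {s..t} (\<lambda>\<tau>. g \<tau> * P \<tau>)"
      by (intro set_integrable_mult_continuous sub[OF gint] cs) auto
    have i3: "set_integrable lborel {s..t} (\<lambda>\<tau>. p \<tau> * (G t - G \<tau>))"
      by (intro set_integrable_mult_continuous sub[OF pint] continuous_intros cs) auto
    have i4: "set_integrable lborel {s..t} (\<lambda>\<tau>. g \<tau> * (P s - P \<tau>))"
      by (intro set_integrable_mult_continuous sub[OF gint] continuous_intros cs) auto
    let ?J = "LINT \<tau>:{s..t}|lborel. \<bar>g \<tau>\<bar>"
    have J: "?J = H t - H s"
      using set_integral_split_Icc[of 0 s t "\<lambda>\<tau>. \<bar>g \<tau>\<bar>"] set_integrable_subset[OF gabs, of "{0..t}"] st by (simp add: H_def)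
    have J0: "0 \<le> ?J" by (intro set_integral_nonneg_all) auto
    have Je: "?J \<le> e'" using d(2)[of s t] st unfolding J by auto
    have Gb: "\<bar>G t - G \<tau>\<bar> \<le> ?J" if "\<tau> \<in> {s..t}" for \<tau>
    proof -
      have "\<bar>G t - G \<tau>\<bar> \<le> (LINT x:{\<tau>..t}|lborel. \<bar>g x\<bar>)"
        unfolding primitive_onD(1)[OF G, of \<tau> t] using that st
        by (subst primitive_onD(1)[OF G]) (auto intro!: set_integral_abs_le sub[OF gint] sub[OF gabs])
      also have "\<dots> \<le> ?J"
        using set_integral_split_Icc[of s \<tau> t "\<lambda>\<tau>. \<bar>g \<tau>\<bar>"] sub[OF gabs, of s t] that
          set_integral_nonneg_all[of "{s..\<tau>}" "\<lambda>\<tau>. \<bar>g \<tau>\<bar>" lborel] by simp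
      finally show ?thesis .
    qed
    have Pb: "\<bar>P s - P \<tau>\<bar> \<le> \<bar>B\<bar> * (t - s)" if "\<tau> \<in> {s..t}" for \<tau>
    proof -
      have "\<bar>P \<tau> - P s\<bar> \<le> (LINT x:{s..\<tau>}|lborel. \<bar>B\<bar>)"
        using that st B'
        by (subst primitive_onD(1)[OF P]) (auto intro!: set_integral_abs_le sub[OF pint] set_integrable_const_Icc elim!: AE_mp)
      also have "\<dots> \<le> \<bar>B\<bar> * (t - s)" using that by (simp add: set_integral_const_Icc mult.commute mult_left_mono)
      finally show ?thesis by (simp add: abs_minus_commute)
    qed
    have "P t * G t - P s * G s = (P t - P s) * G t + (G t - G s) * P s" by (simp add: algebra_simps)
    also have "\<dots> = (LINT \<tau>:{s..t}|lborel. p \<tau> * G t) + (LINT \<tau>:{s..t}|lborel. g \<tau> * P s)"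
      using primitive_onD(1)[OF P, of s t] primitive_onD(1)[OF G, of s t] st by simp
    finally have "P t * G t - P s * G s - (LINT \<tau>:{s..t}|lborel. p \<tau> * G \<tau> + g \<tau> * P \<tau>)
      = ((LINT \<tau>:{s..t}|lborel. p \<tau> * G t) - (LINT \<tau>:{s..t}|lborel. p \<tau> * G \<tau>))
        + ((LINT \<tau>:{s..t}|lborel. g \<tau> * P s) - (LINT \<tau>:{s..t}|lborel. g \<tau> * P \<tau>))"
      using set_integral_add(2)[OF i1 i2] by simp
    also have "\<dots> = (LINT \<tau>:{s..t}|lborel. p \<tau> * (G t - G \<tau>)) + (LINT \<tau>:{s..t}|lborel. g \<tau> * (P s - P \<tau>))"
      using i1 i2 sub[OF pint] sub[OF gint] by (simp add: right_diff_distrib set_integral_diff(2))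
    finally have eq: "P t * G t - P s * G s - (LINT \<tau>:{s..t}|lborel. p \<tau> * G \<tau> + g \<tau> * P \<tau>)
      = (LINT \<tau>:{s..t}|lborel. p \<tau> * (G t - G \<tau>)) + (LINT \<tau>:{s..t}|lborel. g \<tau> * (P s - P \<tau>))" .
    have a1: "\<bar>LINT \<tau>:{s..t}|lborel. p \<tau> * (G t - G \<tau>)\<bar> \<le> (LINT \<tau>:{s..t}|lborel. \<bar>B\<bar> * ?J)"
    proof (rule set_integral_abs_le[OF i3 set_integrable_const_Icc])
      show "AE x in lborel. x \<in> {s..t} \<longrightarrow> \<bar>p x * (G t - G x)\<bar> \<le> \<bar>B\<bar> * ?J"
        using B' by eventually_elim (use Gb st in \<open>auto simp: abs_mult intro!: mult_mono\<close>)
    qed simp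
    have a2: "\<bar>LINT \<tau>:{s..t}|lborel. g \<tau> * (P s - P \<tau>)\<bar> \<le> (LINT \<tau>:{s..t}|lborel. \<bar>g \<tau>\<bar> * (\<bar>B\<bar> * (t - s)))"
      using Pb by (intro set_integral_abs_le[OF i4] set_integrable_mult_left sub[OF gabs])
        (auto simp: abs_mult intro!: AE_I2 mult_left_mono)
    have "\<bar>P t * G t - P s * G s - (LINT \<tau>:{s..t}|lborel. p \<tau> * G \<tau> + g \<tau> * P \<tau>)\<bar>
        \<le> (2 * \<bar>B\<bar> * ?J) * (t - s)"
    proof -
      have "(LINT \<tau>:{s..t}|lborel. \<bar>B\<bar> * ?J) = \<bar>B\<bar> * ?J * (t - s)"
        using st by (simp add: set_integral_const_Icc)
      moreover have "(LINT \<tau>:{s..t}|lborel. \<bar>g \<tau>\<bar> * (\<bar>B\<bar> * (t - s))) = \<bar>B\<bar> * ?J * (t - s)"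
        by simp
      ultimately show ?thesis unfolding eq using a1 a2 by linarith
    qed
    also have "\<dots> \<le> e * (t - s)"
    proof (rule mult_right_mono)
      have "2 * \<bar>B\<bar> * ?J \<le> (2 * \<bar>B\<bar> + 1) * e'" using Je J0 by (intro mult_mono) auto
      also have "\<dots> = e" by (simp add: e'_def add_nonneg_eq_0_iff)
      finally show "2 * \<bar>B\<bar> * ?J \<le> e" .
    qed (use st in simp)
    finally show "\<bar>P t * G t - P s * G s - (LINT \<tau>:{s..t}|lborel. p \<tau> * G \<tau> + g \<tau> * P \<tau>)\<bar> \<le> e * (t - s)" .
  qed
qed

text \<open>On a short interval the increment of f o P is f' at an intermediate value times the
  increment of P, and uniform continuity of f' o P makes freezing f' cost at most e per unit length.
  Differentiability is required on the range of P only, which suits ln on positive numbers.\<close>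

lemma primitive_on_compose:
  fixes f f' :: "real \<Rightarrow> real"
  assumes P: "primitive_on L P p" and B: "AE s in lborel. s \<in> {0..L} \<longrightarrow> \<bar>p s\<bar> \<le> B"
    and f: "\<And>x. x \<in> P ` {0..L} \<Longrightarrow> (f has_real_derivative f' x) (at x)"
    and f': "continuous_on (P ` {0..L}) f'"
  shows "primitive_on L (\<lambda>s. f (P s)) (\<lambda>s. p s * f' (P s))"
proof (rule primitive_on_if_small_error)
  have Pc: "continuous_on {0..L} P" using P by (rule primitive_on_continuous)
  have pint: "set_integrable lborel {0..L} p" using P by (simp add: primitive_on_def)
  have f'P: "continuous_on {0..L} (\<lambda>s. f' (P s))"
    using continuous_on_compose[OF Pc f'] by (simp add: comp_def)
  show "set_integrable lborel {0..L} (\<lambda>s. p s * f' (P s))"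
    by (rule set_integrable_mult_continuous[OF pint f'P])
  have B': "AE s in lborel. s \<in> {0..L} \<longrightarrow> \<bar>p s\<bar> \<le> \<bar>B\<bar>" using B by eventually_elim auto
  fix e :: real assume "e > 0"
  define e' where "e' = e / (\<bar>B\<bar> + 1)"
  have e': "e' > 0" using \<open>e > 0\<close> by (simp add: e'_def)
  have "uniformly_continuous_on {0..L} (\<lambda>s. f' (P s))"
    by (intro compact_uniformly_continuous f'P) auto
  then obtain d where d: "d > 0" "\<And>s t. s \<in> {0..L} \<Longrightarrow> t \<in> {0..L} \<Longrightarrow> \<bar>t - s\<bar> < d \<Longrightarrow> \<bar>f' (P t) - f' (P s)\<bar> < e'"
    using e' unfolding uniformly_continuous_on_def dist_real_def by metis
  show "\<exists>d>0. \<forall>s t. 0 \<le> s \<and> s \<le> t \<and> t \<le> L \<and> t - s < d \<longrightarrow>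
      \<bar>f (P t) - f (P s) - (LINT \<tau>:{s..t}|lborel. p \<tau> * f' (P \<tau>))\<bar> \<le> e * (t - s)"
  proof (intro exI conjI allI impI, rule d(1), elim conjE)
    fix s t assume st: "0 \<le> s" "s \<le> t" "t \<le> L" "t - s < d"
    have pint': "set_integrable lborel {s..t} p" by (rule set_integrable_subset[OF pint]) (use st in auto)
    have conn: "connected (P ` {s..t})"
      using st by (intro connected_continuous_image continuous_on_subset[OF Pc]) auto
    have "\<exists>\<sigma>\<in>{s..t}. f (P t) - f (P s) = f' (P \<sigma>) * (P t - P s)"
    proof (cases "P s = P t")
      case True then show ?thesis using st by (auto intro: bexI[of _ s])
    next
      case False
      define u w where "u = min (P s) (P t)" and "w = max (P s) (P t)"
      have "u < w" using False by (auto simp: u_def w_def)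
      \<comment> \<open>Intermediate value theorem for P: all values between P s and P t are
        attained on [s,t], so the point given by the mean value theorem lies in the range.\<close>
      have sub: "{u..w} \<subseteq> P ` {s..t}"
        using st by (intro connected_contains_Icc[OF conn]) (auto simp: u_def w_def min_def max_def)
      have "\<exists>z>u. z < w \<and> f w - f u = (w - u) * f' z"
      proof (rule MVT2[OF \<open>u < w\<close>])
        fix x assume "u \<le> x" "x \<le> w"
        then have "x \<in> P ` {s..t}" using sub by auto
        then have "x \<in> P ` {0..L}" using st by auto
        then show "(f has_real_derivative f' x) (at x)" by (rule f)
      qed
      then obtain z where z: "u < z" "z < w" "f w - f u = (w - u) * f' z" by auto
      then have "z \<in> P ` {s..t}" using sub by auto
      then obtain \<sigma> where s: "\<sigma> \<in> {s..t}" "z = P \<sigma>" by blast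
      have "f (P t) - f (P s) = f' (P \<sigma>) * (P t - P s)"
        using z(3) unfolding s(2) u_def w_def by (cases "P s \<le> P t") (simp_all add: min_def max_def algebra_simps)
      then show ?thesis using s(1) by blast
    qed
    then obtain \<sigma> where s: "\<sigma> \<in> {s..t}" "f (P t) - f (P s) = f' (P \<sigma>) * (P t - P s)" by blast
    have c: "continuous_on {s..t} (\<lambda>s. f' (P s))" using st by (auto intro: continuous_on_subset[OF f'P])
    have i1: "set_integrable lborel {s..t} (\<lambda>\<tau>. p \<tau> * f' (P \<tau>))"
      by (rule set_integrable_mult_continuous[OF pint' c])
    have i2: "set_integrable lborel {s..t} (\<lambda>\<tau>. p \<tau> * (f' (P \<sigma>) - f' (P \<tau>)))"
      by (rule set_integrable_mult_continuous[OF pint']) (intro continuous_intros c)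
    have "f (P t) - f (P s) = (LINT \<tau>:{s..t}|lborel. p \<tau> * f' (P \<sigma>))"
      using s(2) primitive_onD(1)[OF P, of s t] st by simp
    then have eq: "f (P t) - f (P s) - (LINT \<tau>:{s..t}|lborel. p \<tau> * f' (P \<tau>))
       = (LINT \<tau>:{s..t}|lborel. p \<tau> * (f' (P \<sigma>) - f' (P \<tau>)))"
      using i1 pint' by (simp add: right_diff_distrib set_integral_diff(2))
    have "\<bar>LINT \<tau>:{s..t}|lborel. p \<tau> * (f' (P \<sigma>) - f' (P \<tau>))\<bar> \<le> (LINT \<tau>:{s..t}|lborel. \<bar>B\<bar> * e')"
    proof (rule set_integral_abs_le[OF i2 set_integrable_const_Icc])
      show "AE x in lborel. x \<in> {s..t} \<longrightarrow> \<bar>p x * (f' (P \<sigma>) - f' (P x))\<bar> \<le> \<bar>B\<bar> * e'"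
        using B'
      proof eventually_elim
        case (elim x)
        have "\<bar>f' (P \<sigma>) - f' (P x)\<bar> \<le> e'" if "x \<in> {s..t}"
          using d(2)[of x \<sigma>] that s(1) st by force
        then show ?case using elim st by (auto simp: abs_mult intro!: mult_mono)
      qed
    qed simp
    also have "\<dots> = (\<bar>B\<bar> * e') * (t - s)" using st by (simp add: set_integral_const_Icc)
    also have "\<dots> \<le> e * (t - s)"
    proof (rule mult_right_mono)
      have "\<bar>B\<bar> * e' \<le> (\<bar>B\<bar> + 1) * e'" using e' by (intro mult_right_mono) auto
      also have "\<dots> = e" by (simp add: e'_def add_nonneg_eq_0_iff)
      finally show "\<bar>B\<bar> * e' \<le> e" .
    qed (use st in simp)
    finally show "\<bar>f (P t) - f (P s) - (LINT \<tau>:{s..t}|lborel. p \<tau> * f' (P \<tau>))\<bar> \<le> e * (t - s)"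
      unfolding eq .
  qed
qed

text \<open>Product rule with an integrating factor. It is applied with the logarithm of the weight
  to pass to the weighted unknown, and with its negative to return.\<close>

lemma primitive_on_exp_mult:
  assumes R: "primitive_on L R \<rho>" and U: "primitive_on L U u"
    and B: "AE s in lborel. s \<in> {0..L} \<longrightarrow> \<bar>\<rho> s\<bar> \<le> B"
  shows "primitive_on L (\<lambda>s. exp (R s) * U s) (\<lambda>s. exp (R s) * (\<rho> s * U s + u s))"
proof -
  have E: "primitive_on L (\<lambda>s. exp (R s)) (\<lambda>s. \<rho> s * exp (R s))"
    by (rule primitive_on_compose[OF R B]) (auto intro!: derivative_eq_intros continuous_intros)
  have c: "continuous_on {0..L} (\<lambda>s. exp (R s))" using E by (rule primitive_on_continuous)
  then have "compact ((\<lambda>s. exp (R s)) ` {0..L})" by (rule compact_continuous_image) auto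
  from compact_imp_bounded[OF this] obtain K where "\<forall>x\<in>(\<lambda>s. exp (R s)) ` {0..L}. norm x \<le> K"
    by (auto simp: bounded_iff)
  then have K: "exp (R s) \<le> K" if "s \<in> {0..L}" for s using that by auto
  have "AE s in lborel. s \<in> {0..L} \<longrightarrow> \<bar>\<rho> s * exp (R s)\<bar> \<le> B * K"
    using B by eventually_elim (use K in \<open>auto simp: abs_mult intro!: mult_mono intro: order_trans[OF abs_ge_zero]\<close>)
  from primitive_on_mult[OF E U this] show ?thesis
    by (simp add: algebra_simps)
qed

section \<open>Square-integrable functions on an interval\<close>

text \<open>Square integrability becomes finiteness of a nonnegative integral, so one estimate of
  such integrals gives both membership and a norm bound.\<close>

lemma L2_on_iff_nn_integral:
  "L2_on L f \<longleftrightarrow> set_borel_measurable lborel {0..L} f \<and>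
     (\<integral>\<^sup>+ s. ennreal (indicator {0..L} s * (f s)\<^sup>2) \<partial>lborel) < \<infinity>"
proof -
  have "(\<lambda>s. indicator {0..L} s *\<^sub>R (f s)\<^sup>2) \<in> borel_measurable lborel" if "set_borel_measurable lborel {0..L} f"
  proof -
    have [measurable]: "(\<lambda>s. indicator {0..L} s *\<^sub>R f s) \<in> borel_measurable lborel"
      using that by (simp add: set_borel_measurable_def)
    have "(\<lambda>s. (indicator {0..L} s *\<^sub>R f s)\<^sup>2) \<in> borel_measurable lborel" by measurable
    also have "(\<lambda>s. (indicator {0..L} s *\<^sub>R f s)\<^sup>2) = (\<lambda>s. indicator {0..L} s *\<^sub>R (f s)\<^sup>2)"
      by (auto simp: fun_eq_iff indicator_def)
    finally show ?thesis .
  qed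
  then show ?thesis
    by (auto simp: L2_on_def set_integrable_def integrable_iff_bounded abs_mult)
qed

lemma L2_on_nn_integral:
  assumes "L2_on L f"
  shows "(\<integral>\<^sup>+ s. ennreal (indicator {0..L} s * (f s)\<^sup>2) \<partial>lborel) = ennreal (LINT s:{0..L}|lborel. (f s)\<^sup>2)"
  using assms unfolding L2_on_def set_lebesgue_integral_def set_integrable_def
  by (subst nn_integral_eq_integral) auto

lemma L2norm_sq: "(L2norm L f)\<^sup>2 = (LINT s:{0..L}|lborel. (f s)\<^sup>2)"
  unfolding L2norm_def by (rule real_sqrt_pow2) (simp add: set_integral_nonneg_all)

lemma L2_integral_le:
  assumes f: "L2_on L f" and g: "L2_on M g" and K: "K \<ge> 0"
    and le: "(\<integral>\<^sup>+ s. ennreal (indicator {0..L} s * (f s)\<^sup>2) \<partial>lborel)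
      \<le> ennreal K * (\<integral>\<^sup>+ s. ennreal (indicator {0..M} s * (g s)\<^sup>2) \<partial>lborel)"
  shows "(LINT s:{0..L}|lborel. (f s)\<^sup>2) \<le> K * (LINT s:{0..M}|lborel. (g s)\<^sup>2)"
proof -
  have "ennreal (LINT s:{0..L}|lborel. (f s)\<^sup>2) \<le> ennreal (K * (LINT s:{0..M}|lborel. (g s)\<^sup>2))"
    using le unfolding L2_on_nn_integral[OF f] L2_on_nn_integral[OF g]
    using K by (simp add: ennreal_mult' set_integral_nonneg_all)
  then show ?thesis using K by (simp add: set_integral_nonneg_all)
qed

lemma set_borel_measurable_mult:
  fixes f g :: "real \<Rightarrow> real"
  assumes "set_borel_measurable lborel A f" "set_borel_measurable lborel A g"
  shows "set_borel_measurable lborel A (\<lambda>s. f s * g s)"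
proof -
  have [measurable]: "(\<lambda>s. indicator A s *\<^sub>R f s) \<in> borel_measurable lborel"
    "(\<lambda>s. indicator A s *\<^sub>R g s) \<in> borel_measurable lborel"
    using assms by (auto simp: set_borel_measurable_def)
  have "(\<lambda>s. (indicator A s *\<^sub>R f s) * (indicator A s *\<^sub>R g s)) \<in> borel_measurable lborel" by measurable
  also have "(\<lambda>s. (indicator A s *\<^sub>R f s) * (indicator A s *\<^sub>R g s)) = (\<lambda>s. indicator A s *\<^sub>R (f s * g s))"
    by (auto simp: fun_eq_iff indicator_def)
  finally show ?thesis by (simp add: set_borel_measurable_def)
qed

lemma set_borel_measurable_add:
  fixes f g :: "real \<Rightarrow> real"
  assumes "set_borel_measurable lborel A f" "set_borel_measurable lborel A g"
  shows "set_borel_measurable lborel A (\<lambda>s. f s + g s)"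
  using assms unfolding set_borel_measurable_def by (simp add: distrib_left)

lemma L2_on_mult:
  assumes f: "L2_on L f" and k: "set_borel_measurable lborel {0..L} k"
    and K: "AE s in lborel. s \<in> {0..L} \<longrightarrow> \<bar>k s\<bar> \<le> K"
  shows "L2_on L (\<lambda>s. k s * f s)"
proof -
  have m: "set_borel_measurable lborel {0..L} (\<lambda>s. k s * f s)"
    using f k by (auto simp: L2_on_def intro: set_borel_measurable_mult)
  have "(\<integral>\<^sup>+ s. ennreal (indicator {0..L} s * (k s * f s)\<^sup>2) \<partial>lborel)
     \<le> (\<integral>\<^sup>+ s. ennreal (K\<^sup>2 * (indicator {0..L} s * (f s)\<^sup>2)) \<partial>lborel)"
  proof (rule nn_integral_mono_AE)
    show "AE s in lborel. ennreal (indicator {0..L} s * (k s * f s)\<^sup>2) \<le> ennreal (K\<^sup>2 * (indicator {0..L} s * (f s)\<^sup>2))"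
      using K
    proof eventually_elim
      case (elim s)
      have "(k s)\<^sup>2 \<le> K\<^sup>2" if "s \<in> {0..L}"
        using elim that by (metis abs_le_square_iff abs_ge_self order_trans)
      then show ?case
        by (intro ennreal_leI) (auto simp: indicator_def power_mult_distrib intro!: mult_right_mono)
    qed
  qed
  also have "\<dots> = (\<integral>\<^sup>+ s. ennreal (K\<^sup>2) * ennreal (indicator {0..L} s * (f s)\<^sup>2) \<partial>lborel)"
    by (simp add: ennreal_mult')
  also have "\<dots> = ennreal (K\<^sup>2) * (\<integral>\<^sup>+ s. ennreal (indicator {0..L} s * (f s)\<^sup>2) \<partial>lborel)"
    using f by (intro nn_integral_cmult) (auto simp: L2_on_def set_integrable_def dest: borel_measurable_integrable)
  also have "\<dots> < \<infinity>" using f by (auto simp: L2_on_iff_nn_integral ennreal_mult_less_top)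
  finally show ?thesis using m by (simp add: L2_on_iff_nn_integral)
qed

lemma L2_on_cmult: "L2_on L f \<Longrightarrow> L2_on L (\<lambda>s. k * f s)"
  by (rule L2_on_mult[where K="\<bar>k\<bar>"]) (auto simp: set_borel_measurable_def)

lemma L2_on_add:
  assumes f: "L2_on L f" and g: "L2_on L g"
  shows "L2_on L (\<lambda>s. f s + g s)"
proof -
  define f' where "f' = (\<lambda>s. indicator {0..L} s *\<^sub>R f s)"
  define g' where "g' = (\<lambda>s. indicator {0..L} s *\<^sub>R g s)"
  have [measurable]: "f' \<in> borel_measurable borel" "g' \<in> borel_measurable borel"
    using f g by (auto simp: L2_on_def f'_def g'_def set_borel_measurable_def)
  have "set_integrable lborel {0..L} (\<lambda>s. (f' s + g' s)\<^sup>2)"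
  proof (rule set_integrable_sq_add)
    show "set_integrable lborel {0..L} (\<lambda>s. (f' s)\<^sup>2)"
      using f by (subst set_integrable_cong[where f'="\<lambda>s. (f s)\<^sup>2"]) (auto simp: f'_def L2_on_def)
    show "set_integrable lborel {0..L} (\<lambda>s. (g' s)\<^sup>2)"
      using g by (subst set_integrable_cong[where f'="\<lambda>s. (g s)\<^sup>2"]) (auto simp: g'_def L2_on_def)
  qed auto
  then have "set_integrable lborel {0..L} (\<lambda>s. (f s + g s)\<^sup>2)"
    by (subst set_integrable_cong[where f'="\<lambda>s. (f' s + g' s)\<^sup>2"]) (auto simp: f'_def g'_def)
  moreover have "set_borel_measurable lborel {0..L} (\<lambda>s. f s + g s)"
    using f g by (auto simp: L2_on_def intro: set_borel_measurable_add)
  ultimately show ?thesis by (simp add: L2_on_def)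
qed

lemma L2_on_lin: "L2_on L f \<Longrightarrow> L2_on L g \<Longrightarrow> L2_on L (\<lambda>s. a * f s + b * g s)"
  by (intro L2_on_add L2_on_cmult)

lemma L2_on_diff: "L2_on L f \<Longrightarrow> L2_on L g \<Longrightarrow> L2_on L (\<lambda>s. f s - g s)"
  using L2_on_lin[of L f g 1 "-1"] by simp

lemma set_borel_measurable_continuous_Icc:
  fixes f :: "real \<Rightarrow> real"
  shows "continuous_on {0..L} f \<Longrightarrow> set_borel_measurable lborel {0..L} f"
  using borel_integrable_atLeastAtMost'[of 0 L f]
  by (auto simp: set_integrable_def set_borel_measurable_def dest: borel_measurable_integrable)

lemma continuous_Icc_bounded:
  fixes f :: "real \<Rightarrow> real"
  assumes "continuous_on {0..L} f"
  obtains K where "\<And>s. s \<in> {0..L} \<Longrightarrow> \<bar>f s\<bar> \<le> K"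
proof -
  have "compact (f ` {0..L})" using assms by (rule compact_continuous_image) simp
  from compact_imp_bounded[OF this] obtain K where "\<forall>x\<in>f ` {0..L}. norm x \<le> K" by (auto simp: bounded_iff)
  then have "\<bar>f s\<bar> \<le> K" if "s \<in> {0..L}" for s using that by auto
  then show ?thesis by (rule that)
qed

lemma L2_on_mult_continuous:
  assumes "L2_on L f" "continuous_on {0..L} k"
  shows "L2_on L (\<lambda>s. k s * f s)"
proof -
  obtain K where "\<And>s. s \<in> {0..L} \<Longrightarrow> \<bar>k s\<bar> \<le> K" using continuous_Icc_bounded[OF assms(2)] by blast
  then show ?thesis using assms by (intro L2_on_mult[where K=K] set_borel_measurable_continuous_Icc) auto
qed

lemma L2_on_continuous:
  assumes "continuous_on {0..L} k"
  shows "L2_on L k"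
proof -
  have "L2_on L (\<lambda>_. 1)"
    using set_integrable_const_Icc[of 0 L 1] by (simp add: L2_on_def set_borel_measurable_def)
  then show ?thesis using L2_on_mult_continuous[of L "\<lambda>_. 1" k] assms by simp
qed

lemma L2_on_integrable: "L2_on L f \<Longrightarrow> set_integrable lborel {0..L} f"
  by (auto simp: L2_on_def intro: set_integrable_if_sq_Icc)

lemma ae_eq_on_if_L2norm_zero:
  assumes "L2_on L (\<lambda>s. f s - g s)" "L2norm L (\<lambda>s. f s - g s) = 0"
  shows "ae_eq_on L f g"
proof -
  have "(LINT s:{0..L}|lborel. (f s - g s)\<^sup>2) = 0" using L2norm_sq[of L "\<lambda>s. f s - g s"] assms by simp
  from AE_zero_if_set_integral_sq_zero[OF _ _ this] assms show ?thesis
    by (auto simp: ae_eq_on_def L2_on_def)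
qed

lemma L2norm_zero_if_ae_eq_on:
  assumes "L2_on L (\<lambda>s. f s - g s)" "ae_eq_on L f g"
  shows "L2norm L (\<lambda>s. f s - g s) = 0"
proof -
  have "(LINT s:{0..L}|lborel. (f s - g s)\<^sup>2) = (LINT s|(lborel::real measure). (0::real))"
    unfolding set_lebesgue_integral_def
  proof (rule integral_cong_AE)
    show "AE s in lborel. indicator {0..L} s *\<^sub>R (f s - g s)\<^sup>2 = 0"
      using assms(2) unfolding ae_eq_on_def by eventually_elim (auto simp: indicator_def)
  qed (use assms(1) in \<open>auto simp: L2_on_def set_integrable_def dest: borel_measurable_integrable\<close>)
  then show ?thesis by (simp add: L2norm_def)
qed

text \<open>The shift moves the window to [-t, S - t]; whole periods bring its left end to r in
  [0,S], and the piece beyond S returns to [0,r] by one more period.\<close>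

lemma nn_integral_periodic_shift:
  fixes F :: "real \<Rightarrow> ennreal"
  assumes [measurable]: "F \<in> borel_measurable borel" and S: "S > 0" and per: "\<And>s. F (s + S) = F s"
  shows "(\<integral>\<^sup>+ s. F (s - t) * indicator {0..S} s \<partial>lborel) = (\<integral>\<^sup>+ s. F s * indicator {0..S} s \<partial>lborel)"
proof -
  define G where "G = (\<lambda>a b. \<integral>\<^sup>+ s. F s * indicator {a..b} s \<partial>lborel)"
  have shift: "G (a + h) (b + h) = (\<integral>\<^sup>+ s. F (s + h) * indicator {a..b} s \<partial>lborel)" for a b h
  proof -
    have "G (a + h) (b + h) = (\<integral>\<^sup>+ s. F (h + 1 * s) * indicator {a + h..b + h} (h + 1 * s) \<partial>lborel)"
      unfolding G_def by (subst nn_integral_real_affine[where c=1 and t=h]) auto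
    also have "\<dots> = (\<integral>\<^sup>+ s. F (s + h) * indicator {a..b} s \<partial>lborel)"
      by (intro nn_integral_cong) (auto simp: indicator_def add.commute)
    finally show ?thesis .
  qed
  have perS: "G (a + S) (b + S) = G a b" for a b unfolding shift per by (simp add: G_def)
  have perS': "G (a - S) (b - S) = G a b" for a b using perS[of "a - S" "b - S"] by simp
  have pern: "G (a + real n * S) (b + real n * S) = G a b" for a b n
  proof (induction n)
    case (Suc n) then show ?case using perS[of "a + real n * S" "b + real n * S"] by (simp add: algebra_simps)
  qed simp
  have peri: "G (a + real_of_int k * S) (b + real_of_int k * S) = G a b" for a b k
  proof (cases "k \<ge> 0")
    case True then show ?thesis using pern[of a "nat k" b] by simp
  next
    case False then show ?thesis
      using pern[of "a + real_of_int k * S" "nat (-k)" "b + real_of_int k * S"] by (simp add: algebra_simps)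
  qed
  have split: "G a d = G a b + G b d" if "a \<le> b" "b \<le> d" for a b d
  proof -
    have "G a d = (\<integral>\<^sup>+ s. F s * indicator {a..b} s + F s * indicator {b..d} s \<partial>lborel)"
      unfolding G_def using AE_lborel_singleton[of b] that
      by (intro nn_integral_cong_AE) (auto elim!: eventually_mono simp: indicator_def)
    then show ?thesis unfolding G_def by (subst (asm) nn_integral_add) auto
  qed
  define k where "k = \<lfloor>-t / S\<rfloor>"
  define r where "r = -t - real_of_int k * S"
  have r: "0 \<le> r" "r \<le> S"
  proof -
    have "real_of_int k \<le> -t / S" "-t / S < real_of_int k + 1" unfolding k_def by linarith+
    then show "0 \<le> r" "r \<le> S" using S by (auto simp: r_def field_simps)
  qed
  have "(\<integral>\<^sup>+ s. F (s - t) * indicator {0..S} s \<partial>lborel) = G (0 + (-t)) (S + (-t))"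
    using shift[of 0 "-t" S] by simp
  also have "\<dots> = G r (S + r)" using peri[of r k "S + r"] by (simp add: r_def algebra_simps)
  also have "\<dots> = G r S + G S (S + r)" by (rule split) (use r in auto)
  also have "G S (S + r) = G 0 r" using perS[of 0 r] by (simp add: add.commute)
  also have "G r S + G 0 r = G 0 S" using split[of 0 r S] r by (simp add: add.commute)
  finally show ?thesis by (simp add: G_def)
qed

section \<open>The semigroup in characteristic coordinates\<close>

text \<open>\<open>q\<close> abstracts the damping coefficient, later the indicator of the control
  region. Only measurability and |q| <= 1 are assumed of it here; geometry enters later through
  lower bounds on increments of its integral.\<close>

locale transport =
  fixes c dc q :: "real \<Rightarrow> real" and L cmin cmax B :: real
  assumes L: "L > 0" and cmin: "cmin > 0"
    and c_ge: "\<And>\<omega>. \<omega> \<in> {0..L} \<Longrightarrow> cmin \<le> c \<omega>"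
    and c_le: "\<And>\<omega>. \<omega> \<in> {0..L} \<Longrightarrow> c \<omega> \<le> cmax"
    and dc_meas[measurable]: "dc \<in> borel_measurable borel"
    and dc_bound: "AE \<omega> in lborel. \<omega> \<in> {0..L} \<longrightarrow> \<bar>dc \<omega>\<bar> \<le> B"
    and c_prim: "primitive_on L c dc"
    and q_meas[measurable]: "q \<in> borel_measurable borel"
    and q_bound: "\<And>\<omega>. \<bar>q \<omega>\<bar> \<le> 1"
begin

section \<open>The characteristic coordinate, its inverse and the integrated damping\<close>

lemma c_pos: "\<omega> \<in> {0..L} \<Longrightarrow> c \<omega> > 0" using c_ge cmin by force

lemma c_cont: "continuous_on {0..L} c" using c_prim by (rule primitive_on_continuous)

lemma inv_c_cont: "continuous_on {0..L} (\<lambda>\<omega>. 1 / c \<omega>)"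
  using c_pos by (intro continuous_intros c_cont) force

text \<open>Extends data given on [0,L] continuously to the line: continuity then yields Borel
  measurability, and integrals can run past the endpoints.\<close>

definition clamp :: "real \<Rightarrow> real" where "clamp \<omega> = max 0 (min L \<omega>)"

lemma clamp_in: "clamp \<omega> \<in> {0..L}" using L by (auto simp: clamp_def)
lemma clamp_id: "\<omega> \<in> {0..L} \<Longrightarrow> clamp \<omega> = \<omega>" by (auto simp: clamp_def)
lemma clamp_cont: "continuous_on A clamp" unfolding clamp_def by (intro continuous_intros)

lemma cont_clamp: "continuous_on {0..L} f \<Longrightarrow> continuous_on A (\<lambda>\<omega>. f (clamp \<omega>))"
  using clamp_in by (intro continuous_on_compose2[OF _ clamp_cont]) auto

lemma meas_clamp: "continuous_on {0..L} f \<Longrightarrow> (\<lambda>\<omega>. f (clamp \<omega>) :: real) \<in> borel_measurable borel"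
  by (intro borel_measurable_continuous_onI cont_clamp)

text \<open>The travel time from 0 to \<omega>. The base point -1 keeps 0 inside the interval of
  integration, so that the derivative at 0 is two-sided.\<close>

definition \<phi> :: "real \<Rightarrow> real" where
  "\<phi> \<omega> = integral {-1..\<omega>} (\<lambda>\<tau>. 1 / c (clamp \<tau>)) - integral {-1..0} (\<lambda>\<tau>. 1 / c (clamp \<tau>))"

lemma \<phi>_0: "\<phi> 0 = 0" by (simp add: \<phi>_def)

lemma \<phi>_deriv: "\<omega> \<in> {0..L} \<Longrightarrow> (\<phi> has_real_derivative 1 / c \<omega>) (at \<omega>)"
proof -
  assume w: "\<omega> \<in> {0..L}"
  have "((\<lambda>x. integral {-1..x} (\<lambda>\<tau>. 1 / c (clamp \<tau>))) has_real_derivative 1 / c (clamp \<omega>)) (at \<omega> within {-1..L+1})"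
    using w by (intro integral_has_real_derivative cont_clamp[OF inv_c_cont]) auto
  then have "((\<lambda>x. integral {-1..x} (\<lambda>\<tau>. 1 / c (clamp \<tau>))) has_real_derivative 1 / c \<omega>) (at \<omega>)"
    using w by (simp add: clamp_id at_within_Icc_at)
  then show ?thesis unfolding \<phi>_def[abs_def] by (auto intro!: derivative_eq_intros)
qed

lemma \<phi>_cont: "continuous_on {0..L} \<phi>"
  using \<phi>_deriv by (rule has_real_derivative_imp_continuous_on)

lemma \<phi>_strict:
  assumes "0 \<le> x" "x < y" "y \<le> L"
  shows "\<phi> x < \<phi> y"
proof (rule DERIV_pos_imp_increasing[OF assms(2)])
  fix z assume "x \<le> z" "z \<le> y"
  then have "z \<in> {0..L}" using assms by auto
  then show "\<exists>y. (\<phi> has_real_derivative y) (at z) \<and> 0 < y" using \<phi>_deriv[of z] c_pos[of z] by auto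
qed

lemma \<phi>_mono: "0 \<le> x \<Longrightarrow> x \<le> y \<Longrightarrow> y \<le> L \<Longrightarrow> \<phi> x \<le> \<phi> y"
  using \<phi>_strict[of x y] by (cases "x = y") auto

lemma \<phi>_inj: "inj_on \<phi> {0..L}"
  by (rule linorder_inj_onI) (use \<phi>_strict in force)+

lemma \<phi>_diff_le: "0 \<le> x \<Longrightarrow> x \<le> y \<Longrightarrow> y \<le> L \<Longrightarrow> \<phi> y - \<phi> x \<le> (y - x) / cmin"
proof (cases "x = y")
  case False
  assume a: "0 \<le> x" "x \<le> y" "y \<le> L"
  have "\<exists>z>x. z < y \<and> \<phi> y - \<phi> x = (y - x) * (1 / c z)"
    using a False by (intro MVT2 \<phi>_deriv) auto
  then obtain z where z: "x < z" "z < y" "\<phi> y - \<phi> x = (y - x) * (1 / c z)" by auto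
  have "1 / c z \<le> 1 / cmin" using c_ge[of z] cmin z a by (intro divide_left_mono) auto
  then have "(y - x) * (1 / c z) \<le> (y - x) * (1 / cmin)" using a by (intro mult_left_mono) auto
  then show ?thesis using z by simp
qed simp

definition S :: real where "S = \<phi> L"

lemma S: "S > 0" using \<phi>_strict[of 0 L] L by (simp add: S_def \<phi>_0)

lemma \<phi>_image: "\<phi> ` {0..L} = {0..S}"
proof
  show "\<phi> ` {0..L} \<subseteq> {0..S}" using \<phi>_mono[of 0] \<phi>_mono[of _ L] by (auto simp: \<phi>_0 S_def)
  have "connected (\<phi> ` {0..L})" by (intro connected_continuous_image \<phi>_cont) auto
  then show "{0..S} \<subseteq> \<phi> ` {0..L}"
    by (rule connected_contains_Icc) (use L \<phi>_0 in \<open>auto simp: S_def intro: image_eqI[of _ _ 0]\<close>)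
qed

text \<open>The clamped argument makes the inverse total, continuous and [0,L]-valued on the whole
  line.\<close>

definition \<psi> :: "real \<Rightarrow> real" where
  "\<psi> s = inv_into {0..L} \<phi> (max 0 (min S s))"

lemma \<psi>_in: "\<psi> s \<in> {0..L}"
  unfolding \<psi>_def by (rule inv_into_into) (use S \<phi>_image in auto)

lemma \<phi>_\<psi>: "s \<in> {0..S} \<Longrightarrow> \<phi> (\<psi> s) = s"
  unfolding \<psi>_def by (subst f_inv_into_f) (use S \<phi>_image in auto)

lemma \<phi>_in: "\<omega> \<in> {0..L} \<Longrightarrow> \<phi> \<omega> \<in> {0..S}" using \<phi>_image by auto

lemma \<psi>_\<phi>: "\<omega> \<in> {0..L} \<Longrightarrow> \<psi> (\<phi> \<omega>) = \<omega>"
  using \<phi>_in[of \<omega>] by (simp add: \<psi>_def inv_into_f_f[OF \<phi>_inj])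

lemma \<psi>_cont: "continuous_on A \<psi>"
proof -
  have "continuous_on (\<phi> ` {0..L}) (inv_into {0..L} \<phi>)"
    by (rule continuous_on_inv[OF \<phi>_cont]) (auto simp: inv_into_f_f[OF \<phi>_inj])
  then show ?thesis unfolding \<psi>_def
    by (rule continuous_on_compose2) (use S in \<open>auto simp: \<phi>_image intro!: continuous_intros\<close>)
qed

lemma \<psi>_meas[measurable]: "\<psi> \<in> borel_measurable borel"
  by (intro borel_measurable_continuous_onI \<psi>_cont)

definition Q :: "real \<Rightarrow> real" where "Q \<omega> = (LINT \<tau>:{0..\<omega>}|lborel. q \<tau> / c \<tau>)"

lemma q_int: "set_integrable lborel {0..L} q"
  by (rule set_integrable_bound[OF set_integrable_const_Icc[of 0 L 1]])
    (use q_bound in \<open>auto simp: set_borel_measurable_def\<close>)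

lemma qc_int: "set_integrable lborel {0..L} (\<lambda>\<tau>. q \<tau> / c \<tau>)"
  using set_integrable_mult_continuous[OF q_int inv_c_cont] by simp

lemma Q_0: "Q 0 = 0" by (simp add: Q_def set_integral_at_point)

lemma Q_prim: "primitive_on L Q (\<lambda>\<tau>. q \<tau> / c \<tau>)"
  unfolding primitive_on_def Q_0 using qc_int by (simp add: Q_def)

lemma Q_cont: "continuous_on {0..L} Q" using Q_prim by (rule primitive_on_continuous)

definition \<theta> :: real where "\<theta> = Q L"
definition \<Phi> :: "real \<Rightarrow> real" where "\<Phi> \<omega> = \<phi> (clamp \<omega>)"
definition p :: "real \<Rightarrow> real" where "p \<omega> = c (clamp \<omega>) * exp (Q (clamp \<omega>))"

lemma \<Phi>_meas[measurable]: "\<Phi> \<in> borel_measurable borel"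
  unfolding \<Phi>_def by (rule meas_clamp[OF \<phi>_cont])
lemma p_meas[measurable]: "p \<in> borel_measurable borel"
  unfolding p_def by (rule meas_clamp) (intro continuous_intros c_cont Q_cont)
lemma p_pos: "p \<omega> > 0" unfolding p_def using c_pos[OF clamp_in] by simp
lemma \<Phi>_eq: "\<omega> \<in> {0..L} \<Longrightarrow> \<Phi> \<omega> = \<phi> \<omega>" by (simp add: \<Phi>_def clamp_id)
lemma p_eq: "\<omega> \<in> {0..L} \<Longrightarrow> p \<omega> = c \<omega> * exp (Q \<omega>)" by (simp add: p_def clamp_id)

section \<open>Laps and the quasi-periodic extension\<close>

definition lap :: "real \<Rightarrow> int" where "lap s = \<lfloor>s / S\<rfloor>"
definition res :: "real \<Rightarrow> real" where "res s = s - S * real_of_int (lap s)"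

lemma lap_meas[measurable]: "(\<lambda>s. real_of_int (lap s)) \<in> borel_measurable borel"
  unfolding lap_def by measurable
lemma res_meas[measurable]: "res \<in> borel_measurable borel"
  unfolding res_def by measurable

lemma lap_add: "lap (s + S * real_of_int k) = lap s + k"
  using S by (simp add: lap_def add_divide_distrib)
lemma res_add: "res (s + S * real_of_int k) = res s"
  by (simp add: res_def lap_add distrib_left)
lemma res_in: "0 \<le> res s" "res s < S"
proof -
  have "real_of_int (lap s) \<le> s / S" "s / S < real_of_int (lap s) + 1" unfolding lap_def by linarith+
  then show "0 \<le> res s" "res s < S" using S by (auto simp: res_def field_simps)
qed
lemma s_eq: "s = res s + S * real_of_int (lap s)" by (simp add: res_def)
text \<open>Laps are half-open: at s = S the count jumps to 1 and the residue to 0. Hence the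
  formulas for V and T 0 stop short of the right endpoint, which \<open>AE_not_L\<close> later
  discards.\<close>

lemma lap_res_id: "0 \<le> s \<Longrightarrow> s < S \<Longrightarrow> lap s = 0 \<and> res s = s"
  using S by (auto simp: lap_def res_def floor_eq_iff)

text \<open>The characteristic coordinate s = \<phi> \<omega>, together with the integrating factor p, turns the equation into
  \<open>\<partial>\<^sub>t v = - \<partial>\<^sub>s v\<close>; the boundary condition becomes \<open>v (s + S) = exp \<theta> * v s\<close>, which is used to extend v to the line.\<close>

definition V :: "(real \<Rightarrow> real) \<Rightarrow> real \<Rightarrow> real" where
  "V x s = exp (\<theta> * real_of_int (lap s)) * (p (\<psi> (res s)) * x (\<psi> (res s)))"

definition T :: "real \<Rightarrow> (real \<Rightarrow> real) \<Rightarrow> real \<Rightarrow> real" where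
  "T t x \<omega> = V x (\<Phi> \<omega> - t) / p \<omega>"

lemma V_add_S: "V x (s + S) = exp \<theta> * V x s"
  using lap_add[of s 1] res_add[of s 1] by (simp add: V_def exp_add distrib_left)

lemma V_eq: "0 \<le> s \<Longrightarrow> s < S \<Longrightarrow> V x s = p (\<psi> s) * x (\<psi> s)"
  using lap_res_id[of s] by (simp add: V_def)

lemma V_\<phi>: "0 \<le> \<omega> \<Longrightarrow> \<omega> < L \<Longrightarrow> V x (\<phi> \<omega>) = p \<omega> * x \<omega>"
  using V_eq[of "\<phi> \<omega>" x] \<phi>_strict[of \<omega> L] \<phi>_in[of \<omega>] \<psi>_\<phi>[of \<omega>] by (simp add: S_def)

lemma V_lin: "V (\<lambda>s. a * x s + b * y s) s = a * V x s + b * V y s"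
  by (simp add: V_def algebra_simps)

text \<open>V conjugates T t to translation at every point, not just almost everywhere, so the
  semigroup law becomes an identity of functions. The residue lies in [0,S), where
  \<open>\<Phi>\<close> inverts \<open>\<psi>\<close>, and the lap factor is multiplicative.\<close>

lemma V_T: "V (T t x) s = V x (s - t)"
proof -
  have "\<Phi> (\<psi> (res s)) = res s" using \<Phi>_eq[OF \<psi>_in] \<phi>_\<psi>[of "res s"] res_in[of s] by simp
  then have 1: "V (T t x) s = exp (\<theta> * real_of_int (lap s)) * V x (res s - t)"
    using p_pos[of "\<psi> (res s)"] by (simp add: V_def[of "T t x"] T_def)
  have eq: "s - t = (res s - t) + S * real_of_int (lap s)" using s_eq[of s] by simp
  have "V x (s - t) = exp (\<theta> * real_of_int (lap s)) * V x (res s - t)"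
    unfolding eq by (simp add: V_def lap_add res_add exp_add distrib_left)
  with 1 show ?thesis by simp
qed

lemma T_add: "T (t + u) x = T t (T u x)"
  by (simp add: T_def V_T fun_eq_iff algebra_simps)

lemma T_lin: "T t (\<lambda>s. a * x s + b * y s) = (\<lambda>s. a * T t x s + b * T t y s)"
  by (auto simp: T_def V_lin fun_eq_iff add_divide_distrib)

lemma T_0: "0 \<le> \<omega> \<Longrightarrow> \<omega> < L \<Longrightarrow> T 0 x \<omega> = x \<omega>"
  using V_\<phi>[of \<omega> x] p_pos[of \<omega>] by (simp add: T_def \<Phi>_eq)

lemma V_meas:
  assumes "set_borel_measurable lborel {0..L} x"
  shows "V x \<in> borel_measurable borel"
proof -
  have [measurable]: "(\<lambda>s. indicator {0..L} s *\<^sub>R x s) \<in> borel_measurable borel"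
    using assms by (simp add: set_borel_measurable_def)
  \<comment> \<open>x is measurable only on [0,L]; the inserted indicator is 1 because \<psi> takes
    its values there.\<close>
  have [measurable]: "(\<lambda>s. indicator {0..L} (\<psi> (res s)) *\<^sub>R x (\<psi> (res s))) \<in> borel_measurable borel"
    by (rule measurable_compose[where f="\<lambda>s. \<psi> (res s)" and g="\<lambda>s. indicator {0..L} s *\<^sub>R x s"]) measurable
  have "(\<lambda>s. exp (\<theta> * real_of_int (lap s)) * (p (\<psi> (res s)) * (indicator {0..L} (\<psi> (res s)) *\<^sub>R x (\<psi> (res s))))) \<in> borel_measurable borel"
    by measurable
  then show ?thesis using \<psi>_in by (simp add: V_def[abs_def])
qed

lemma T_meas:
  assumes "set_borel_measurable lborel {0..L} x"
  shows "T t x \<in> borel_measurable borel"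
proof -
  note [measurable] = V_meas[OF assms]
  show ?thesis unfolding T_def[abs_def] by measurable
qed

section \<open>Change of variables and comparison of norms\<close>

lemma nn_substitution:
  assumes [measurable]: "F \<in> borel_measurable borel"
  shows "(\<integral>\<^sup>+ s. ennreal (F s * indicator {0..S} s) \<partial>lborel)
     = (\<integral>\<^sup>+ \<omega>. ennreal (F (\<phi> \<omega>) * (1 / c \<omega>) * indicator {0..L} \<omega>) \<partial>lborel)"
proof -
  have "set_borel_measurable borel {\<phi> 0..\<phi> L} F" unfolding set_borel_measurable_def by measurable
  from nn_integral_substitution[OF this \<phi>_deriv inv_c_cont] show ?thesis
    using L c_pos by (force simp: \<phi>_0 S_def less_imp_le)
qed

lemma AE_not_L: "AE \<omega> in lborel. \<omega> \<in> {0..L} \<longrightarrow> 0 \<le> \<omega> \<and> \<omega> < L"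
  using AE_lborel_singleton[of L] by eventually_elim auto

lemma V_nn_integral:
  assumes "set_borel_measurable lborel {0..L} x"
  shows "(\<integral>\<^sup>+ s. ennreal (indicator {0..S} s * (V x s)\<^sup>2) \<partial>lborel)
    = (\<integral>\<^sup>+ \<omega>. ennreal ((p \<omega>)\<^sup>2 / c \<omega> * (indicator {0..L} \<omega> * (x \<omega>)\<^sup>2)) \<partial>lborel)"
proof -
  note [measurable] = V_meas[OF assms]
  have "(\<integral>\<^sup>+ s. ennreal (indicator {0..S} s * (V x s)\<^sup>2) \<partial>lborel)
     = (\<integral>\<^sup>+ \<omega>. ennreal ((V x (\<phi> \<omega>))\<^sup>2 * (1 / c \<omega>) * indicator {0..L} \<omega>) \<partial>lborel)"
    using nn_substitution[of "\<lambda>s. (V x s)\<^sup>2"] by (simp add: mult.commute)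
  also have "\<dots> = (\<integral>\<^sup>+ \<omega>. ennreal ((p \<omega>)\<^sup>2 / c \<omega> * (indicator {0..L} \<omega> * (x \<omega>)\<^sup>2)) \<partial>lborel)"
    using AE_not_L by (intro nn_integral_cong_AE, eventually_elim) (auto simp: V_\<phi> indicator_def power_mult_distrib)
  finally show ?thesis .
qed

text \<open>Plain compactness. That K depends on L is tolerable, as only limits and integrability
  for fixed L rest on it.\<close>

lemma weight_bounds:
  obtains K where "K > 0" "\<And>\<omega>. \<omega> \<in> {0..L} \<Longrightarrow> (p \<omega>)\<^sup>2 / c \<omega> \<le> K" "\<And>\<omega>. \<omega> \<in> {0..L} \<Longrightarrow> 1 \<le> K * ((p \<omega>)\<^sup>2 / c \<omega>)"
proof -
  have cont: "continuous_on {0..L} (\<lambda>\<omega>. (c \<omega> * exp (Q \<omega>))\<^sup>2 / c \<omega>)" "continuous_on {0..L} (\<lambda>\<omega>. c \<omega> / (c \<omega> * exp (Q \<omega>))\<^sup>2)"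
    using c_pos by (auto intro!: continuous_intros c_cont Q_cont dest: less_imp_neq[symmetric]) (metis less_irrefl atLeastAtMost_iff)+
  obtain K1 where K1: "\<And>\<omega>. \<omega> \<in> {0..L} \<Longrightarrow> \<bar>(c \<omega> * exp (Q \<omega>))\<^sup>2 / c \<omega>\<bar> \<le> K1" using continuous_Icc_bounded[OF cont(1)] by blast
  obtain K2 where K2: "\<And>\<omega>. \<omega> \<in> {0..L} \<Longrightarrow> \<bar>c \<omega> / (c \<omega> * exp (Q \<omega>))\<^sup>2\<bar> \<le> K2" using continuous_Icc_bounded[OF cont(2)] by blast
  define K where "K = max 1 (max K1 K2)"
  show thesis
  proof (rule that)
    show "K > 0" by (simp add: K_def)
    fix \<omega> assume w: "\<omega> \<in> {0..L}"
    have cp: "c \<omega> > 0" using c_pos w by simp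
    have 1: "(p \<omega>)\<^sup>2 / c \<omega> \<le> K1" using K1[OF w] w by (simp only: p_eq abs_le_iff)
    then show "(p \<omega>)\<^sup>2 / c \<omega> \<le> K" by (simp add: K_def)
    have "c \<omega> / (p \<omega>)\<^sup>2 \<le> K2" using K2[OF w] w by (simp only: p_eq abs_le_iff)
    then have "c \<omega> / (p \<omega>)\<^sup>2 \<le> K" by (simp add: K_def)
    then show "1 \<le> K * ((p \<omega>)\<^sup>2 / c \<omega>)" using cp p_pos[of \<omega>] by (simp add: field_simps)
  qed
qed

lemma norm_equivalence:
  obtains K where "K > 0"
    and "\<And>x. L2_on L x \<Longrightarrow> L2_on S (V x)"
    and "\<And>x. L2_on L x \<Longrightarrow> (LINT s:{0..S}|lborel. (V x s)\<^sup>2) \<le> K * (L2norm L x)\<^sup>2"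
    and "\<And>x. L2_on L x \<Longrightarrow> (L2norm L x)\<^sup>2 \<le> K * (LINT s:{0..S}|lborel. (V x s)\<^sup>2)"
proof -
  obtain K where K: "K > 0" "\<And>\<omega>. \<omega> \<in> {0..L} \<Longrightarrow> (p \<omega>)\<^sup>2 / c \<omega> \<le> K"
    "\<And>\<omega>. \<omega> \<in> {0..L} \<Longrightarrow> 1 \<le> K * ((p \<omega>)\<^sup>2 / c \<omega>)" using weight_bounds by blast
  let ?N = "\<lambda>x. \<integral>\<^sup>+ s. ennreal (indicator {0..L} s * (x s)\<^sup>2) \<partial>lborel"
  let ?NS = "\<lambda>x. \<integral>\<^sup>+ s. ennreal (indicator {0..S} s * (V x s)\<^sup>2) \<partial>lborel"
  have *: "?NS x \<le> ennreal K * ?N x" "?N x \<le> ennreal K * ?NS x" "L2_on S (V x)" if x: "L2_on L x" for x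
  proof -
    have xm: "set_borel_measurable lborel {0..L} x" using x by (simp add: L2_on_def)
    note [measurable] = V_meas[OF xm]
    have [measurable]: "(\<lambda>s. indicator {0..L} s * (x s)\<^sup>2) \<in> borel_measurable borel"
      using x by (auto simp: L2_on_def set_integrable_def dest: borel_measurable_integrable)
    have "?NS x \<le> (\<integral>\<^sup>+ \<omega>. ennreal (K * (indicator {0..L} \<omega> * (x \<omega>)\<^sup>2)) \<partial>lborel)"
      unfolding V_nn_integral[OF xm]
    proof (intro nn_integral_mono ennreal_leI)
      fix \<omega>
      show "(p \<omega>)\<^sup>2 / c \<omega> * (indicator {0..L} \<omega> * (x \<omega>)\<^sup>2) \<le> K * (indicator {0..L} \<omega> * (x \<omega>)\<^sup>2)"
        using mult_right_mono[OF K(2)[of \<omega>], of "(x \<omega>)\<^sup>2"] by (auto simp: indicator_def)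
    qed
    also have "\<dots> = (\<integral>\<^sup>+ \<omega>. ennreal K * ennreal (indicator {0..L} \<omega> * (x \<omega>)\<^sup>2) \<partial>lborel)"
      using K(1) by (intro nn_integral_cong ennreal_mult') simp
    also have "\<dots> = ennreal K * ?N x" by (rule nn_integral_cmult) measurable
    finally show 1: "?NS x \<le> ennreal K * ?N x" .
    have "?N x \<le> (\<integral>\<^sup>+ \<omega>. ennreal (K * ((p \<omega>)\<^sup>2 / c \<omega> * (indicator {0..L} \<omega> * (x \<omega>)\<^sup>2))) \<partial>lborel)"
    proof (intro nn_integral_mono ennreal_leI)
      fix \<omega>
      show "indicator {0..L} \<omega> * (x \<omega>)\<^sup>2 \<le> K * ((p \<omega>)\<^sup>2 / c \<omega> * (indicator {0..L} \<omega> * (x \<omega>)\<^sup>2))"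
        using mult_right_mono[OF K(3)[of \<omega>], of "(x \<omega>)\<^sup>2"] by (auto simp: indicator_def mult.assoc)
    qed
    also have "\<dots> = (\<integral>\<^sup>+ \<omega>. ennreal K * ennreal ((p \<omega>)\<^sup>2 / c \<omega> * (indicator {0..L} \<omega> * (x \<omega>)\<^sup>2)) \<partial>lborel)"
      using K(1) by (intro nn_integral_cong ennreal_mult') simp
    also have "\<dots> = ennreal K * ?NS x"
    proof -
      have [measurable]: "(\<lambda>\<omega>. c (clamp \<omega>)) \<in> borel_measurable borel" by (rule meas_clamp[OF c_cont])
      have eq: "(\<lambda>\<omega>. ennreal ((p \<omega>)\<^sup>2 / c \<omega> * (indicator {0..L} \<omega> * (x \<omega>)\<^sup>2)))
         = (\<lambda>\<omega>. ennreal ((p \<omega>)\<^sup>2 / c (clamp \<omega>) * (indicator {0..L} \<omega> * (x \<omega>)\<^sup>2)))"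
        by (auto simp: fun_eq_iff indicator_def clamp_id)
      have "(\<lambda>\<omega>. ennreal ((p \<omega>)\<^sup>2 / c \<omega> * (indicator {0..L} \<omega> * (x \<omega>)\<^sup>2))) \<in> borel_measurable lborel"
        unfolding eq by measurable
      then show ?thesis unfolding V_nn_integral[OF xm] by (rule nn_integral_cmult)
    qed
    finally show "?N x \<le> ennreal K * ?NS x" .
    have "?NS x < \<infinity>" using 1 x by (auto simp: L2_on_iff_nn_integral ennreal_mult_less_top elim!: order.strict_trans1)
    then show "L2_on S (V x)" by (simp add: L2_on_iff_nn_integral set_borel_measurable_def)
  qed
  show thesis
  proof (rule that[OF K(1) *(3)])
    fix x assume x: "L2_on L x"
    show "(LINT s:{0..S}|lborel. (V x s)\<^sup>2) \<le> K * (L2norm L x)\<^sup>2"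
      unfolding L2norm_sq using *(1,3)[OF x] x K(1) by (intro L2_integral_le) auto
    show "(L2norm L x)\<^sup>2 \<le> K * (LINT s:{0..S}|lborel. (V x s)\<^sup>2)"
      unfolding L2norm_sq using *(2,3)[OF x] x K(1) by (intro L2_integral_le) auto
  qed
qed

text \<open>The interval [-S,0] is one lap behind [0,S], and V differs there by the constant factor
  exp \<theta>.\<close>

lemma V_sq_symmetric_interval:
  assumes "L2_on L x"
  shows "set_integrable lborel {-S..S} (\<lambda>s. (V x s)\<^sup>2)"
proof -
  obtain K where "\<And>x. L2_on L x \<Longrightarrow> L2_on S (V x)" using norm_equivalence by metis
  then have 1: "set_integrable lborel {0..S} (\<lambda>s. (V x s)\<^sup>2)" using assms by (simp add: L2_on_def)
  then have "set_integrable lborel {-S - (-S)..0 - (-S)} (\<lambda>s. (V x s)\<^sup>2)" by simp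
  from set_integrable_shift_Icc[OF this] have "set_integrable lborel {-S..0} (\<lambda>s. (exp \<theta>)\<^sup>2 * (V x s)\<^sup>2)"
    by (simp add: V_add_S power_mult_distrib)
  then have 2: "set_integrable lborel {-S..0} (\<lambda>s. (V x s)\<^sup>2)" by simp
  have "{-S..S} = {-S..0} \<union> {0..S}" using S by auto
  then show ?thesis using set_integrable_Un[OF 2 1] by simp
qed

section \<open>Accumulated damping and exponential decay\<close>

text \<open>Since \<open>W x\<close> is S-periodic, the decay of the translates of \<open>V x = exp damp * W x\<close> is governed by the growth
  of \<open>damp\<close> alone.\<close>

definition damp :: "real \<Rightarrow> real" where "damp s = \<theta> * real_of_int (lap s) + Q (\<psi> (res s))"
definition W :: "(real \<Rightarrow> real) \<Rightarrow> real \<Rightarrow> real" where "W x s = c (\<psi> (res s)) * x (\<psi> (res s))"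

lemma V_W: "V x s = exp (damp s) * W x s"
  using p_eq[OF \<psi>_in] by (simp add: V_def W_def damp_def exp_add)

lemma W_meas:
  assumes "set_borel_measurable lborel {0..L} x"
  shows "W x \<in> borel_measurable borel"
proof -
  note [measurable] = V_meas[OF assms]
  have [measurable]: "(\<lambda>\<omega>. Q (clamp \<omega>)) \<in> borel_measurable borel" by (rule meas_clamp[OF Q_cont])
  have "(\<lambda>s. Q (clamp (\<psi> (res s)))) \<in> borel_measurable borel" by measurable
  then have [measurable]: "(\<lambda>s. Q (\<psi> (res s))) \<in> borel_measurable borel"
    by (simp only: clamp_id[OF \<psi>_in])
  have [measurable]: "damp \<in> borel_measurable borel"
    unfolding damp_def[abs_def] by measurable
  have "W x = (\<lambda>s. exp (- damp s) * V x s)" by (auto simp: V_W fun_eq_iff exp_minus)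
  then show ?thesis by simp
qed

text \<open>The factor 2: a path from s to t contains at most two incomplete laps, the end of its
  first and the start of its last, and each may lose \<beta>. The complete laps in between satisfy
  the lossless bound \<open>full\<close>, so the loss does not accumulate with t.\<close>

lemma damp_increase:
  assumes part: "\<And>x y. 0 \<le> x \<Longrightarrow> x \<le> y \<Longrightarrow> y \<le> L \<Longrightarrow> Q y - Q x \<ge> \<alpha> * (\<phi> y - \<phi> x) - \<beta>"
    and full: "\<theta> \<ge> \<alpha> * S" and "\<beta> \<ge> 0" and "s \<le> t"
  shows "damp t - damp s \<ge> \<alpha> * (t - s) - 2 * \<beta>"
proof -
  define i j where "i = lap s" and "j = lap t"
  have ij: "i \<le> j" unfolding i_def j_def lap_def using \<open>s \<le> t\<close> S by (intro floor_mono divide_right_mono) auto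
  define x y where "x = \<psi> (res s)" and "y = \<psi> (res t)"
  have xy: "x \<in> {0..L}" "y \<in> {0..L}" using \<psi>_in by (auto simp: x_def y_def)
  have r: "\<phi> x = res s" "\<phi> y = res t" using res_in[of s] res_in[of t] \<phi>_\<psi> by (auto simp: x_def y_def)
  have s: "s = \<phi> x + S * real_of_int i" "t = \<phi> y + S * real_of_int j"
    using s_eq[of s] s_eq[of t] by (auto simp: r i_def j_def)
  have d: "damp t - damp s = \<theta> * (real_of_int j - real_of_int i) + Q y - Q x"
    by (simp add: damp_def x_def y_def i_def j_def algebra_simps)
  show ?thesis
  proof (cases "i = j")
    case True
    then have "\<phi> x \<le> \<phi> y" using s \<open>s \<le> t\<close> by simp
    then have "x \<le> y" using \<phi>_strict[of y x] xy by force
    from part[OF _ this] show ?thesis using d s True xy \<open>\<beta> \<ge> 0\<close> by simp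
  next
    case False
    \<comment> \<open>The number of complete laps strictly between the two incomplete ones; it may
      be 0.\<close>
    define n where "n = real_of_int j - real_of_int i - 1"
    have n: "n \<ge> 0" using ij False by (simp add: n_def)
    have j: "real_of_int j = real_of_int i + n + 1" by (simp add: n_def)
    have 1: "Q y \<ge> \<alpha> * \<phi> y - \<beta>" using part[of 0 y] xy by (simp add: Q_0 \<phi>_0)
    have 2: "\<theta> - Q x \<ge> \<alpha> * (S - \<phi> x) - \<beta>" using part[of x L] xy by (simp add: \<theta>_def S_def)
    have 3: "n * \<theta> \<ge> n * (\<alpha> * S)" using full n by (rule mult_left_mono)
    have "\<alpha> * (t - s) = \<alpha> * \<phi> y + \<alpha> * (S - \<phi> x) + n * (\<alpha> * S)" unfolding s j by (simp add: algebra_simps)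
    moreover have "damp t - damp s = n * \<theta> + (\<theta> - Q x) + Q y" unfolding d j by (simp add: algebra_simps)
    ultimately show ?thesis using 1 2 3 by linarith
  qed
qed

text \<open>T t x is W translated, divided by c and damped. Of the factor 1 / c^2 in its square, one
  1 / c is the Jacobian of the coordinate and the other is bounded by 1 / cmin; after the periodic
  shift, c x^2 <= cmax x^2 leads back. Hence sqrt (cmax / cmin), whatever L is.\<close>

lemma T_decay:
  assumes part: "\<And>x y. 0 \<le> x \<Longrightarrow> x \<le> y \<Longrightarrow> y \<le> L \<Longrightarrow> Q y - Q x \<ge> \<alpha> * (\<phi> y - \<phi> x) - \<beta>"
    and full: "\<theta> \<ge> \<alpha> * S" and b: "\<beta> \<ge> 0" and t: "t \<ge> 0" and x: "L2_on L x"
  shows "L2_on L (T t x)"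
    and "L2norm L (T t x) \<le> sqrt (cmax / cmin) * exp (2 * \<beta>) * exp (- \<alpha> * t) * L2norm L x"
proof -
  have xm: "set_borel_measurable lborel {0..L} x" using x by (simp add: L2_on_def)
  note [measurable] = W_meas[OF xm] T_meas[OF xm]
  have cmax: "cmax > 0" using c_le[of L] c_pos[of L] L by simp
  define D where "D = exp (2 * \<beta> - \<alpha> * t)"
  have D: "D > 0" by (simp add: D_def)
  let ?N = "\<lambda>x. \<integral>\<^sup>+ s. ennreal (indicator {0..L} s * (x s)\<^sup>2) \<partial>lborel"
  have [measurable]: "(\<lambda>s. indicator {0..L} s * (x s)\<^sup>2) \<in> borel_measurable borel"
    using x by (auto simp: L2_on_def set_integrable_def dest: borel_measurable_integrable)
  have "?N (T t x) \<le> (\<integral>\<^sup>+ \<omega>. ennreal (D\<^sup>2 / cmin * (W x (\<phi> \<omega> - t))\<^sup>2 * (1 / c \<omega>) * indicator {0..L} \<omega>) \<partial>lborel)"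
  proof (rule nn_integral_mono_AE)
    show "AE \<omega> in lborel. ennreal (indicator {0..L} \<omega> * (T t x \<omega>)\<^sup>2)
       \<le> ennreal (D\<^sup>2 / cmin * (W x (\<phi> \<omega> - t))\<^sup>2 * (1 / c \<omega>) * indicator {0..L} \<omega>)"
      using AE_not_L
    proof eventually_elim
      case (elim \<omega>)
      show ?case
      proof (cases "\<omega> \<in> {0..L}")
        case True
        then have w: "0 \<le> \<omega>" "\<omega> < L" using elim by auto
        have cp: "c \<omega> > 0" "cmin \<le> c \<omega>" using c_pos c_ge True by auto
        have "\<phi> \<omega> < S" using \<phi>_strict[of \<omega> L] w by (simp add: S_def)
        then have dw: "damp (\<phi> \<omega>) = Q \<omega>"
          using lap_res_id[of "\<phi> \<omega>"] \<phi>_in[OF True] \<psi>_\<phi>[OF True] by (simp add: damp_def)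
        \<comment> \<open>The value at \<omega> comes from the coordinate \<phi> \<omega> - t on the
          unrolled line; \<open>damp\<close> counts the laps passed since then.\<close>
        have "damp (\<phi> \<omega>) - damp (\<phi> \<omega> - t) \<ge> \<alpha> * (\<phi> \<omega> - (\<phi> \<omega> - t)) - 2 * \<beta>"
          by (rule damp_increase[OF part full b]) (use t in auto)
        then have e: "exp (damp (\<phi> \<omega> - t) - Q \<omega>) \<le> D" by (simp add: D_def dw)
        have "T t x \<omega> = exp (damp (\<phi> \<omega> - t) - Q \<omega>) * (W x (\<phi> \<omega> - t) / c \<omega>)"
          using True cp by (simp add: T_def V_W p_eq \<Phi>_eq exp_diff field_simps)
        then have "(T t x \<omega>)\<^sup>2 = (exp (damp (\<phi> \<omega> - t) - Q \<omega>))\<^sup>2 * ((W x (\<phi> \<omega> - t))\<^sup>2 / (c \<omega>)\<^sup>2)"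
          by (simp add: power_mult_distrib power_divide)
        also have "\<dots> \<le> D\<^sup>2 * ((W x (\<phi> \<omega> - t))\<^sup>2 / (cmin * c \<omega>))"
          using e cp cmin by (intro mult_mono power_mono divide_left_mono) (auto simp: power2_eq_square)
        also have "\<dots> = D\<^sup>2 / cmin * (W x (\<phi> \<omega> - t))\<^sup>2 * (1 / c \<omega>)" by (simp add: field_simps)
        finally show ?thesis using True by (simp add: ennreal_leI)
      qed simp
    qed
  qed
  also have "\<dots> = (\<integral>\<^sup>+ s. ennreal (D\<^sup>2 / cmin * (W x (s - t))\<^sup>2 * indicator {0..S} s) \<partial>lborel)"
    by (subst nn_substitution) auto
  also have "\<dots> = (\<integral>\<^sup>+ s. ennreal (D\<^sup>2 / cmin * (W x (s - t))\<^sup>2) * indicator {0..S} s \<partial>lborel)"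
    by (intro nn_integral_cong) (auto simp: indicator_def)
  also have "\<dots> = (\<integral>\<^sup>+ s. ennreal (D\<^sup>2 / cmin * (W x s)\<^sup>2) * indicator {0..S} s \<partial>lborel)"
  \<comment> \<open>W is periodic but V is not, which is why the damping factor is bounded before
    this shift.\<close>
  proof (rule nn_integral_periodic_shift[OF _ S, where F="\<lambda>s. ennreal (D\<^sup>2 / cmin * (W x s)\<^sup>2)"])
    show "ennreal (D\<^sup>2 / cmin * (W x (s + S))\<^sup>2) = ennreal (D\<^sup>2 / cmin * (W x s)\<^sup>2)" for s
      using res_add[of s 1] by (simp add: W_def)
  qed measurable
  also have "\<dots> = (\<integral>\<^sup>+ s. ennreal (D\<^sup>2 / cmin * (W x s)\<^sup>2 * indicator {0..S} s) \<partial>lborel)"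
    by (intro nn_integral_cong) (auto simp: indicator_def)
  also have "\<dots> = (\<integral>\<^sup>+ \<omega>. ennreal (D\<^sup>2 / cmin * (W x (\<phi> \<omega>))\<^sup>2 * (1 / c \<omega>) * indicator {0..L} \<omega>) \<partial>lborel)"
    by (rule nn_substitution) measurable
  also have "\<dots> \<le> (\<integral>\<^sup>+ \<omega>. ennreal (D\<^sup>2 * (cmax / cmin)) * ennreal (indicator {0..L} \<omega> * (x \<omega>)\<^sup>2) \<partial>lborel)"
  proof (rule nn_integral_mono_AE)
    show "AE \<omega> in lborel. ennreal (D\<^sup>2 / cmin * (W x (\<phi> \<omega>))\<^sup>2 * (1 / c \<omega>) * indicator {0..L} \<omega>)
       \<le> ennreal (D\<^sup>2 * (cmax / cmin)) * ennreal (indicator {0..L} \<omega> * (x \<omega>)\<^sup>2)"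
      using AE_not_L
    proof eventually_elim
      case (elim \<omega>)
      show ?case
      proof (cases "\<omega> \<in> {0..L}")
        case True
        then have w: "0 \<le> \<omega>" "\<omega> < L" using elim by auto
        have cp: "c \<omega> > 0" "c \<omega> \<le> cmax" using c_pos c_le True by auto
        have "\<phi> \<omega> < S" using \<phi>_strict[of \<omega> L] w by (simp add: S_def)
        then have "W x (\<phi> \<omega>) = c \<omega> * x \<omega>"
          using lap_res_id[of "\<phi> \<omega>"] \<phi>_in[OF True] \<psi>_\<phi>[OF True] by (simp add: W_def)
        then have "D\<^sup>2 / cmin * (W x (\<phi> \<omega>))\<^sup>2 * (1 / c \<omega>) = D\<^sup>2 / cmin * (x \<omega>)\<^sup>2 * c \<omega>"
          using cp by (simp add: power2_eq_square)
        also have "\<dots> \<le> D\<^sup>2 / cmin * (x \<omega>)\<^sup>2 * cmax" using cp cmin by (intro mult_left_mono) auto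
        also have "\<dots> = D\<^sup>2 * (cmax / cmin) * (x \<omega>)\<^sup>2" by simp
        finally show ?thesis using True cmax cmin by (simp add: ennreal_mult[symmetric] ennreal_leI)
      qed simp
    qed
  qed
  also have "\<dots> = ennreal (D\<^sup>2 * (cmax / cmin)) * ?N x" by (rule nn_integral_cmult) measurable
  finally have main: "?N (T t x) \<le> ennreal (D\<^sup>2 * (cmax / cmin)) * ?N x" .
  have "?N (T t x) < \<infinity>"
    using x by (intro order.strict_trans1[OF main]) (auto simp: L2_on_iff_nn_integral ennreal_mult_less_top)
  then show Tx: "L2_on L (T t x)" by (simp add: L2_on_iff_nn_integral set_borel_measurable_def)
  have "(L2norm L (T t x))\<^sup>2 \<le> D\<^sup>2 * (cmax / cmin) * (L2norm L x)\<^sup>2"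
    unfolding L2norm_sq using cmax cmin by (intro L2_integral_le[OF Tx x _ main]) simp
  then have "sqrt ((L2norm L (T t x))\<^sup>2) \<le> sqrt (D\<^sup>2 * (cmax / cmin) * (L2norm L x)\<^sup>2)"
    by (rule real_sqrt_le_mono)
  moreover have "L2norm L f \<ge> 0" for f unfolding L2norm_def by (simp add: set_integral_nonneg_all)
  moreover have "sqrt (D\<^sup>2 * (cmax / cmin) * (L2norm L x)\<^sup>2) = D * sqrt (cmax / cmin) * L2norm L x"
    using D calculation(2)[of x] unfolding real_sqrt_mult by simp
  ultimately have "L2norm L (T t x) \<le> D * sqrt (cmax / cmin) * L2norm L x" by simp
  also have "D = exp (2 * \<beta>) * exp (- \<alpha> * t)" by (simp add: D_def exp_add[symmetric])
  finally show "L2norm L (T t x) \<le> sqrt (cmax / cmin) * exp (2 * \<beta>) * exp (- \<alpha> * t) * L2norm L x"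
    by (simp add: mult_ac)
qed

end

section \<open>The closed-loop generator\<close>

lemma primitive_on_add:
  assumes "primitive_on L F f" "primitive_on L G g"
  shows "primitive_on L (\<lambda>s. F s + G s) (\<lambda>s. f s + g s)"
  unfolding primitive_on_def
proof (intro conjI ballI)
  have i: "set_integrable lborel {0..L} f" "set_integrable lborel {0..L} g"
    using assms by (auto simp: primitive_on_def)
  then show "set_integrable lborel {0..L} (\<lambda>s. f s + g s)" by (rule set_integral_add(1))
  fix s assume s: "s \<in> {0..L}"
  have "set_integrable lborel {0..s} f" "set_integrable lborel {0..s} g"
    by (rule set_integrable_subset[OF i(1)] set_integrable_subset[OF i(2)]; use s in auto)+
  then show "F s + G s = F 0 + G 0 + (LINT \<tau>:{0..s}|lborel. f \<tau> + g \<tau>)"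
    using primitive_onD(1)[OF assms(1), of 0 s] primitive_onD(1)[OF assms(2), of 0 s] s
    by (simp add: set_integral_add(2))
qed

lemma primitive_on_uminus:
  assumes "primitive_on L F f"
  shows "primitive_on L (\<lambda>s. - F s) (\<lambda>s. - f s)"
  unfolding primitive_on_def
proof (intro conjI ballI)
  have i: "set_integrable lborel {0..L} f" using assms by (auto simp: primitive_on_def)
  then show "set_integrable lborel {0..L} (\<lambda>s. - f s)" using set_integrable_mult_right[of "-1" lborel _ f] by simp
  fix s assume s: "s \<in> {0..L}"
  have "set_integrable lborel {0..s} f" by (rule set_integrable_subset[OF i]) (use s in auto)
  then show "- F s = - F 0 + (LINT \<tau>:{0..s}|lborel. - f \<tau>)"
    using primitive_onD(1)[OF assms, of 0 s] s by (simp add: set_integral_uminus)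
qed

lemma set_integral_cong_AE_set_measurable:
  fixes f g :: "'a \<Rightarrow> real"
  assumes "set_integrable M A f" "set_integrable M A g" "AE x in M. x \<in> A \<longrightarrow> f x = g x"
  shows "(LINT x:A|M. f x) = (LINT x:A|M. g x)"
  unfolding set_lebesgue_integral_def
proof (rule integral_cong_AE)
  show "AE x in M. indicator A x *\<^sub>R f x = indicator A x *\<^sub>R g x"
    using assms(3) by eventually_elim (auto simp: indicator_def)
qed (use assms in \<open>auto simp: set_integrable_def\<close>)

lemma H1_rep_iff_primitive_on: "L2_on L g \<and> primitive_on L y g \<longleftrightarrow> H1_rep L y g"
  unfolding H1_rep_def primitive_on_def using L2_on_integrable by blast

lemma sq_tendsto_zero_iff:
  fixes f :: "'a \<Rightarrow> real"
  shows "((\<lambda>h. (f h)\<^sup>2) \<longlongrightarrow> 0) F \<longleftrightarrow> (f \<longlongrightarrow> 0) F"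
proof
  assume "((\<lambda>h. (f h)\<^sup>2) \<longlongrightarrow> 0) F"
  then have "((\<lambda>h. sqrt ((f h)\<^sup>2)) \<longlongrightarrow> sqrt 0) F" by (intro tendsto_intros)
  then show "(f \<longlongrightarrow> 0) F" by (simp add: tendsto_rabs_zero_iff)
next
  assume "(f \<longlongrightarrow> 0) F"
  from tendsto_power[OF this, of 2] show "((\<lambda>h. (f h)\<^sup>2) \<longlongrightarrow> 0) F" by simp
qed

context transport
begin

text \<open>The logarithm of the weight p on [0,L], with \<rho> its bounded derivative. In
  exponential form, p and 1 / p are served by the same product rule.\<close>

definition R :: "real \<Rightarrow> real" where "R \<omega> = ln (c \<omega>) + Q \<omega>"
definition \<rho> :: "real \<Rightarrow> real" where "\<rho> \<omega> = dc \<omega> / c \<omega> + q \<omega> / c \<omega>"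

lemma exp_R: "\<omega> \<in> {0..L} \<Longrightarrow> exp (R \<omega>) = p \<omega>"
  using c_pos by (simp add: R_def exp_add p_eq)

lemma R_prim: "primitive_on L R \<rho>"
proof -
  have "primitive_on L (\<lambda>\<omega>. ln (c \<omega>)) (\<lambda>\<omega>. dc \<omega> * (1 / c \<omega>))"
  proof (rule primitive_on_compose[OF c_prim dc_bound])
    show "(ln has_real_derivative 1 / x) (at x)" if "x \<in> c ` {0..L}" for x
      using that c_pos by (auto intro!: derivative_eq_intros)
    show "continuous_on (c ` {0..L}) (\<lambda>x. 1 / x)"
      using c_pos by (force intro!: continuous_intros)
  qed
  from primitive_on_add[OF this Q_prim] show ?thesis
    by (simp add: R_def[abs_def] \<rho>_def[abs_def])
qed

lemma \<rho>_meas: "set_borel_measurable lborel {0..L} \<rho>"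
  using R_prim by (auto simp: primitive_on_def set_integrable_def set_borel_measurable_def)

lemma \<rho>_bound: "AE \<omega> in lborel. \<omega> \<in> {0..L} \<longrightarrow> \<bar>\<rho> \<omega>\<bar> \<le> (B + 1) / cmin"
  using dc_bound
proof eventually_elim
  case (elim \<omega>)
  show ?case
  proof
    assume w: "\<omega> \<in> {0..L}"
    have "\<bar>dc \<omega> + q \<omega>\<bar> \<le> B + 1" using elim w q_bound[of \<omega>] by auto
    moreover have "\<rho> \<omega> = (dc \<omega> + q \<omega>) / c \<omega>" by (simp add: \<rho>_def add_divide_distrib)
    ultimately show "\<bar>\<rho> \<omega>\<bar> \<le> (B + 1) / cmin"
      using c_pos[OF w] c_ge[OF w] cmin by (auto simp: abs_divide intro!: frac_le)
  qed
qed

lemma p_cont: "continuous_on {0..L} p"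
  unfolding p_def by (intro cont_clamp continuous_intros c_cont Q_cont)

lemma V_integral:
  assumes z: "L2_on L z" and w: "\<omega> \<in> {0..L}"
  shows "(LINT s:{0..\<phi> \<omega>}|lborel. V z s) = (LINT \<tau>:{0..\<omega>}|lborel. p \<tau> / c \<tau> * z \<tau>)"
proof -
  have Vint: "set_integrable lborel {0..S} (V z)"
  proof -
    obtain K where "\<And>x. L2_on L x \<Longrightarrow> L2_on S (V x)" using norm_equivalence by metis
    then show ?thesis using z by (intro L2_on_integrable) simp
  qed
  have sub: "set_integrable lborel {\<phi> 0..\<phi> \<omega>} (V z)"
    by (rule set_integrable_subset[OF Vint]) (use \<phi>_in[OF w] in \<open>auto simp: \<phi>_0\<close>)
  have d: "\<And>x. x \<in> {0..\<omega>} \<Longrightarrow> (\<phi> has_real_derivative 1 / c x) (at x)" using w by (intro \<phi>_deriv) auto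
  have cc: "continuous_on {0..\<omega>} (\<lambda>x. 1 / c x)" by (rule continuous_on_subset[OF inv_c_cont]) (use w in auto)
  have nn: "\<And>x. x \<in> {0..\<omega>} \<Longrightarrow> 0 \<le> 1 / c x" using c_pos w by (auto simp: less_imp_le)
  have w0: "0 \<le> \<omega>" using w by simp
  note s1 = integral_substitution(1)[OF sub d cc nn w0] and s2 = integral_substitution(2)[OF sub d cc nn w0]
  have "continuous_on {0..L} (\<lambda>\<tau>. p \<tau> * (1 / c \<tau>))" by (intro continuous_on_mult p_cont inv_c_cont)
  then have "L2_on L (\<lambda>\<tau>. p \<tau> * (1 / c \<tau>) * z \<tau>)" using L2_on_mult_continuous[OF z] by blast
  then have i2: "set_integrable lborel {0..L} (\<lambda>\<tau>. p \<tau> / c \<tau> * z \<tau>)" using L2_on_integrable by simp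
  have "(LINT s:{0..\<phi> \<omega>}|lborel. V z s) = (LINT \<tau>:{0..\<omega>}|lborel. V z (\<phi> \<tau>) * (1 / c \<tau>))"
    using s2 by (simp add: set_lebesgue_integral_def \<phi>_0 mult.commute mult.left_commute)
  also have "\<dots> = (LINT \<tau>:{0..\<omega>}|lborel. p \<tau> / c \<tau> * z \<tau>)"
  proof (rule set_integral_cong_AE_set_measurable[OF s1])
    show "set_integrable lborel {0..\<omega>} (\<lambda>\<tau>. p \<tau> / c \<tau> * z \<tau>)"
      by (rule set_integrable_subset[OF i2]) (use w in auto)
    show "AE \<tau> in lborel. \<tau> \<in> {0..\<omega>} \<longrightarrow> V z (\<phi> \<tau>) * (1 / c \<tau>) = p \<tau> / c \<tau> * z \<tau>"
      using AE_not_L by eventually_elim (use w in \<open>auto simp: V_\<phi>\<close>)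
  qed
  finally show ?thesis .
qed

text \<open>Null sets pull back along \<phi> because the density 1 / c is positive: where its
  integral over the preimage vanishes, the preimage is null.\<close>

lemma AE_\<phi>:
  assumes "AE s in lborel. s \<in> {0..S} \<longrightarrow> P s"
  shows "AE \<omega> in lborel. \<omega> \<in> {0..L} \<longrightarrow> P (\<phi> \<omega>)"
proof -
  from assms obtain N where N: "N \<in> null_sets lborel" "{s. \<not> (s \<in> {0..S} \<longrightarrow> P s)} \<subseteq> N"
    by (auto simp: eventually_ae_filter)
  have [measurable]: "N \<in> sets borel" using N(1) by auto
  have [measurable]: "(\<lambda>\<omega>. c (clamp \<omega>)) \<in> borel_measurable borel" by (rule meas_clamp[OF c_cont])
  have "(\<integral>\<^sup>+ \<omega>. ennreal (indicator N (\<phi> \<omega>) * (1 / c \<omega>) * indicator {0..L} \<omega>) \<partial>lborel)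
     = (\<integral>\<^sup>+ s. ennreal (indicator N s * indicator {0..S} s) \<partial>lborel)"
    by (rule nn_substitution[symmetric]) measurable
  also have "\<dots> \<le> (\<integral>\<^sup>+ s. indicator N s \<partial>lborel)" by (intro nn_integral_mono) (auto simp: indicator_def)
  also have "\<dots> = 0" using N(1) by (simp add: null_sets_def)
  finally have "(\<integral>\<^sup>+ \<omega>. ennreal (indicator N (\<phi> \<omega>) * (1 / c \<omega>) * indicator {0..L} \<omega>) \<partial>lborel) = 0" by simp
  moreover have "(\<lambda>\<omega>. ennreal (indicator N (\<phi> \<omega>) * (1 / c \<omega>) * indicator {0..L} \<omega>)) \<in> borel_measurable lborel"
  proof -
    have "(\<lambda>\<omega>. ennreal (indicator N (\<Phi> \<omega>) * (1 / c (clamp \<omega>)) * indicator {0..L} \<omega>)) \<in> borel_measurable lborel"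
      by measurable
    also have "(\<lambda>\<omega>. ennreal (indicator N (\<Phi> \<omega>) * (1 / c (clamp \<omega>)) * indicator {0..L} \<omega>))
       = (\<lambda>\<omega>. ennreal (indicator N (\<phi> \<omega>) * (1 / c \<omega>) * indicator {0..L} \<omega>))"
      by (auto simp: fun_eq_iff indicator_def clamp_id \<Phi>_eq)
    finally show ?thesis .
  qed
  ultimately have "AE \<omega> in lborel. ennreal (indicator N (\<phi> \<omega>) * (1 / c \<omega>) * indicator {0..L} \<omega>) = 0"
    by (simp add: nn_integral_0_iff_AE)
  then show ?thesis
  proof eventually_elim
    case (elim \<omega>)
    show ?case
    proof
      assume w: "\<omega> \<in> {0..L}"
      then have "\<phi> \<omega> \<notin> N" using elim c_pos[OF w] by (auto simp: indicator_def ennreal_eq_0_iff split: if_splits)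
      then show "P (\<phi> \<omega>)" using N(2) \<phi>_in[OF w] by auto
    qed
  qed
qed

text \<open>The substitution read the other way: the image under \<phi> of a null set has as measure
  the integral of 1 / c over that set, which is 0.\<close>

lemma AE_\<psi>:
  assumes "AE \<omega> in lborel. \<omega> \<in> {0..L} \<longrightarrow> P \<omega>"
  shows "AE s in lborel. s \<in> {0..S} \<longrightarrow> P (\<psi> s)"
proof -
  from assms obtain N where N: "N \<in> null_sets lborel" "{\<omega>. \<not> (\<omega> \<in> {0..L} \<longrightarrow> P \<omega>)} \<subseteq> N"
    by (auto simp: eventually_ae_filter)
  have [measurable]: "N \<in> sets borel" using N(1) by auto
  have "(\<integral>\<^sup>+ s. ennreal (indicator N (\<psi> s) * indicator {0..S} s) \<partial>lborel)
     = (\<integral>\<^sup>+ \<omega>. ennreal (indicator N (\<psi> (\<phi> \<omega>)) * (1 / c \<omega>) * indicator {0..L} \<omega>) \<partial>lborel)"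
    by (rule nn_substitution) measurable
  also have "\<dots> = (\<integral>\<^sup>+ \<omega>. 0 \<partial>(lborel::real measure))"
  proof (rule nn_integral_cong_AE)
    show "AE \<omega> in lborel. ennreal (indicator N (\<psi> (\<phi> \<omega>)) * (1 / c \<omega>) * indicator {0..L} \<omega>) = 0"
      using AE_not_in[OF N(1)] by eventually_elim (auto simp: indicator_def \<psi>_\<phi>)
  qed
  finally have "AE s in lborel. ennreal (indicator N (\<psi> s) * indicator {0..S} s) = 0"
    by (subst nn_integral_0_iff_AE[symmetric]) auto
  then show ?thesis
  proof eventually_elim
    case (elim s)
    then show ?case using N(2) \<psi>_in[of s] by (auto simp: indicator_def split: if_splits)
  qed
qed

text \<open>\<open>CL_op\<close> with the single coefficient \<open>q\<close> in place of the
  truncated indicator times the feedback gain; on [0,L] they agree for gain 1 and q the indicator of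
  the region.\<close>

definition gen :: "(real \<Rightarrow> real) \<Rightarrow> (real \<Rightarrow> real) \<Rightarrow> bool" where
  "gen x z \<longleftrightarrow> (\<exists>y g. H1_rep L y g \<and> ae_eq_on L x y \<and> c 0 * y 0 = c L * y L \<and>
     ae_eq_on L z (\<lambda>s. - (dc s * y s + c s * g s) - q s * y s))"

lemma quasi_periodic_pair_V:
  assumes "L2_on L x" "L2_on L z"
  shows "quasi_periodic_pair (V x) (V z) S (exp \<theta>)"
  using assms by unfold_locales (auto simp: S V_add_S L2_on_def intro: V_meas V_sq_symmetric_interval)

text \<open>The weight is chosen so that (p y)' = p (\<rho> y + g) = (p / c) (dc y + q y + c g) =
  -(p / c) z; in the coordinate s, p y is thus a primitive of - V z. The boundary condition becomes
  the factor exp \<theta>, since p equals c 0 at 0 and c L exp \<theta> at L.\<close>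

lemma gen_imp_V_limit:
  assumes x: "L2_on L x" and z: "L2_on L z" and g: "gen x z"
  shows "((\<lambda>h. LINT s:{0..S}|lborel. ((V x (s - h) - V x s) / h - V z s)\<^sup>2) \<longlongrightarrow> 0) (at_right 0)"
proof -
  interpret qp: quasi_periodic_pair "V x" "V z" S "exp \<theta>" using quasi_periodic_pair_V[OF x z] .
  from g obtain y g where H: "H1_rep L y g" and xy: "ae_eq_on L x y" and bc: "c 0 * y 0 = c L * y L"
    and zeq: "ae_eq_on L z (\<lambda>s. - (dc s * y s + c s * g s) - q s * y s)" by (auto simp: gen_def)
  have y: "primitive_on L y g" using H by (simp add: H1_rep_iff_primitive_on[symmetric])
  have U: "primitive_on L (\<lambda>s. exp (R s) * y s) (\<lambda>s. exp (R s) * (\<rho> s * y s + g s))"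
    by (rule primitive_on_exp_mult[OF R_prim y \<rho>_bound])
  have Vz: "(LINT s:{0..\<phi> \<omega>}|lborel. V z s) = - (p \<omega> * y \<omega> - p 0 * y 0)" if w: "\<omega> \<in> {0..L}" for \<omega>
  proof -
    have "continuous_on {0..L} (\<lambda>\<tau>. p \<tau> * (1 / c \<tau>))" by (intro continuous_on_mult p_cont inv_c_cont)
    then have "L2_on L (\<lambda>\<tau>. p \<tau> * (1 / c \<tau>) * z \<tau>)" using L2_on_mult_continuous[OF z] by blast
    then have i2: "set_integrable lborel {0..L} (\<lambda>\<tau>. p \<tau> / c \<tau> * z \<tau>)" using L2_on_integrable by simp
    have i3: "set_integrable lborel {0..\<omega>} (\<lambda>s. exp (R s) * (\<rho> s * y s + g s))"
      using primitive_onD(2)[OF U, of 0 \<omega>] w by simp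
    have "(LINT s:{0..\<phi> \<omega>}|lborel. V z s) = (LINT \<tau>:{0..\<omega>}|lborel. p \<tau> / c \<tau> * z \<tau>)"
      by (rule V_integral[OF z w])
    also have "\<dots> = (LINT \<tau>:{0..\<omega>}|lborel. (-1) * (exp (R \<tau>) * (\<rho> \<tau> * y \<tau> + g \<tau>)))"
    proof (rule set_integral_cong_AE_set_measurable)
      show "set_integrable lborel {0..\<omega>} (\<lambda>\<tau>. p \<tau> / c \<tau> * z \<tau>)"
        by (rule set_integrable_subset[OF i2]) (use w in auto)
      show "set_integrable lborel {0..\<omega>} (\<lambda>\<tau>. (-1) * (exp (R \<tau>) * (\<rho> \<tau> * y \<tau> + g \<tau>)))"
        by (rule set_integrable_mult_right) (rule i3)
      show "AE \<tau> in lborel. \<tau> \<in> {0..\<omega>} \<longrightarrow> p \<tau> / c \<tau> * z \<tau> = (-1) * (exp (R \<tau>) * (\<rho> \<tau> * y \<tau> + g \<tau>))"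
        using zeq[unfolded ae_eq_on_def]
      proof eventually_elim
        case (elim \<tau>)
        show ?case
        proof
          assume "\<tau> \<in> {0..\<omega>}"
          then have t: "\<tau> \<in> {0..L}" using w by auto
          have "c \<tau> \<noteq> 0" using c_pos[OF t] by simp
          moreover have zt: "z \<tau> = - (dc \<tau> * y \<tau> + c \<tau> * g \<tau>) - q \<tau> * y \<tau>" using elim t by blast
          ultimately show "p \<tau> / c \<tau> * z \<tau> = (-1) * (exp (R \<tau>) * (\<rho> \<tau> * y \<tau> + g \<tau>))"
            unfolding zt exp_R[OF t] \<rho>_def by (simp add: field_simps)
        qed
      qed
    qed
    also have "\<dots> = - (exp (R \<omega>) * y \<omega> - exp (R 0) * y 0)"
      using primitive_onD(1)[OF U, of 0 \<omega>] w by (subst set_integral_mult_right) simp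
    finally show ?thesis using exp_R[OF w] exp_R[of 0] L by simp
  qed
  show ?thesis
  proof (rule qp.translation_generator_limit[where Y="\<lambda>s. p (\<psi> s) * y (\<psi> s)"])
    have \<psi>0: "\<psi> 0 = 0" using \<psi>_\<phi>[of 0] L by (simp add: \<phi>_0)
    fix s assume s: "s \<in> {0..S}"
    show "p (\<psi> s) * y (\<psi> s) = p (\<psi> 0) * y (\<psi> 0) - (LINT t:{0..s}|lborel. V z t)"
      using Vz[OF \<psi>_in, of s] \<phi>_\<psi>[OF s] by (simp add: \<psi>0)
  next
    have \<psi>0: "\<psi> 0 = 0" using \<psi>_\<phi>[of 0] L by (simp add: \<phi>_0)
    have \<psi>S: "\<psi> S = L" using \<psi>_\<phi>[of L] L by (simp add: S_def)
    show "p (\<psi> S) * y (\<psi> S) = exp \<theta> * (p (\<psi> 0) * y (\<psi> 0))"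
      using bc p_eq[of 0] p_eq[of L] L by (simp add: \<psi>0 \<psi>S \<theta>_def Q_0)
  next
    \<comment> \<open>At s = S the extension already belongs to the next lap, so that point is
      removed.\<close>
    show "AE s in lborel. s \<in> {0..S} \<longrightarrow> V x s = p (\<psi> s) * y (\<psi> s)"
      using AE_\<psi>[OF xy[unfolded ae_eq_on_def]] AE_lborel_singleton[of S]
      by eventually_elim (auto simp: V_eq)
  qed
qed

text \<open>The primitive found in characteristic coordinates is pulled back to U, and y = U / p is
  the absolutely continuous representative of x. Its derivative comes from the product rule with exp
  (- R), and is square integrable because z is, \<rho> is essentially bounded and U is
  continuous.\<close>

lemma V_limit_imp_gen:
  assumes x: "L2_on L x" and z: "L2_on L z"
    and lim: "((\<lambda>h. LINT s:{0..S}|lborel. ((V x (s - h) - V x s) / h - V z s)\<^sup>2) \<longlongrightarrow> 0) (at_right 0)"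
  shows "gen x z"
proof -
  interpret qp: quasi_periodic_pair "V x" "V z" S "exp \<theta>" using quasi_periodic_pair_V[OF x z] .
  obtain C where ae: "AE s in lborel. s \<in> {0..S} \<longrightarrow> V x s = C - (LINT t:{0..s}|lborel. V z t)"
    and bc: "C - (LINT t:{0..S}|lborel. V z t) = exp \<theta> * C"
    using qp.translation_generator_primitive[OF lim] by blast
  define u where "u = (\<lambda>\<tau>. - (p \<tau> / c \<tau> * z \<tau>))"
  define U where "U = (\<lambda>\<omega>. C - (LINT \<tau>:{0..\<omega>}|lborel. p \<tau> / c \<tau> * z \<tau>))"
  have pc: "continuous_on {0..L} (\<lambda>\<tau>. p \<tau> * (1 / c \<tau>))" by (intro continuous_on_mult p_cont inv_c_cont)
  have "L2_on L (\<lambda>\<tau>. (-1) * (p \<tau> * (1 / c \<tau>) * z \<tau>))"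
    by (intro L2_on_cmult L2_on_mult_continuous[OF z] pc)
  then have u2: "L2_on L u" by (simp add: u_def)
  have uint: "set_integrable lborel {0..L} u" using u2 by (rule L2_on_integrable)
  have U0: "U 0 = C" by (simp add: U_def set_integral_at_point)
  have Uprim: "primitive_on L U u"
    unfolding primitive_on_def U0
  proof (intro conjI ballI uint)
    fix s assume s: "s \<in> {0..L}"
    have "set_integrable lborel {0..s} u" by (rule set_integrable_subset[OF uint]) (use s in auto)
    from set_integrable_mult_right[of "-1" lborel _ u, OF this]
    have "set_integrable lborel {0..s} (\<lambda>\<tau>. p \<tau> / c \<tau> * z \<tau>)" by (simp add: u_def)
    then show "U s = C + (LINT \<tau>:{0..s}|lborel. u \<tau>)"
      unfolding U_def u_def by (subst set_integral_uminus) auto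
  qed
  have R': "primitive_on L (\<lambda>s. - R s) (\<lambda>s. - \<rho> s)" by (rule primitive_on_uminus[OF R_prim])
  have b': "AE \<omega> in lborel. \<omega> \<in> {0..L} \<longrightarrow> \<bar>- \<rho> \<omega>\<bar> \<le> (B + 1) / cmin" using \<rho>_bound by simp
  define y where "y = (\<lambda>s. exp (- R s) * U s)"
  define g where "g = (\<lambda>s. exp (- R s) * (- \<rho> s * U s + u s))"
  have yprim: "primitive_on L y g"
    unfolding y_def g_def by (rule primitive_on_exp_mult[OF R' Uprim b'])
  have eR: "exp (- R \<omega>) = 1 / p \<omega>" if "\<omega> \<in> {0..L}" for \<omega> using exp_R[OF that] by (simp add: exp_minus inverse_eq_divide)
  have g2: "L2_on L g"
    unfolding g_def
  proof (rule L2_on_mult_continuous[OF L2_on_add[OF _ u2]])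
    show "continuous_on {0..L} (\<lambda>s. exp (- R s))"
      by (intro continuous_intros primitive_on_continuous[OF R_prim])
    show "L2_on L (\<lambda>s. - \<rho> s * U s)"
    proof (rule L2_on_mult[OF L2_on_continuous[OF primitive_on_continuous[OF Uprim]] _ b'])
      show "set_borel_measurable lborel {0..L} (\<lambda>s. - \<rho> s)"
        using \<rho>_meas by (simp add: set_borel_measurable_def)
    qed
  qed
  have H: "H1_rep L y g" using yprim g2 by (simp add: H1_rep_iff_primitive_on[symmetric])
  have UV: "U \<omega> = C - (LINT t:{0..\<phi> \<omega>}|lborel. V z t)" if "\<omega> \<in> {0..L}" for \<omega>
    using V_integral[OF z that] by (simp add: U_def)
  have xy: "ae_eq_on L x y"
    unfolding ae_eq_on_def using AE_\<phi>[OF ae] AE_not_L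
  proof eventually_elim
    case (elim \<omega>)
    show ?case
    proof
      assume w: "\<omega> \<in> {0..L}"
      then have "p \<omega> * x \<omega> = U \<omega>" using elim UV[OF w] V_\<phi>[of \<omega> x] by auto
      then have "U \<omega> / p \<omega> = x \<omega>" using p_pos[of \<omega>] by (auto simp: field_simps)
      then show "x \<omega> = y \<omega>" unfolding y_def eR[OF w] by simp
    qed
  qed
  have bc': "c 0 * y 0 = c L * y L"
  proof -
    have "U L = exp \<theta> * C" using UV[of L] L bc by (simp add: S_def)
    then show ?thesis using eR[of 0] eR[of L] p_eq[of 0] p_eq[of L] c_pos[of 0] c_pos[of L] L
      by (simp add: y_def U0 Q_0 \<theta>_def)
  qed
  \<comment> \<open>The identity holds at every point of [0,L]: g is given by the product-rule
    formula with u = - (p / c) z inserted, which only has to be solved for z.\<close>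
  have zz: "ae_eq_on L z (\<lambda>s. - (dc s * y s + c s * g s) - q s * y s)"
    unfolding ae_eq_on_def
  proof (intro AE_I2 impI)
    fix s assume s: "s \<in> {0..L}"
    have cp: "c s \<noteq> 0" "p s \<noteq> 0" using c_pos[OF s] p_pos[of s] by auto
    show "z s = - (dc s * y s + c s * g s) - q s * y s"
      using cp by (simp add: g_def y_def u_def \<rho>_def eR[OF s] field_simps)
  qed
  show ?thesis unfolding gen_def using H xy bc' zz by blast
qed

text \<open>\<open>CL_dom\<close> names no image. One in L2 exists automatically, since the
  representative y is continuous, hence bounded, and dc and q are essentially bounded.\<close>

lemma gen_dom_iff:
  "L2_on L x \<and> (\<exists>z. L2_on L z \<and> gen x z) \<longleftrightarrow> CL_dom c L x"
proof
  assume "CL_dom c L x"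
  then obtain y g where x: "L2_on L x" and H: "H1_rep L y g" "ae_eq_on L x y" "c 0 * y 0 = c L * y L"
    by (auto simp: CL_dom_def)
  have y: "primitive_on L y g" and g: "L2_on L g" using H(1) by (auto simp: H1_rep_iff_primitive_on[symmetric])
  have y2: "L2_on L y" by (rule L2_on_continuous[OF primitive_on_continuous[OF y]])
  have "L2_on L (\<lambda>s. dc s * y s)"
    by (rule L2_on_mult[OF y2 _ dc_bound]) (simp add: set_borel_measurable_def)
  moreover have "L2_on L (\<lambda>s. c s * g s)" by (rule L2_on_mult_continuous[OF g c_cont])
  moreover have "L2_on L (\<lambda>s. q s * y s)"
    by (rule L2_on_mult[OF y2, where K=1]) (use q_bound in \<open>auto simp: set_borel_measurable_def\<close>)
  ultimately have "L2_on L (\<lambda>s. (-1) * (dc s * y s + c s * g s) - q s * y s)"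
    by (intro L2_on_diff L2_on_cmult L2_on_add)
  then have "L2_on L (\<lambda>s. - (dc s * y s + c s * g s) - q s * y s)" by simp
  then show "L2_on L x \<and> (\<exists>z. L2_on L z \<and> gen x z)"
    using x H unfolding gen_def ae_eq_on_def by blast
qed (auto simp: CL_dom_def gen_def)

end

section \<open>The semigroup on L2 and its generator\<close>

locale damped_transport = transport +
  fixes \<alpha> \<beta> :: real
  assumes part: "\<And>x y. 0 \<le> x \<Longrightarrow> x \<le> y \<Longrightarrow> y \<le> L \<Longrightarrow> Q y - Q x \<ge> \<alpha> * (\<phi> y - \<phi> x) - \<beta>"
    and full: "\<theta> \<ge> \<alpha> * S" and \<beta>: "\<beta> \<ge> 0"
begin

lemma T_L2: "0 \<le> t \<Longrightarrow> L2_on L x \<Longrightarrow> L2_on L (T t x)"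
  using T_decay(1)[OF part full \<beta>] by blast

lemma T_bound: "0 \<le> t \<Longrightarrow> L2_on L x \<Longrightarrow>
    L2norm L (T t x) \<le> sqrt (cmax / cmin) * exp (2 * \<beta>) * exp (- \<alpha> * t) * L2norm L x"
  using T_decay(2)[OF part full \<beta>] by blast

text \<open>V is linear and turns T h into translation, so it carries the difference quotient of x
  to that of V x; the norm equivalence for fixed L transfers the limit both ways.\<close>

lemma generator_iff:
  assumes x: "L2_on L x" and z: "L2_on L z"
  shows "((\<lambda>h. L2norm L (\<lambda>s. (T h x s - x s) / h - z s)) \<longlongrightarrow> 0) (at_right 0) \<longleftrightarrow> gen x z"
proof -
  obtain K where K: "K > 0"
    and K1: "\<And>x. L2_on L x \<Longrightarrow> (LINT s:{0..S}|lborel. (V x s)\<^sup>2) \<le> K * (L2norm L x)\<^sup>2"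
    and K2: "\<And>x. L2_on L x \<Longrightarrow> (L2norm L x)\<^sup>2 \<le> K * (LINT s:{0..S}|lborel. (V x s)\<^sup>2)"
    using norm_equivalence by metis
  define d where "d = (\<lambda>h s. (T h x s - x s) / h - z s)"
  define E where "E = (\<lambda>h. LINT s:{0..S}|lborel. ((V x (s - h) - V x s) / h - V z s)\<^sup>2)"
  \<comment> \<open>Nested linear combinations, so that \<open>V_lin\<close> applies to each
    layer.\<close>
  have dlin: "d h = (\<lambda>s. (1 / h) * (1 * T h x s + (-1) * x s) + (-1) * z s)" for h
    by (simp add: d_def fun_eq_iff)
  have d2: "L2_on L (d h)" if "h > 0" for h
    unfolding dlin using that x z T_L2[of h x] by (intro L2_on_lin) auto
  have Vd: "V (d h) = (\<lambda>s. (V x (s - h) - V x s) / h - V z s)" for h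
    unfolding dlin V_lin[abs_def] V_T by (simp add: fun_eq_iff)
  have pos: "\<forall>\<^sub>F h in at_right (0::real). h > 0" by (simp add: eventually_at_right_less)
  have "((\<lambda>h. L2norm L (d h)) \<longlongrightarrow> 0) (at_right 0) \<longleftrightarrow> ((\<lambda>h. (L2norm L (d h))\<^sup>2) \<longlongrightarrow> 0) (at_right 0)"
    by (simp only: sq_tendsto_zero_iff)
  also have "\<dots> \<longleftrightarrow> (E \<longlongrightarrow> 0) (at_right 0)"
  proof
    assume "((\<lambda>h. (L2norm L (d h))\<^sup>2) \<longlongrightarrow> 0) (at_right 0)"
    then have l: "((\<lambda>h. K * (L2norm L (d h))\<^sup>2) \<longlongrightarrow> 0) (at_right 0)" using tendsto_mult_right_zero by blast
    show "(E \<longlongrightarrow> 0) (at_right 0)"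
    proof (rule tendsto_sandwich[OF _ _ tendsto_const l])
      show "\<forall>\<^sub>F h in at_right 0. E h \<le> K * (L2norm L (d h))\<^sup>2"
        using pos by eventually_elim (use K1[OF d2] in \<open>simp add: E_def Vd\<close>)
    qed (simp add: E_def set_integral_nonneg_all)
  next
    assume "(E \<longlongrightarrow> 0) (at_right 0)"
    then have l: "((\<lambda>h. K * E h) \<longlongrightarrow> 0) (at_right 0)" using tendsto_mult_right_zero by blast
    show "((\<lambda>h. (L2norm L (d h))\<^sup>2) \<longlongrightarrow> 0) (at_right 0)"
    proof (rule tendsto_sandwich[OF _ _ tendsto_const l])
      show "\<forall>\<^sub>F h in at_right 0. (L2norm L (d h))\<^sup>2 \<le> K * E h"
        using pos by eventually_elim (use K2[OF d2] in \<open>simp add: E_def Vd\<close>)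
    qed simp
  qed
  also have "\<dots> \<longleftrightarrow> gen x z"
    unfolding E_def using gen_imp_V_limit[OF x z] V_limit_imp_gen[OF x z] by blast
  finally show ?thesis by (simp add: d_def)
qed

lemma T_strongly_continuous:
  assumes x: "L2_on L x"
  shows "((\<lambda>t. L2norm L (\<lambda>s. T t x s - x s)) \<longlongrightarrow> 0) (at_right 0)"
proof -
  obtain K where K: "K > 0"
    and K2: "\<And>x. L2_on L x \<Longrightarrow> (L2norm L x)\<^sup>2 \<le> K * (LINT s:{0..S}|lborel. (V x s)\<^sup>2)"
    using norm_equivalence by metis
  have Vd: "V (\<lambda>s. T h x s - x s) = (\<lambda>s. V x (s - h) - V x s)" for h
    using V_lin[of 1 "T h x" "-1" x] by (simp add: V_T fun_eq_iff)
  have "((\<lambda>h. LINT s:{0..S}|lborel. (V x (s - h) - V x s)\<^sup>2) \<longlongrightarrow> 0) (at_right 0)"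
    using x by (intro tendsto_L2_translation S V_meas V_sq_symmetric_interval) (auto simp: L2_on_def)
  then have l: "((\<lambda>h. K * (LINT s:{0..S}|lborel. (V x (s - h) - V x s)\<^sup>2)) \<longlongrightarrow> 0) (at_right 0)"
    using tendsto_mult_right_zero by blast
  have pos: "\<forall>\<^sub>F h in at_right (0::real). h > 0" by (simp add: eventually_at_right_less)
  have "((\<lambda>t. (L2norm L (\<lambda>s. T t x s - x s))\<^sup>2) \<longlongrightarrow> 0) (at_right 0)"
  proof (rule tendsto_sandwich[OF _ _ tendsto_const l])
    show "\<forall>\<^sub>F h in at_right 0. (L2norm L (\<lambda>s. T h x s - x s))\<^sup>2 \<le> K * (LINT s:{0..S}|lborel. (V x (s - h) - V x s)\<^sup>2)"
      using pos
    proof eventually_elim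
      case (elim h)
      then have "L2_on L (\<lambda>s. T h x s - x s)" using x T_L2[of h x] by (intro L2_on_diff) auto
      from K2[OF this] show ?case by (simp add: Vd)
    qed
  qed simp
  then show ?thesis by (simp only: sq_tendsto_zero_iff)
qed

lemma T_semigroup: "C0_semigroup_gen L T (CL_dom c L) gen"
  unfolding C0_semigroup_gen_def
proof (intro conjI allI impI)
  fix t :: real and x assume "0 \<le> t" "L2_on L x" then show "L2_on L (T t x)" by (rule T_L2)
next
  fix t :: real and x y assume t: "0 \<le> t" and x: "L2_on L x" and y: "L2_on L y" and xy: "ae_eq_on L x y"
  \<comment> \<open>T t acts on functions pointwise; that it respects equality almost everywhere
    follows from linearity and the norm bound applied to the difference.\<close>
  have d: "L2_on L (\<lambda>s. x s - y s)" using x y by (rule L2_on_diff)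
  have 1: "T t (\<lambda>s. x s - y s) = (\<lambda>s. T t x s - T t y s)" using T_lin[of t 1 x "-1" y] by simp
  have "L2norm L (\<lambda>s. T t x s - T t y s) \<le> 0"
    using T_bound[OF t d] L2norm_zero_if_ae_eq_on[OF d xy] by (simp add: 1)
  then have "L2norm L (\<lambda>s. T t x s - T t y s) = 0"
    by (rule order_antisym) (simp add: L2norm_def set_integral_nonneg_all)
  then show "ae_eq_on L (T t x) (T t y)"
    by (rule ae_eq_on_if_L2norm_zero[rotated]) (intro L2_on_diff T_L2 t x y)
next
  fix t :: real and a b :: real and x y
  show "ae_eq_on L (T t (\<lambda>s. a * x s + b * y s)) (\<lambda>s. a * T t x s + b * T t y s)"
    by (simp add: T_lin ae_eq_on_def)
next
  fix t :: real assume t: "0 \<le> t"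
  show "\<exists>C. \<forall>x. L2_on L x \<longrightarrow> L2norm L (T t x) \<le> C * L2norm L x"
    using T_bound[OF t] by blast
next
  fix x show "ae_eq_on L (T 0 x) x"
    unfolding ae_eq_on_def using AE_not_L by eventually_elim (simp add: T_0)
next
  fix t s :: real and x show "ae_eq_on L (T (t + s) x) (T t (T s x))"
    by (simp add: T_add ae_eq_on_def)
next
  fix x assume "L2_on L x"
  then show "((\<lambda>t. L2norm L (\<lambda>s. T t x s - x s)) \<longlongrightarrow> 0) (at_right 0)" by (rule T_strongly_continuous)
next
  fix x
  show "CL_dom c L x \<longleftrightarrow> L2_on L x \<and> (\<exists>z. L2_on L z \<and>
         ((\<lambda>h. L2norm L (\<lambda>s. (T h x s - x s) / h - z s)) \<longlongrightarrow> 0) (at_right 0))"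
    using generator_iff gen_dom_iff by blast
next
  fix x z assume "CL_dom c L x" "L2_on L z"
  then show "gen x z \<longleftrightarrow> ((\<lambda>h. L2norm L (\<lambda>s. (T h x s - x s) / h - z s)) \<longlongrightarrow> 0) (at_right 0)"
    using generator_iff by (auto simp: CL_dom_def)
qed

end

section \<open>Coverage by the control region\<close>

lemma set_integrable_indicator_Icc:
  assumes "Om \<in> sets borel"
  shows "set_integrable lborel {x..y::real} (indicator Om :: real \<Rightarrow> real)"
  by (rule set_integrable_bound[OF set_integrable_const_Icc[of x y 1]])
    (use assms in \<open>auto simp: set_borel_measurable_def\<close>)

lemma measure_Int_Icc:
  assumes "Om \<in> sets borel"
  shows "measure lborel (Om \<inter> {x..y::real}) = (LINT s:{x..y}|lborel. indicator Om s)"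
proof -
  have "(LINT s:{x..y}|lborel. indicator Om s) = (LINT s|lborel. indicator (Om \<inter> {x..y}) s)"
    unfolding set_lebesgue_integral_def by (intro Bochner_Integration.integral_cong) (auto simp: indicator_def)
  also have "\<dots> = measure lborel (Om \<inter> {x..y} \<inter> space lborel)" by (rule Bochner_Integration.integral_indicator)
  finally show ?thesis by simp
qed

lemma measure_Int_Icc_split:
  assumes "Om \<in> sets borel" "x \<le> y" "y \<le> (z::real)"
  shows "measure lborel (Om \<inter> {x..z}) = measure lborel (Om \<inter> {x..y}) + measure lborel (Om \<inter> {y..z})"
  unfolding measure_Int_Icc[OF assms(1)]
  by (rule set_integral_split_Icc[OF assms(2,3) set_integrable_indicator_Icc[OF assms(1)]])

lemma measure_Int_Icc_le:
  assumes "Om \<in> sets borel" "x \<le> (y::real)"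
  shows "measure lborel (Om \<inter> {x..y}) \<le> y - x"
proof -
  have "measure lborel (Om \<inter> {x..y}) \<le> measure lborel {x..y}"
    using assms by (intro measure_mono_fmeasurable) (auto simp: fmeasurable_def)
  then show ?thesis using assms by simp
qed

lemma measure_Int_Icc_sub:
  assumes "Om \<in> sets borel" "x \<le> (y::real)" "{x..y} \<subseteq> Om"
  shows "measure lborel (Om \<inter> {x..y}) = y - x"
proof -
  have "Om \<inter> {x..y} = {x..y}" using assms by auto
  then show ?thesis using assms by simp
qed

text \<open>From the end of one interval to the start of a later one, the gap condition says that K
  times the covered length is at least k times the distance minus 1, which gives density k / K. The
  constant collects 1 / K from that inequality and 1 / k three times: for the gap behind b m, and
  for each of the two end blocks.\<close>

lemma coverage_of_gap_condition:
  fixes a b :: "nat \<Rightarrow> real"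
  defines "Om \<equiv> Omega_o a b"
  assumes a0: "a 0 = 0" and ab: "\<And>j. a j < b j \<and> b j \<le> a (Suc j)" and unb: "\<And>r. \<exists>j. a j > r"
    and K: "K > k" "k > 0"
    and gap: "\<And>m n. m \<le> n \<Longrightarrow> k * (a n - b m) - (\<Sum>j\<in>{m<..<n}. K * (b j - a j)) \<le> 1"
    and xy: "0 \<le> x" "x \<le> y"
  shows "measure lborel (Om \<inter> {x..y}) \<ge> k / K * (y - x) - (1 / K + 3 / k)"
proof -
  have Om: "Om \<in> sets borel" unfolding Om_def Omega_o_def by auto
  let ?m = "\<lambda>x y. measure lborel (Om \<inter> {x..y})"
  have l: "0 < k / K" "k / K < 1" using K by auto
  have sub: "{a j..b j} \<subseteq> Om" for j unfolding Om_def Omega_o_def by auto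
  have nn: "?m s t \<ge> 0" for s t by simp
  have amono: "a i \<le> a j" if "i \<le> j" for i j
    using that by (rule lift_Suc_mono_le[rotated]) (meson ab less_imp_le order_trans)
  have ba: "b i \<le> a j" if "i < j" for i j
    using amono[of "Suc i" j] ab[of i] that by simp
  \<comment> \<open>With n = m + 1 the sum is empty, which bounds every single gap.\<close>
  have small_gap: "a (Suc j) - b j \<le> 1 / k" for j
  proof -
    have "{j<..<Suc j} = {}" by auto
    then have "k * (a (Suc j) - b j) \<le> 1" using gap[of j "Suc j"] by simp
    then show ?thesis using K by (simp add: field_simps)
  qed
  have sum_le: "(\<Sum>j\<in>{m<..<n}. b j - a j) \<le> ?m (b m) (a n)" if "m < n" for m n
    using that
  proof (induction n)
    case (Suc n)
    show ?case
    proof (cases "m = n")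
      case True
      have "{n<..<Suc n} = {}" by auto
      then show ?thesis using True by simp
    next
      case False
      then have mn: "m < n" using Suc by simp
      then have "{m<..<Suc n} = insert n {m<..<n}" by auto
      then have "(\<Sum>j\<in>{m<..<Suc n}. b j - a j) = (b n - a n) + (\<Sum>j\<in>{m<..<n}. b j - a j)" by simp
      also have "\<dots> \<le> ?m (a n) (b n) + ?m (b m) (a n)"
        using Suc.IH[OF mn] measure_Int_Icc_sub[OF Om _ sub, of n] ab[of n] by simp
      also have "\<dots> = ?m (b m) (b n)"
        using measure_Int_Icc_split[OF Om, of "b m" "a n" "b n"] ba[OF mn] ab[of n] by simp
      also have "\<dots> \<le> ?m (b m) (a (Suc n))"
        using measure_Int_Icc_split[OF Om, of "b m" "b n" "a (Suc n)"] ba[OF mn] ab[of n] by simp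
      finally show ?thesis .
    qed
  qed simp
  have block: "?m s t \<ge> (t - s) - 1 / k" if st: "a j \<le> s" "s \<le> t" "t \<le> a (Suc j)" for j s t
  proof -
    \<comment> \<open>The point where the covered part of [s,t] ends; if s already lies in the gap,
      u = s.\<close>
    define u where "u = max s (min t (b j))"
    have u: "s \<le> u" "u \<le> t" using st by (auto simp: u_def)
    have 1: "?m s t = ?m s u + ?m u t" by (rule measure_Int_Icc_split[OF Om u])
    have 2: "t - u \<le> 1 / k" using small_gap[of j] st ab[of j] K by (auto simp: u_def max_def min_def)
    have 3: "?m s u \<ge> u - s"
    proof (cases "s \<le> b j")
      case True
      then have "{s..u} \<subseteq> {a j..b j}" using st by (auto simp: u_def)
      then have "{s..u} \<subseteq> Om" using sub[of j] by blast
      then show ?thesis using measure_Int_Icc_sub[OF Om u(1)] by simp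
    next
      case False then show ?thesis by (simp add: u_def)
    qed
    show ?thesis using 1 2 3 nn[of u t] by linarith
  qed
  have far: "?m (a (Suc m)) (a n) \<ge> k / K * (a n - a (Suc m)) - (1 / K + 1 / k)" if "m < n" for m n
  proof -
    have "k * (a n - b m) - K * (\<Sum>j\<in>{m<..<n}. b j - a j) \<le> 1" using gap[of m n] that by (simp add: sum_distrib_left)
    moreover have "K * (\<Sum>j\<in>{m<..<n}. b j - a j) \<le> K * ?m (b m) (a n)"
      using sum_le[OF that] K by (intro mult_left_mono) auto
    ultimately have "k * (a n - b m) - 1 \<le> K * ?m (b m) (a n)" by linarith
    then have "(k * (a n - b m) - 1) / K \<le> ?m (b m) (a n)" using K by (simp add: pos_divide_le_eq mult.commute)
    then have 1: "?m (b m) (a n) \<ge> k / K * (a n - b m) - 1 / K" by (simp add: diff_divide_distrib)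
    have 2: "?m (b m) (a n) = ?m (b m) (a (Suc m)) + ?m (a (Suc m)) (a n)"
      using ab[of m] amono[of "Suc m" n] that by (intro measure_Int_Icc_split[OF Om]) auto
    have 3: "?m (b m) (a (Suc m)) \<le> 1 / k"
      using measure_Int_Icc_le[OF Om, of "b m" "a (Suc m)"] ab[of m] small_gap[of m] by simp
    have 4: "k / K * (a n - a (Suc m)) \<le> k / K * (a n - b m)"
      using l ab[of m] by (intro mult_left_mono) auto
    show ?thesis using 1 2 3 4 by linarith
  qed
  have index: "\<exists>j. a j \<le> s \<and> s \<le> a (Suc j)" if s: "0 \<le> s" for s
  proof -
    \<comment> \<open>The first starting point beyond s cannot be a 0 = 0 <= s, so its index has a
      predecessor.\<close>
    define i where "i = (LEAST j. a j > s)"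
    have i: "a i > s" unfolding i_def using unb[of s] by (rule LeastI_ex)
    then obtain j where j: "i = Suc j" using a0 s by (cases i) auto
    have "\<not> a j > s" using not_less_Least[of j "\<lambda>j. a j > s"] j by (simp add: i_def)
    then show ?thesis using i j by (intro exI[of _ j]) auto
  qed
  obtain m where m: "a m \<le> x" "x \<le> a (Suc m)" using index[of x] xy by auto
  obtain n where n: "a n \<le> y" "y \<le> a (Suc n)" using index[of y] xy by auto
  have shrink: "k / K * d \<le> d" if "d \<ge> 0" for d
    using mult_right_mono[of "k / K" 1 d] l that by simp
  have pos: "1 / K > 0" "1 / k > 0" "3 / k = 3 * (1 / k)" using K by auto
  show ?thesis
  \<comment> \<open>Either one block contains both points, or [x,y] is cut at a (Suc m) and a n;
    since k / K < 1, the end blocks meet the same density up to one gap each.\<close>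
  proof (cases "y \<le> a (Suc m)")
    case True
    show ?thesis using block[OF m(1) xy(2) True] shrink[of "y - x"] xy pos by linarith
  next
    case False
    have mn: "m < n"
    proof (rule ccontr)
      assume "\<not> m < n"
      then have "a (Suc n) \<le> a (Suc m)" by (intro amono) auto
      then show False using False n by linarith
    qed
    have 0: "a (Suc m) \<le> a n" using mn by (intro amono) auto
    have "?m x y = ?m x (a (Suc m)) + ?m (a (Suc m)) y"
      by (rule measure_Int_Icc_split[OF Om m(2)]) (use False in simp)
    moreover have "?m (a (Suc m)) y = ?m (a (Suc m)) (a n) + ?m (a n) y"
      by (rule measure_Int_Icc_split[OF Om 0 n(1)])
    moreover have "?m x (a (Suc m)) \<ge> (a (Suc m) - x) - 1 / k" by (rule block[OF m order_refl])
    moreover have "?m (a n) y \<ge> (y - a n) - 1 / k" by (rule block[OF order_refl n])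
    moreover note far[OF mn]
    moreover have "k / K * (a (Suc m) - x) \<le> a (Suc m) - x" "k / K * (y - a n) \<le> y - a n"
      by (rule shrink; use m n in simp)+
    moreover have "k / K * (y - x) = k / K * (y - a n) + k / K * (a n - a (Suc m)) + k / K * (a (Suc m) - x)"
      unfolding distrib_left[symmetric] by simp
    ultimately show ?thesis using pos by linarith
  qed
qed

section \<open>From coverage to damping uniform in L\<close>

lemma (in transport) Q_increase_ge_measure:
  assumes q: "q = indicator Om" and Om: "Om \<in> sets borel" and xy: "0 \<le> x" "x \<le> y" "y \<le> L"
  shows "Q y - Q x \<ge> measure lborel (Om \<inter> {x..y}) / cmax"
proof -
  have "measure lborel (Om \<inter> {x..y}) / cmax = (LINT s:{x..y}|lborel. indicator Om s / cmax)"
    unfolding measure_Int_Icc[OF Om] by simp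
  also have "\<dots> \<le> (LINT s:{x..y}|lborel. q s / c s)"
  proof (rule set_integral_mono)
    show "set_integrable lborel {x..y} (\<lambda>s. indicator Om s / cmax)"
      using set_integrable_indicator_Icc[OF Om] by simp
    show "set_integrable lborel {x..y} (\<lambda>s. q s / c s)"
      by (rule primitive_onD(2)[OF Q_prim xy])
    fix s assume "s \<in> {x..y}"
    then have "s \<in> {0..L}" using xy by auto
    then show "indicator Om s / cmax \<le> q s / c s"
      using c_le[of s] c_pos[of s] by (auto simp: q indicator_def intro!: divide_left_mono)
  qed
  also have "\<dots> = Q y - Q x" by (rule primitive_onD(1)[OF Q_prim xy, symmetric])
  finally show ?thesis .
qed

lemma (in transport) S_le: "S \<le> L / cmin"
  using \<phi>_diff_le[of 0 L] L by (simp add: S_def \<phi>_0)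

theorem mainTheorem14:
  fixes c dc :: "real \<Rightarrow> real" and cmin cmax :: real
    and a b :: "nat \<Rightarrow> real" and \<gamma> :: real
  assumes cmin_pos: "cmin > 0" and cmax_pos: "cmax > 0"
    and c_bounds: "\<forall>\<omega>\<ge>0. cmin \<le> c \<omega> \<and> c \<omega> \<le> cmax"
    and dc_meas: "dc \<in> borel_measurable lborel"
    and dc_L2: "set_integrable lborel {0..} (\<lambda>\<omega>. (dc \<omega>)\<^sup>2)"
    and dc_Linf: "\<exists>B. AE \<omega> in lborel. \<omega> \<ge> 0 \<longrightarrow> \<bar>dc \<omega>\<bar> \<le> B"
    and c_H1: "\<forall>\<omega>\<ge>0. c \<omega> = c 0 + (LINT \<tau>:{0..\<omega>}|lborel. dc \<tau>)"
    and a0: "a 0 = 0"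
    and ab: "\<forall>j. a j < b j \<and> b j \<le> a (Suc j)"
    and a_unbdd: "\<forall>R. \<exists>j. a j > R"
    and geom: "(\<exists>K k. K > k \<and> k > 0 \<and>
                  (\<forall>m n. m \<le> n \<longrightarrow>
                     k * (a n - b m) - (\<Sum>j\<in>{m<..<n}. K * (b j - a j)) \<le> 1))
             \<or> (\<exists>c0 c1. c0 > 0 \<and> c1 > 0 \<and>
                  (\<forall>\<alpha> \<beta>. 0 \<le> \<alpha> \<longrightarrow> \<alpha> \<le> \<beta> \<longrightarrow>
                     measure lborel (Omega_o a b \<inter> {\<alpha>..\<beta>}) \<ge> c1 * (\<beta> - \<alpha>) - c0) \<and>
                  (\<forall>L>0. measure lborel (Omega_o a b \<inter> {0..L}) > 0))"
    and gamma_pos: "\<gamma> > 0"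
  shows "\<exists>kB :: real \<Rightarrow> real. kB \<in> borel_measurable lborel \<and> (\<exists>B. \<forall>\<omega>>0. \<bar>kB \<omega>\<bar> \<le> B) \<and>
           (\<exists>M \<kappa>. M > 0 \<and> \<kappa> > 0 \<and>
             (\<forall>L\<ge>\<gamma>. \<exists>T. C0_semigroup_gen L T (CL_dom c L) (CL_op c dc kB (Omega_o a b) L) \<and>
                (\<forall>t\<ge>0. \<forall>x. L2_on L x \<longrightarrow>
                    L2norm L (T t x) \<le> M * exp (- \<kappa> * t) * L2norm L x)))"
proof -
  let ?Om = "Omega_o a b"
  have Om: "?Om \<in> sets borel" unfolding Omega_o_def by auto
  have "\<exists>c0 c1. c0 > 0 \<and> c1 > 0 \<and> (\<forall>x y. 0 \<le> x \<longrightarrow> x \<le> y \<longrightarrow>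
      measure lborel (?Om \<inter> {x..y}) \<ge> c1 * (y - x) - c0)"
    using geom
  proof (elim disjE exE conjE)
    fix K k assume K: "k < K" "0 < k" and gap: "\<forall>m n. m \<le> n \<longrightarrow>
                     k * (a n - b m) - (\<Sum>j\<in>{m<..<n}. K * (b j - a j)) \<le> 1"
    show ?thesis
    proof -
      have "k / K * (y - x) - (1 / K + 3 / k) \<le> measure lborel (?Om \<inter> {x..y})" if "0 \<le> x" "x \<le> y" for x y
        by (rule coverage_of_gap_condition[where a=a and b=b, OF a0 _ _ K]) (use ab a_unbdd gap that in auto)
      moreover have "1 / K + 3 / k > 0" "k / K > 0" using K by (auto intro!: add_pos_pos)
      ultimately show ?thesis by blast
    qed
  qed blast
  then obtain c0 c1 where c01: "c0 > 0" "c1 > 0"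
    and cov: "\<And>x y. 0 \<le> x \<Longrightarrow> x \<le> y \<Longrightarrow> measure lborel (?Om \<inter> {x..y}) \<ge> c1 * (y - x) - c0"
    by blast
  obtain B where B: "AE \<omega> in lborel. \<omega> \<ge> 0 \<longrightarrow> \<bar>dc \<omega>\<bar> \<le> B" using dc_Linf by blast
  \<comment> \<open>The part of the first control interval that lies in [0,L] for every L >=
    \<gamma>.\<close>
  define \<mu> where "\<mu> = min \<gamma> (b 0)"
  have \<mu>: "\<mu> > 0" using gamma_pos ab[rule_format, of 0] a0 by (simp add: \<mu>_def)
  \<comment> \<open>Density c1 guarantees damping c1 * cmin / cmax per unit of time, up to a
    constant. Half of this rate is given up so that for L >= 2 * c0 / c1 the loss c0 on a full lap
    is paid from the other half. For smaller L the lap takes at most (2 * c0 / c1) / cmin, and the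
    factor \<mu> / c0 makes \<kappa> times this equal to at most \<mu> / cmax, the damping secured
    by the first interval.\<close>
  define \<kappa> where "\<kappa> = c1 * cmin / (2 * cmax) * min 1 (\<mu> / c0)"
  have \<kappa>: "\<kappa> > 0" unfolding \<kappa>_def using c01 cmin_pos cmax_pos \<mu> by simp
  have \<kappa>1: "\<kappa> \<le> c1 * cmin / (2 * cmax)"
    unfolding \<kappa>_def using c01 cmin_pos cmax_pos \<mu> by (intro mult_left_le) auto
  have \<kappa>2: "\<kappa> \<le> c1 * cmin / (2 * cmax) * (\<mu> / c0)"
    unfolding \<kappa>_def using c01 cmin_pos cmax_pos by (intro mult_left_mono) auto
  \<comment> \<open>The prefactor of \<open>T_decay\<close> for the loss \<beta> = c0 / cmax, free
    of L.\<close>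
  define M where "M = sqrt (cmax / cmin) * exp (2 * (c0 / cmax))"
  have M: "M > 0" unfolding M_def using cmin_pos cmax_pos by simp
  have main: "\<exists>T. C0_semigroup_gen L T (CL_dom c L) (CL_op c dc (\<lambda>_. 1) ?Om L) \<and>
                (\<forall>t\<ge>0. \<forall>x. L2_on L x \<longrightarrow> L2norm L (T t x) \<le> M * exp (- \<kappa> * t) * L2norm L x)"
    if L\<gamma>: "L \<ge> \<gamma>" for L
  proof -
    have Lpos: "L > 0" using L\<gamma> gamma_pos by simp
    have dc2: "set_integrable lborel {0..L} (\<lambda>\<omega>. (dc \<omega>)\<^sup>2)"
      by (rule set_integrable_subset[OF dc_L2]) auto
    have dcm: "dc \<in> borel_measurable borel" using dc_meas by simp
    interpret tr: transport c dc "indicator ?Om" L cmin cmax B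
    proof
      show "AE \<omega> in lborel. \<omega> \<in> {0..L} \<longrightarrow> \<bar>dc \<omega>\<bar> \<le> B" using B by eventually_elim auto
      have "set_integrable lborel {0..L} dc"
        by (rule set_integrable_if_sq_Icc[OF _ dc2]) (use dcm in \<open>simp add: set_borel_measurable_def\<close>)
      then show "primitive_on L c dc" unfolding primitive_on_def using c_H1 by (meson atLeastAtMost_iff)
    qed (use Lpos cmin_pos c_bounds dcm Om in \<open>auto simp: indicator_def\<close>)
    have Qge: "tr.Q y - tr.Q x \<ge> measure lborel (?Om \<inter> {x..y}) / cmax" if "0 \<le> x" "x \<le> y" "y \<le> L" for x y
      by (rule tr.Q_increase_ge_measure[OF refl Om that])
    interpret dt: damped_transport c dc "indicator ?Om" L cmin cmax B \<kappa> "c0 / cmax"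
    proof
      fix x y assume xy: "0 \<le> x" "x \<le> y" "y \<le> L"
      have d: "0 \<le> tr.\<phi> y - tr.\<phi> x" using tr.\<phi>_mono[OF xy] by simp
      \<comment> \<open>Travel time is at most length / cmin and damping at least covered length /
        cmax, so on part of a lap the loss is c0 / cmax.\<close>
      have "\<kappa> * (tr.\<phi> y - tr.\<phi> x) \<le> c1 * cmin / cmax * (tr.\<phi> y - tr.\<phi> x)"
      proof (rule mult_right_mono[OF _ d])
        have "c1 * cmin / (2 * cmax) \<le> c1 * cmin / cmax"
          using c01 cmin_pos cmax_pos by (intro divide_left_mono) auto
        then show "\<kappa> \<le> c1 * cmin / cmax" using \<kappa>1 by simp
      qed
      also have "\<dots> = c1 / cmax * (cmin * (tr.\<phi> y - tr.\<phi> x))" by simp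
      also have "\<dots> \<le> c1 / cmax * (y - x)"
        using tr.\<phi>_diff_le[OF xy] cmin_pos cmax_pos c01 by (intro mult_left_mono) (auto simp: field_simps)
      finally have "\<kappa> * (tr.\<phi> y - tr.\<phi> x) - c0 / cmax \<le> (c1 * (y - x) - c0) / cmax"
        by (simp add: diff_divide_distrib)
      also have "\<dots> \<le> measure lborel (?Om \<inter> {x..y}) / cmax"
        using cov[OF xy(1,2)] cmax_pos by (intro divide_right_mono) auto
      also have "\<dots> \<le> tr.Q y - tr.Q x" by (rule Qge[OF xy])
      finally show "\<kappa> * (tr.\<phi> y - tr.\<phi> x) - c0 / cmax \<le> tr.Q y - tr.Q x" .
    next
      have \<theta>: "measure lborel (?Om \<inter> {0..L}) / cmax \<le> tr.\<theta>"
        using Qge[of 0 L] Lpos by (simp add: tr.\<theta>_def tr.Q_0)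
      have "\<kappa> * tr.S \<le> \<kappa> * (L / cmin)" using tr.S_le \<kappa> by (intro mult_left_mono) auto
      also have "\<dots> \<le> measure lborel (?Om \<inter> {0..L}) / cmax"
      proof (cases "L \<ge> 2 * c0 / c1")
        case True
        have "\<kappa> * (L / cmin) \<le> c1 * cmin / (2 * cmax) * (L / cmin)"
          using \<kappa>1 Lpos cmin_pos by (intro mult_right_mono) auto
        also have "\<dots> = (c1 * L / 2) / cmax" using cmin_pos by simp
        also have "\<dots> \<le> (c1 * (L - 0) - c0) / cmax"
          using True c01 cmax_pos by (intro divide_right_mono) (auto simp: field_simps)
        also have "\<dots> \<le> measure lborel (?Om \<inter> {0..L}) / cmax"
          using cov[of 0 L] Lpos cmax_pos by (intro divide_right_mono) auto
        finally show ?thesis .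
      next
        case False
        have "\<kappa> * (L / cmin) \<le> (c1 * cmin / (2 * cmax) * (\<mu> / c0)) * ((2 * c0 / c1) / cmin)"
          using \<kappa>2 \<kappa> False Lpos cmin_pos by (intro mult_mono divide_right_mono) auto
        also have "\<dots> = \<mu> / cmax" using cmin_pos c01 cmax_pos by (simp add: field_simps)
        also have "\<dots> \<le> measure lborel (?Om \<inter> {0..L}) / cmax"
        proof (rule divide_right_mono)
          have "{0..\<mu>} \<subseteq> {a 0..b 0}" by (auto simp: \<mu>_def a0)
          then have "{0..\<mu>} \<subseteq> ?Om" unfolding Omega_o_def by blast
          then have "measure lborel (?Om \<inter> {0..\<mu>}) = \<mu>" using measure_Int_Icc_sub[OF Om, of 0 \<mu>] \<mu> by simp
          then show "\<mu> \<le> measure lborel (?Om \<inter> {0..L})"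
            using measure_Int_Icc_split[OF Om, of 0 \<mu> L] \<mu> L\<gamma> by (simp add: \<mu>_def)
        qed (use cmax_pos in simp)
        finally show ?thesis .
      qed
      finally show "\<kappa> * tr.S \<le> tr.\<theta>" using \<theta> by simp
    qed (use c01 cmax_pos in simp)
    \<comment> \<open>Equality of the two relations: on [0,L] the truncation of the region is
      invisible and the gain is 1.\<close>
    have "tr.gen = CL_op c dc (\<lambda>_. 1) ?Om L"
    proof -
      have "ae_eq_on L z (\<lambda>s. - (dc s * y s + c s * g s) - indicator ?Om s * y s)
         = ae_eq_on L z (\<lambda>s. - (dc s * y s + c s * g s) - indicator (?Om \<inter> {0..L}) s * 1 * y s)" for y g z
        unfolding ae_eq_on_def by (intro AE_cong) (auto simp: indicator_def)
      then show ?thesis by (intro ext) (simp add: tr.gen_def CL_op_def)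
    qed
    then show ?thesis using dt.T_semigroup dt.T_bound by (intro exI[of _ tr.T]) (auto simp: M_def)
  qed
  have "(\<lambda>_. 1 :: real) \<in> borel_measurable lborel" by simp
  moreover have "\<exists>C. \<forall>\<omega>>0::real. \<bar>1 :: real\<bar> \<le> C" by (rule exI[of _ 1]) simp
  ultimately show ?thesis using M \<kappa> main by blast
qed

end
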